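(* Let $n,t\ge1$ and $d\ge2$ be integers, let $u$ be a $t$-spread monomial of degree $d$ of $S=K[x_1,\dots,x_n]$ with $\min(u)=1$, and let $T=(\mathcal{L}_t^f(u))$ be the final $t$-spread lexsegment ideal of $S$ determined by $u$. Then $\mathrm{pd}(S/T)=n-(d-1)t$, $\mathrm{depth}(S/T)=(d-1)t$ and $$\dim(S/T)=\begin{cases}(d-1)t & \text{if } u=x_1x_{1+t}\cdots x_{1+(d-1)t},\\ 1+(d-1)t & \text{otherwise}.\end{cases}$$
   Context: $S=K[x_1,\dots,x_n]$ is a standard graded polynomial ring over a field $K$; $\mathrm{pd}$ is projective dimension over $S$ and $\dim$ is Krull dimension. $\min(u)$ is the smallest index of a variable dividing $u$. For $t\ge1$, a monomial $x_{i_1}\cdots x_{i_d}$ with $i_1\le\dots\le i_d$ is $t$-spread if $i_{r+1}-i_r\ge t$ for $r=1,\dots,d-1$. $M_{n,d,t}$ is the set of $t$-spread monomials of degree $d$ of $S$. For squarefree monomials of the same degree, $x_{i_1}\cdots x_{i_d}>_{\mathrm{slex}}x_{j_1}\cdots x_{j_d}$ (indices increasing) if for some $s$ one has $i_1=j_1,\dots,i_{s-1}=j_{s-1}$ and $i_s<j_s$. For $u\in M_{n,d,t}$, $\mathcal{L}_t^f(u)=\{w\in M_{n,d,t}: w\le_{\mathrm{slex}}u\}$, and $(\mathcal{L}_t^f(u))$ is the ideal of $S$ it generates. *)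

theory Defs
  imports
    "HOL-Algebra.QuotRing"
    "HOL-Algebra.Module"
    "HOL-Library.Poly_Mapping"
    "HOL-Library.Extended_Nat"
begin

section \<open>Modules and homological invariants\<close>

definition module_hom ::
  "('a, 'r) ring_scheme \<Rightarrow> ('a, 'b, 'm) module_scheme \<Rightarrow> ('a, 'c, 'n) module_scheme \<Rightarrow> ('b \<Rightarrow> 'c) set"
  where "module_hom R M N =
    {f. f \<in> carrier M \<rightarrow> carrier N \<and>
        (\<forall>x\<in>carrier M. \<forall>y\<in>carrier M. f (x \<oplus>\<^bsub>M\<^esub> y) = f x \<oplus>\<^bsub>N\<^esub> f y) \<and>
        (\<forall>a\<in>carrier R. \<forall>x\<in>carrier M. f (a \<odot>\<^bsub>M\<^esub> x) = a \<odot>\<^bsub>N\<^esub> f x)}"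

definition module_ker ::
  "('a, 'b, 'm) module_scheme \<Rightarrow> ('a, 'c, 'n) module_scheme \<Rightarrow> ('b \<Rightarrow> 'c) \<Rightarrow> 'b set"
  where "module_ker M N f = {x \<in> carrier M. f x = \<zero>\<^bsub>N\<^esub>}"

text \<open>The record type of modules extends that of rings. The fields \<^const>\<open>mult\<close> and
  \<^const>\<open>one\<close> play no role for modules and are left undefined where they have no natural value.\<close>

definition quot_module :: "('a, 'r) ring_scheme \<Rightarrow> 'a set \<Rightarrow> ('a, 'a set) module"
  where "quot_module R I =
    \<lparr>carrier = carrier (R Quot I), mult = mult (R Quot I), one = one (R Quot I),
     zero = zero (R Quot I), add = add (R Quot I),
     smult = (\<lambda>a X. (I +>\<^bsub>R\<^esub> a) \<otimes>\<^bsub>R Quot I\<^esub> X)\<rparr>"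

definition free_module :: "('a, 'r) ring_scheme \<Rightarrow> 'b set \<Rightarrow> ('a, 'b \<Rightarrow> 'a) module"
  where "free_module R B =
    \<lparr>carrier = {f. (\<forall>b\<in>B. f b \<in> carrier R) \<and> (\<forall>b. b \<notin> B \<longrightarrow> f b = \<zero>\<^bsub>R\<^esub>) \<and>
                   finite {b. f b \<noteq> \<zero>\<^bsub>R\<^esub>}},
     mult = undefined, one = undefined,
     zero = (\<lambda>b. \<zero>\<^bsub>R\<^esub>), add = (\<lambda>f g b. f b \<oplus>\<^bsub>R\<^esub> g b),
     smult = (\<lambda>a f b. a \<otimes>\<^bsub>R\<^esub> f b)\<rparr>"

text \<open>A module is projective iff it is (isomorphic to) a direct summand of a free module.
  Taking the basis inside the type of elements of the module is no restriction: if \<open>P\<close> is a direct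
  summand of some free module, then the canonical surjection onto \<open>P\<close> from the free module on the
  set \<open>carrier P\<close> splits.\<close>

definition projective :: "('a, 'r) ring_scheme \<Rightarrow> ('a, 'b, 'm) module_scheme \<Rightarrow> bool"
  where "projective R P \<longleftrightarrow> Module.module R P \<and>
    (\<exists>(B :: 'b set) \<iota> \<pi>. \<iota> \<in> module_hom R P (free_module R B) \<and>
       \<pi> \<in> module_hom R (free_module R B) P \<and> (\<forall>x\<in>carrier P. \<pi> (\<iota> x) = x))"

text \<open>Existence of a projective resolution
  \<open>0 \<rightarrow> P p \<rightarrow> \<dots> \<rightarrow> P 1 \<rightarrow> P 0 \<rightarrow> M \<rightarrow> 0\<close>, continued by zero modules.
  The carriers of the modules \<open>P i\<close> live in the type \<open>'b \<times> nat \<Rightarrow> 'a\<close>, but their operations are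
  arbitrary, so that up to isomorphism all modules of at most the cardinality of that type are
  available. This is no restriction: if \<open>M\<close> has a projective resolution of length \<open>p\<close>, it has one
  whose modules have cardinality at most \<open>max(|R|, |M|, \<aleph>\<^sub>0)\<close> (use free covers on all elements
  and stop with the \<open>p\<close>-th syzygy, which is projective by Schanuel's lemma).\<close>

definition has_projective_resolution ::
  "('a, 'r) ring_scheme \<Rightarrow> ('a, 'b, 'm) module_scheme \<Rightarrow> nat \<Rightarrow> bool"
  where "has_projective_resolution R M p \<longleftrightarrow>
    (\<exists>(P :: nat \<Rightarrow> ('a, 'b \<times> nat \<Rightarrow> 'a) module) \<epsilon> \<delta>.
       (\<forall>i. projective R (P i)) \<and>
       (\<forall>i>p. carrier (P i) = {\<zero>\<^bsub>P i\<^esub>}) \<and>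
       \<epsilon> \<in> module_hom R (P 0) M \<and> \<epsilon> ` carrier (P 0) = carrier M \<and>
       (\<forall>i. \<delta> i \<in> module_hom R (P (Suc i)) (P i)) \<and>
       \<delta> 0 ` carrier (P (Suc 0)) = module_ker (P 0) M \<epsilon> \<and>
       (\<forall>i. \<delta> (Suc i) ` carrier (P (Suc (Suc i))) = module_ker (P (Suc i)) (P i) (\<delta> i)))"

text \<open>The infimum of the empty set is \<^term>\<open>\<infinity>\<close>. For the zero module, the value below is \<open>0\<close>.\<close>

definition proj_dim :: "('a, 'r) ring_scheme \<Rightarrow> ('a, 'b, 'm) module_scheme \<Rightarrow> enat"
  where "proj_dim R M = Inf {enat p |p. has_projective_resolution R M p}"

text \<open>The submodule \<open>(a\<^sub>1, \<dots>, a\<^sub>r) M\<close>.\<close>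

definition seq_smult :: "('a, 'b, 'm) module_scheme \<Rightarrow> 'a list \<Rightarrow> 'b set"
  where "seq_smult M as =
    {finsum M (\<lambda>j. as ! j \<odot>\<^bsub>M\<^esub> f j) {..<length as} |f. f \<in> {..<length as} \<rightarrow> carrier M}"

text \<open>\<open>as ! i\<close> is a nonzerodivisor on \<open>M / (as ! 0, \<dots>, as ! (i - 1)) M\<close>,
  expressed by representatives in \<open>M\<close>, and \<open>M \<noteq> (as) M\<close>.\<close>

definition regular_sequence ::
  "('a, 'r) ring_scheme \<Rightarrow> ('a, 'b, 'm) module_scheme \<Rightarrow> 'a list \<Rightarrow> bool"
  where "regular_sequence R M as \<longleftrightarrow> set as \<subseteq> carrier R \<and>
    (\<forall>i<length as. \<forall>x\<in>carrier M.
       as ! i \<odot>\<^bsub>M\<^esub> x \<in> seq_smult M (take i as) \<longrightarrow> x \<in> seq_smult M (take i as)) \<and>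
    seq_smult M as \<noteq> carrier M"

definition depth_wrt ::
  "('a, 'r) ring_scheme \<Rightarrow> 'a set \<Rightarrow> ('a, 'b, 'm) module_scheme \<Rightarrow> enat"
  where "depth_wrt R I M = Sup {enat (length as) |as. set as \<subseteq> I \<and> regular_sequence R M as}"

text \<open>Suprema are taken in \<^typ>\<open>enat\<close>, so the zero ring gets dimension \<open>0\<close>.\<close>

definition krull_dim :: "('a, 'r) ring_scheme \<Rightarrow> enat"
  where "krull_dim R = Sup {enat k |k.
    \<exists>\<pp> :: nat \<Rightarrow> 'a set. (\<forall>i\<le>k. primeideal (\<pp> i) R) \<and> (\<forall>i<k. \<pp> i \<subset> \<pp> (Suc i))}"

section \<open>Polynomial rings\<close>

text \<open>A monomial is encoded by its exponent vector \<^typ>\<open>nat \<Rightarrow>\<^sub>0 nat\<close>, a polynomial by its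
  finitely supported coefficient function on monomials. The variables of \<open>K[x\<^sub>1, \<dots>, x\<^sub>n]\<close> are
  indexed by \<open>{1..n}\<close>.\<close>

type_synonym monomial = "nat \<Rightarrow>\<^sub>0 nat"
type_synonym 'k polynomial = "monomial \<Rightarrow>\<^sub>0 'k"

definition poly_ring :: "nat \<Rightarrow> 'k::field polynomial ring"
  where "poly_ring n =
    \<lparr>carrier = {p. \<forall>m\<in>Poly_Mapping.keys p. Poly_Mapping.keys m \<subseteq> {1..n}},
     mult = (*), one = 1, zero = 0, add = (+)\<rparr>"

definition monomial_poly :: "monomial \<Rightarrow> 'k::field polynomial"
  where "monomial_poly m = Poly_Mapping.single m 1"

definition irrelevant_ideal :: "nat \<Rightarrow> 'k::field polynomial set"
  where "irrelevant_ideal n =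
    Idl\<^bsub>poly_ring n\<^esub> ((\<lambda>i. monomial_poly (Poly_Mapping.single i 1)) ` {1..n})"

text \<open>Depth of a (finitely generated graded) module over \<open>K[x\<^sub>1, \<dots>, x\<^sub>n]\<close>, that is, with respect
  to the graded maximal ideal.\<close>

definition depth :: "nat \<Rightarrow> ('k::field polynomial, 'b, 'm) module_scheme \<Rightarrow> enat"
  where "depth n M = depth_wrt (poly_ring n) (irrelevant_ideal n) M"

section \<open>Final t-spread lexsegment ideals\<close>

text \<open>The monomial with the given list of indices of variables.\<close>

definition monomial_of :: "nat list \<Rightarrow> monomial"
  where "monomial_of is = (\<Sum>i\<leftarrow>is. Poly_Mapping.single i 1)"

definition spread_monomials :: "nat \<Rightarrow> nat \<Rightarrow> nat \<Rightarrow> monomial set"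
  where "spread_monomials n d t =
    {monomial_of is |is. length is = d \<and> set is \<subseteq> {1..n} \<and> sorted is \<and>
       (\<forall>r. Suc r < d \<longrightarrow> is ! Suc r \<ge> is ! r + t)}"

definition min_var :: "monomial \<Rightarrow> nat"
  where "min_var u = Min (Poly_Mapping.keys u)"

definition slex_greater :: "monomial \<Rightarrow> monomial \<Rightarrow> bool"  (infix \<open>>\<^sub>s\<^sub>l\<^sub>e\<^sub>x\<close> 50)
  where "u >\<^sub>s\<^sub>l\<^sub>e\<^sub>x v \<longleftrightarrow>
    (\<exists>is js. sorted_wrt (<) is \<and> sorted_wrt (<) js \<and> length is = length js \<and>
       u = monomial_of is \<and> v = monomial_of js \<and>
       (\<exists>s<length is. take s is = take s js \<and> is ! s < js ! s))"

definition final_lexsegment :: "nat \<Rightarrow> nat \<Rightarrow> nat \<Rightarrow> monomial \<Rightarrow> monomial set"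
  where "final_lexsegment n d t u = {w \<in> spread_monomials n d t. w = u \<or> u >\<^sub>s\<^sub>l\<^sub>e\<^sub>x w}"

definition final_lexsegment_ideal ::
  "nat \<Rightarrow> nat \<Rightarrow> nat \<Rightarrow> monomial \<Rightarrow> 'k::field polynomial set"
  where "final_lexsegment_ideal n d t u =
    Idl\<^bsub>poly_ring n\<^esub> (monomial_poly ` final_lexsegment n d t u)"

end

theory Submission
  imports Defs "HOL-Library.Function_Algebras"
begin

text \<open>
  Put \<open>D = (d - 1) t\<close>. Taking the colon ideal by \<open>x\<^sub>n\<close> or adding \<open>x\<^sub>n\<close> turns a final lexsegment ideal
  (more generally, any ideal generated by a componentwise upward closed set of \<open>t\<close>-spread monomials)
  into an ideal of the same kind with smaller parameters. Hence \<open>S/T\<close> has a filtration with factors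
  \<open>K[V]\<close>, \<open>|V| \<ge> D\<close>. By the horseshoe lemma and the resolution of \<open>K[V]\<close> of length \<open>n - |V|\<close>, the
  projective dimension is at most \<open>n - D\<close>; the elementary symmetric polynomials of degrees
  \<open>D, \<dots>, 1\<close> form a regular sequence on every factor, hence on \<open>S/T\<close>, so the depth is at least \<open>D\<close>.

  For the opposite bounds, \<open>F = {n - D + 1, \<dots>, n}\<close> is a facet of the complex of \<open>T\<close>, so the monomial
  \<open>x\<^sub>F\<close> is annihilated in \<open>S/T\<close> exactly by the prime \<open>P\<close> generated by the other \<open>n - D\<close> variables.
  As these form a regular sequence on all projective modules, a socle element modulo initial
  segments of it can be chased through any resolution, whose length is therefore at least \<open>n - D\<close>.
  Conversely, more than \<open>D\<close> elements are algebraically dependent modulo \<open>P\<close>; applied to high powers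
  of a regular sequence, this would put \<open>x\<^sub>F\<close> into \<open>T\<close> plus a high power of the irrelevant ideal.
  The same argument along a chain of primes bounds the Krull dimension by the largest size of
  a face, which is read off the lexicographic order.
\<close>

section \<open>Projective dimension bounded below by a regular sequence\<close>

text \<open>Elementary symmetric polynomials in all n variables serve every factor
  \<open>K[V]\<close> at once, because modulo the variables outside \<open>V\<close> they become the
  elementary symmetric polynomials of \<open>V\<close>. Depth and projective dimension are computed
  separately, not one from the other by the Auslander-Buchsbaum formula. The lower bound for
  resolutions only uses that projective modules inherit regularity from the ring, so it applies to
  an arbitrary projective resolution, minimal or not. The constant D is the threshold for fitting a
  monomial: the indices of a \<open>t\<close>-spread monomial of degree \<open>d\<close> span at
  least D + 1 consecutive numbers, so D consecutive variables carry none, while any D + 1 variables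
  carry one (take every t-th). The condition min(u) = 1 enters twice. It puts u componentwise below
  x_i x_{n-(d-2)t} ... x_n for every i \<le> n - D, which makes F a facet; and it puts every spread
  monomial without x_1 into the lexsegment, so that only the vertex 1 can enlarge a face beyond
  D.\<close>

primrec seq_sub ::
  "('a, 'b, 'm) module_scheme \<Rightarrow> (nat \<Rightarrow> 'a) \<Rightarrow> 'b set \<Rightarrow> nat \<Rightarrow> 'b set" where
  "seq_sub M x U 0 = {\<zero>\<^bsub>M\<^esub>}"
| "seq_sub M x U (Suc k) = {a \<oplus>\<^bsub>M\<^esub> x k \<odot>\<^bsub>M\<^esub> b |a b. a \<in> seq_sub M x U k \<and> b \<in> U}"

lemma seq_sub_SucI:
  "a \<in> seq_sub M x U k \<Longrightarrow> b \<in> U \<Longrightarrow> a \<oplus>\<^bsub>M\<^esub> x k \<odot>\<^bsub>M\<^esub> b \<in> seq_sub M x U (Suc k)"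
  by auto

text \<open>Weakly, because \<open>U\<close> may equal (x)U: zero modules occur in a resolution.
  \<open>U\<close> is a subset of a fixed \<open>M\<close>, so that images and kernels of the maps
  of a resolution need no records of their own.\<close>

definition weakly_regular_on ::
  "('a, 'b, 'm) module_scheme \<Rightarrow> (nat \<Rightarrow> 'a) \<Rightarrow> 'b set \<Rightarrow> nat \<Rightarrow> bool" where
  "weakly_regular_on M x U k \<longleftrightarrow>
     (\<forall>j<k. \<forall>u\<in>U. x j \<odot>\<^bsub>M\<^esub> u \<in> seq_sub M x U j \<longrightarrow> u \<in> seq_sub M x U j)"

definition regular_module :: "('a, 'r) ring_scheme \<Rightarrow> ('a, 'a) module" where
  "regular_module R = \<lparr>carrier = carrier R, mult = mult R, one = one R,
     zero = zero R, add = add R, smult = mult R\<rparr>"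

lemma regular_module_simps [simp]:
  "carrier (regular_module R) = carrier R" "zero (regular_module R) = zero R"
  "add (regular_module R) = add R" "smult (regular_module R) = mult R"
  by (simp_all add: regular_module_def)

lemma free_module_simps:
  "carrier (free_module R B) = {f. (\<forall>b\<in>B. f b \<in> carrier R) \<and> (\<forall>b. b \<notin> B \<longrightarrow> f b = \<zero>\<^bsub>R\<^esub>) \<and>
                   finite {b. f b \<noteq> \<zero>\<^bsub>R\<^esub>}}"
  "zero (free_module R B) = (\<lambda>b. \<zero>\<^bsub>R\<^esub>)"
  "add (free_module R B) = (\<lambda>f g b. f b \<oplus>\<^bsub>R\<^esub> g b)"
  "smult (free_module R B) = (\<lambda>a f b. a \<otimes>\<^bsub>R\<^esub> f b)"
  by (simp_all add: free_module_def)

lemma (in cring) free_module_carrier: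
  "f \<in> carrier (free_module R B) \<longleftrightarrow>
    (\<forall>b. f b \<in> carrier R) \<and> (\<forall>b. b \<notin> B \<longrightarrow> f b = \<zero>) \<and> finite {b. f b \<noteq> \<zero>}"
  by (auto simp: free_module_simps)

lemma (in cring) free_module_module: "Module.module R (free_module R B)"
proof (rule moduleI)
  note [simp] = free_module_carrier free_module_simps(2-)
  have fin: "finite {b. h b \<noteq> \<zero>}"
    if "finite {b. f b \<noteq> \<zero>}" "finite {b. g b \<noteq> \<zero>}" "\<And>b. f b = \<zero> \<Longrightarrow> g b = \<zero> \<Longrightarrow> h b = \<zero>"
    for f g h :: "'c \<Rightarrow> 'a"
    by (rule finite_subset[of _ "{b. f b \<noteq> \<zero>} \<union> {b. g b \<noteq> \<zero>}"]) (use that in auto)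
  show "abelian_group (free_module R B)"
  proof (rule abelian_groupI)
    fix f assume f: "f \<in> carrier (free_module R B)"
    then have "(\<lambda>b. \<ominus> f b) \<in> carrier (free_module R B)" using fin[of f f] by auto
    then show "\<exists>g\<in>carrier (free_module R B). g \<oplus>\<^bsub>free_module R B\<^esub> f = \<zero>\<^bsub>free_module R B\<^esub>"
      using f by (intro bexI[of _ "\<lambda>b. \<ominus> f b"]) (auto simp: l_neg)
  next
    fix f g assume "f \<in> carrier (free_module R B)" "g \<in> carrier (free_module R B)"
    then show "f \<oplus>\<^bsub>free_module R B\<^esub> g \<in> carrier (free_module R B)" using fin[of f g] by auto
  qed (auto simp: a_ac)
  fix a f assume "a \<in> carrier R" "f \<in> carrier (free_module R B)"
  then show "a \<odot>\<^bsub>free_module R B\<^esub> f \<in> carrier (free_module R B)" using fin[of f f] by auto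
qed (auto simp: free_module_carrier free_module_simps(2-) cring_axioms l_distr r_distr m_assoc)

lemma module_homD:
  assumes "f \<in> module_hom R M N"
  shows "x \<in> carrier M \<Longrightarrow> f x \<in> carrier N"
    and "x \<in> carrier M \<Longrightarrow> y \<in> carrier M \<Longrightarrow> f (x \<oplus>\<^bsub>M\<^esub> y) = f x \<oplus>\<^bsub>N\<^esub> f y"
    and "a \<in> carrier R \<Longrightarrow> x \<in> carrier M \<Longrightarrow> f (a \<odot>\<^bsub>M\<^esub> x) = a \<odot>\<^bsub>N\<^esub> f x"
  using assms by (auto simp: module_hom_def)

lemma module_hom_zero:
  assumes "Module.module R M" "Module.module R N" "f \<in> module_hom R M N"
  shows "f \<zero>\<^bsub>M\<^esub> = \<zero>\<^bsub>N\<^esub>"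
proof -
  interpret M: Module.module R M by fact
  interpret N: Module.module R N by fact
  have "f (\<zero>\<^bsub>R\<^esub> \<odot>\<^bsub>M\<^esub> \<zero>\<^bsub>M\<^esub>) = \<zero>\<^bsub>R\<^esub> \<odot>\<^bsub>N\<^esub> f \<zero>\<^bsub>M\<^esub>"
    by (rule module_homD(3)[OF assms(3)]) simp_all
  then show ?thesis using module_homD(1)[OF assms(3)] by simp
qed

lemma module_hom_minus:
  assumes "Module.module R M" "Module.module R N" "f \<in> module_hom R M N" "x \<in> carrier M"
  shows "f (\<ominus>\<^bsub>M\<^esub> x) = \<ominus>\<^bsub>N\<^esub> f x"
proof -
  interpret M: Module.module R M by fact
  interpret N: Module.module R N by fact
  have "f (\<ominus>\<^bsub>M\<^esub> x) \<oplus>\<^bsub>N\<^esub> f x = \<zero>\<^bsub>N\<^esub>"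
    using module_homD(2)[OF assms(3), of "\<ominus>\<^bsub>M\<^esub> x" x] assms(4)
      module_hom_zero[OF assms(1-3)] by (simp add: M.M.l_neg)
  then show ?thesis
    using module_homD(1)[OF assms(3)] assms(4) by (simp add: N.M.minus_equality)
qed

lemma module_ker_submodule:
  assumes "Module.module R M" "Module.module R N" "f \<in> module_hom R M N"
  shows "submodule (module_ker M N f) R M"
proof -
  interpret M: Module.module R M by fact
  interpret N: Module.module R N by fact
  show ?thesis
    by (rule M.submoduleI)
      (auto simp: module_ker_def module_hom_zero[OF assms] module_hom_minus[OF assms]
        module_homD[OF assms(3)])
qed

context Module.module
begin

lemma submodule_zero: "submodule H R M \<Longrightarrow> \<zero>\<^bsub>M\<^esub> \<in> H"
  using subgroup.one_closed[OF submodule.axioms(1), of H R M] by simp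

lemma carrier_submodule: "submodule (carrier M) R M"
  by (rule submoduleI) auto

lemma seq_sub_submodule:
  assumes U: "submodule U R M" and x: "\<And>i. x i \<in> carrier R"
  shows "submodule (seq_sub M x U k) R M \<and> seq_sub M x U k \<subseteq> U"
proof (induction k)
  case 0
  show ?case using submodule_zero[OF U] by (auto intro!: submoduleI)
next
  case (Suc k)
  note UE = submoduleE[OF U] and SE = submoduleE[OF conjunct1[OF Suc]]
  have sc: "a \<in> carrier M" if "a \<in> seq_sub M x U k" for a using SE(1) that by blast
  have uc: "a \<in> carrier M" if "a \<in> U" for a using UE(1) that by blast
  have z: "\<zero>\<^bsub>M\<^esub> \<in> U" "\<zero>\<^bsub>M\<^esub> \<in> seq_sub M x U k"
    using submodule_zero U Suc by blast+
  show ?case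
  proof (intro conjI submoduleI)
    show "seq_sub M x U (Suc k) \<subseteq> carrier M" using x sc uc by auto
    show "\<zero>\<^bsub>M\<^esub> \<in> seq_sub M x U (Suc k)"
      using z x by (auto intro!: exI[of _ "\<zero>\<^bsub>M\<^esub>"])
    show "seq_sub M x U (Suc k) \<subseteq> U" using Suc UE x by auto
  next
    fix a assume "a \<in> seq_sub M x U (Suc k)"
    then obtain b c where bc: "a = b \<oplus>\<^bsub>M\<^esub> x k \<odot>\<^bsub>M\<^esub> c" "b \<in> seq_sub M x U k" "c \<in> U" by auto
    have "\<ominus>\<^bsub>M\<^esub> a = (\<ominus>\<^bsub>M\<^esub> b) \<oplus>\<^bsub>M\<^esub> x k \<odot>\<^bsub>M\<^esub> (\<ominus>\<^bsub>M\<^esub> c)"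
      using bc sc uc x by (simp add: M.minus_add smult_r_minus)
    then show "\<ominus>\<^bsub>M\<^esub> a \<in> seq_sub M x U (Suc k)"
      using seq_sub_SucI[OF SE(3)[OF bc(2)] UE(3)[OF bc(3)]] by simp
    fix a' assume "a' \<in> seq_sub M x U (Suc k)"
    then obtain b' c' where bc': "a' = b' \<oplus>\<^bsub>M\<^esub> x k \<odot>\<^bsub>M\<^esub> c'" "b' \<in> seq_sub M x U k" "c' \<in> U" by auto
    have "a \<oplus>\<^bsub>M\<^esub> a' = (b \<oplus>\<^bsub>M\<^esub> b') \<oplus>\<^bsub>M\<^esub> x k \<odot>\<^bsub>M\<^esub> (c \<oplus>\<^bsub>M\<^esub> c')"
      using bc bc' sc uc x by (simp add: smult_r_distr M.a_ac)
    then show "a \<oplus>\<^bsub>M\<^esub> a' \<in> seq_sub M x U (Suc k)"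
      using seq_sub_SucI[OF SE(5)[OF bc(2) bc'(2)] UE(5)[OF bc(3) bc'(3)]] by simp
  next
    fix r a assume r: "r \<in> carrier R" and "a \<in> seq_sub M x U (Suc k)"
    then obtain b c where bc: "a = b \<oplus>\<^bsub>M\<^esub> x k \<odot>\<^bsub>M\<^esub> c" "b \<in> seq_sub M x U k" "c \<in> U" by auto
    have "r \<odot>\<^bsub>M\<^esub> a = r \<odot>\<^bsub>M\<^esub> b \<oplus>\<^bsub>M\<^esub> x k \<odot>\<^bsub>M\<^esub> (r \<odot>\<^bsub>M\<^esub> c)"
      using bc sc uc x r by (simp add: smult_r_distr smult_assoc1[symmetric] R.m_comm)
    then show "r \<odot>\<^bsub>M\<^esub> a \<in> seq_sub M x U (Suc k)"
      using seq_sub_SucI[OF SE(4)[OF r bc(2)] UE(4)[OF r bc(3)]] by simp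
  qed
qed

lemma seq_sub_mono: "U \<subseteq> W \<Longrightarrow> seq_sub M x U k \<subseteq> seq_sub M x W k"
  by (induction k) auto

end

lemma seq_sub_image:
  assumes "Module.module R M" "Module.module R N" and f: "f \<in> module_hom R M N"
    and x: "\<And>i. x i \<in> carrier R" and W: "submodule W R M"
  shows "f ` seq_sub M x W k = seq_sub N x (f ` W) k"
proof -
  interpret M: Module.module R M by fact
  interpret N: Module.module R N by fact
  note F = module_homD[OF f]
  have Wc: "W \<subseteq> carrier M" using M.submoduleE(1)[OF W] .
  have Sc: "seq_sub M x W k \<subseteq> carrier M" for k
    using M.seq_sub_submodule[where x = x, OF W x] Wc by blast
  show ?thesis
  proof (induction k)
    case 0
    then show ?case using module_hom_zero[OF assms(1-3)] by simp
  next
    case (Suc k)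
    have eq: "f (a \<oplus>\<^bsub>M\<^esub> x k \<odot>\<^bsub>M\<^esub> b) = f a \<oplus>\<^bsub>N\<^esub> x k \<odot>\<^bsub>N\<^esub> f b" if "a \<in> seq_sub M x W k" "b \<in> W" for a b
      using F x Sc[of k] Wc that by (simp add: subset_iff)
    show ?case
    proof (intro equalityI subsetI)
      fix v assume "v \<in> f ` seq_sub M x W (Suc k)"
      then obtain a b where ab: "v = f (a \<oplus>\<^bsub>M\<^esub> x k \<odot>\<^bsub>M\<^esub> b)" "a \<in> seq_sub M x W k" "b \<in> W"
        by auto
      then have "f a \<in> seq_sub N x (f ` W) k" "f b \<in> f ` W" using Suc by auto
      then show "v \<in> seq_sub N x (f ` W) (Suc k)"
        unfolding ab(1) eq[OF ab(2,3)] by (rule seq_sub_SucI)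
    next
      fix v assume "v \<in> seq_sub N x (f ` W) (Suc k)"
      then obtain a' b where "v = a' \<oplus>\<^bsub>N\<^esub> x k \<odot>\<^bsub>N\<^esub> f b" "a' \<in> f ` seq_sub M x W k" "b \<in> W"
        unfolding seq_sub.simps Suc by blast
      then obtain a where "v = f a \<oplus>\<^bsub>N\<^esub> x k \<odot>\<^bsub>N\<^esub> f b" "a \<in> seq_sub M x W k" "b \<in> W"
        by blast
      then have "v = f (a \<oplus>\<^bsub>M\<^esub> x k \<odot>\<^bsub>M\<^esub> b)" "a \<oplus>\<^bsub>M\<^esub> x k \<odot>\<^bsub>M\<^esub> b \<in> seq_sub M x W (Suc k)"
        using eq by auto
      then show "v \<in> f ` seq_sub M x W (Suc k)" by blast
    qed
  qed
qed

text \<open>One step 0 -> K -> P -> U -> 0 of a resolution. The image \<open>U\<close> sits in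
  \<open>N\<close> and the kernel \<open>K\<close> in \<open>P\<close>, so by exactness the
  \<open>K\<close> of one step is the \<open>U\<close> of the next.\<close>

locale syzygy_step =
  P: Module.module R P + N: Module.module R N
  for R (structure) and P :: "('a, 'b, 'm) module_scheme" and N :: "('a, 'c, 'n) module_scheme" +
  fixes f :: "'b \<Rightarrow> 'c" and x :: "nat \<Rightarrow> 'a"
  assumes f: "f \<in> module_hom R P N" and x: "\<And>i. x i \<in> carrier R"
begin

abbreviation "U \<equiv> f ` carrier P"
abbreviation "K \<equiv> module_ker P N f"

lemmas F = module_homD[OF f]
lemmas f_zero = module_hom_zero[OF P.module_axioms N.module_axioms f]
lemmas f_minus = module_hom_minus[OF P.module_axioms N.module_axioms f]
lemmas K_sub = module_ker_submodule[OF P.module_axioms N.module_axioms f]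
lemmas image_P = seq_sub_image[where x = x, OF P.module_axioms N.module_axioms f x P.carrier_submodule]
lemmas SP = P.seq_sub_submodule[where x = x, OF P.carrier_submodule x]
lemmas SPE = P.submoduleE[OF conjunct1[OF SP]]
lemmas SK = P.seq_sub_submodule[where x = x, OF K_sub x]
lemmas SKE = P.submoduleE[OF conjunct1[OF SK]]
lemmas KE = P.submoduleE[OF K_sub]

lemma lift_mod_ker:
  assumes "y \<in> carrier P" "f y \<in> seq_sub N x U k"
  shows "\<exists>q w. q \<in> seq_sub P x (carrier P) k \<and> w \<in> K \<and> y = q \<oplus>\<^bsub>P\<^esub> w"
proof -
  obtain q where q: "q \<in> seq_sub P x (carrier P) k" "f y = f q"
    using assms(2) by (auto simp: image_P[symmetric])
  have qc: "q \<in> carrier P" using q SPE(1) by blast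
  have "f (y \<oplus>\<^bsub>P\<^esub> \<ominus>\<^bsub>P\<^esub> q) = \<zero>\<^bsub>N\<^esub>"
    using q(2) qc assms(1) F by (simp add: f_minus N.M.r_neg)
  then have "y \<oplus>\<^bsub>P\<^esub> \<ominus>\<^bsub>P\<^esub> q \<in> K" using qc assms(1) by (simp add: module_ker_def)
  moreover have "y = q \<oplus>\<^bsub>P\<^esub> (y \<oplus>\<^bsub>P\<^esub> \<ominus>\<^bsub>P\<^esub> q)"
    using qc assms(1) by (metis P.M.a_lcomm P.M.a_inv_closed P.M.r_neg P.M.r_zero)
  ultimately show ?thesis using q(1) by blast
qed

text \<open>This is the vanishing of \<open>Tor\<^sub>1(R/(x\<^sub>0, \<dots>, x\<^sub>k\<^sub>-\<^sub>1), U)\<close>.\<close>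

lemma seq_sub_ker:
  assumes "weakly_regular_on N x U k" "v \<in> seq_sub P x (carrier P) k" "v \<in> K"
  shows "v \<in> seq_sub P x K k"
  using assms
proof (induction k arbitrary: v)
  case (Suc k)
  from Suc.prems(1) have reg: "weakly_regular_on N x U k"
    by (simp add: weakly_regular_on_def)
  obtain a b where ab: "v = a \<oplus>\<^bsub>P\<^esub> x k \<odot>\<^bsub>P\<^esub> b" "a \<in> seq_sub P x (carrier P) k" "b \<in> carrier P"
    using Suc.prems(2) by auto
  have ac: "a \<in> carrier P" using ab SPE(1) by blast
  have "f a \<oplus>\<^bsub>N\<^esub> x k \<odot>\<^bsub>N\<^esub> f b = \<zero>\<^bsub>N\<^esub>"
    using Suc.prems(3) ab ac F x by (simp add: module_ker_def)
  then have "x k \<odot>\<^bsub>N\<^esub> f b = f (\<ominus>\<^bsub>P\<^esub> a)"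
    using ac ab F x by (simp add: f_minus) (metis N.M.minus_equality N.M.minus_minus N.M.a_comm N.smult_closed)
  then have "x k \<odot>\<^bsub>N\<^esub> f b \<in> seq_sub N x U k"
    using SPE(3)[OF ab(2)] image_P by auto
  then have "f b \<in> seq_sub N x U k"
    using Suc.prems(1) ab(3) by (auto simp: weakly_regular_on_def)
  then obtain q w where qw: "q \<in> seq_sub P x (carrier P) k" "w \<in> K" "b = q \<oplus>\<^bsub>P\<^esub> w"
    using lift_mod_ker ab(3) by blast
  have qc: "q \<in> carrier P" "w \<in> carrier P" using qw SPE(1) KE(1) by blast+
  \<comment> \<open>Only the kernel part \<open>w\<close> of \<open>b\<close> stays behind
    \<open>x k\<close>. The term \<open>x k q\<close> joins the first \<open>k\<close> terms, and
    their sum differs from \<open>v\<close> by an element of \<open>K\<close>, so the induction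
    hypothesis applies to it.\<close>
  have v: "v = (a \<oplus>\<^bsub>P\<^esub> x k \<odot>\<^bsub>P\<^esub> q) \<oplus>\<^bsub>P\<^esub> x k \<odot>\<^bsub>P\<^esub> w"
    using ab(1) qw(3) qc ac x by (simp add: P.smult_r_distr P.M.a_assoc)
  have m: "a \<oplus>\<^bsub>P\<^esub> x k \<odot>\<^bsub>P\<^esub> q \<in> seq_sub P x (carrier P) k"
    using SPE(4,5) ab(2) qw(1) x by blast
  have "a \<oplus>\<^bsub>P\<^esub> x k \<odot>\<^bsub>P\<^esub> q = v \<oplus>\<^bsub>P\<^esub> \<ominus>\<^bsub>P\<^esub> (x k \<odot>\<^bsub>P\<^esub> w)"
    unfolding v using ac qc x by (simp add: P.M.a_assoc P.M.r_neg)
  then have "a \<oplus>\<^bsub>P\<^esub> x k \<odot>\<^bsub>P\<^esub> q \<in> K"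
    using KE(5)[OF Suc.prems(3) KE(3)[OF KE(4)[OF x qw(2)]]] by simp
  then have "a \<oplus>\<^bsub>P\<^esub> x k \<odot>\<^bsub>P\<^esub> q \<in> seq_sub P x K k" using Suc.IH reg m by blast
  then show ?case using v qw(2) by auto
qed auto

text \<open>By \<open>seq_sub_ker\<close>, (x_0, ..., x_{i-1})P meets \<open>K\<close> in (x_0, ...,
  x_{i-1})K, hence regularity on \<open>P\<close> restricts to \<open>K\<close>. This needs
  regularity of \<open>U\<close> only for i \<le> j, so each syzygy gains one element.\<close>

lemma syzygy_regular:
  assumes "weakly_regular_on N x U j" "weakly_regular_on P x (carrier P) (Suc j)"
  shows "weakly_regular_on P x K (Suc j)"
  unfolding weakly_regular_on_def
proof (intro allI ballI impI)
  fix i u assume i: "i < Suc j" and u: "u \<in> K" "x i \<odot>\<^bsub>P\<^esub> u \<in> seq_sub P x K i"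
  have "u \<in> carrier P" using u KE(1) by blast
  moreover have "x i \<odot>\<^bsub>P\<^esub> u \<in> seq_sub P x (carrier P) i"
    using u(2) P.seq_sub_mono[OF KE(1)] by blast
  ultimately have "u \<in> seq_sub P x (carrier P) i"
    using assms(2) i by (auto simp: weakly_regular_on_def)
  moreover have "weakly_regular_on N x U i"
    using assms(1) i by (auto simp: weakly_regular_on_def)
  ultimately show "u \<in> seq_sub P x K i" using seq_sub_ker u(1) by blast
qed

text \<open>The connecting map from classes in U/(x_0, ..., x_{j-1})U killed by x_j to K/(x_0, ...,
  x_j)K, made explicit: lift \<open>z\<close> to \<open>y\<close> and take the component
  \<open>w\<close> of x_j y in \<open>K\<close>. Regularity of x_j on \<open>P\<close> keeps it
  nonzero.\<close>

lemma syzygy_socle: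
  assumes regU: "weakly_regular_on N x U j" and regP: "weakly_regular_on P x (carrier P) (Suc j)"
    and j: "j < p"
    and z: "z \<in> U" "z \<notin> seq_sub N x U j" "\<And>i. i < p \<Longrightarrow> x i \<odot>\<^bsub>N\<^esub> z \<in> seq_sub N x U j"
  shows "\<exists>w\<in>K. w \<notin> seq_sub P x K (Suc j) \<and> (\<forall>i<p. x i \<odot>\<^bsub>P\<^esub> w \<in> seq_sub P x K (Suc j))"
proof -
  obtain y where y: "y \<in> carrier P" "f y = z" using z(1) by auto
  have split: "\<exists>q w. q \<in> seq_sub P x (carrier P) j \<and> w \<in> K \<and> x i \<odot>\<^bsub>P\<^esub> y = q \<oplus>\<^bsub>P\<^esub> w" if "i < p" for i
    using lift_mod_ker[of "x i \<odot>\<^bsub>P\<^esub> y" j] z(3)[OF that] y x F by auto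
  obtain q w where qw: "q \<in> seq_sub P x (carrier P) j" "w \<in> K" "x j \<odot>\<^bsub>P\<^esub> y = q \<oplus>\<^bsub>P\<^esub> w"
    using split[OF j] by blast
  have qc: "q \<in> carrier P" "w \<in> carrier P" using qw SPE(1) KE(1) by blast+
  have "w \<notin> seq_sub P x K (Suc j)"
  proof
    assume "w \<in> seq_sub P x K (Suc j)"
    then obtain a b where ab: "w = a \<oplus>\<^bsub>P\<^esub> x j \<odot>\<^bsub>P\<^esub> b" "a \<in> seq_sub P x K j" "b \<in> K" by auto
    have a': "a \<in> seq_sub P x (carrier P) j" using ab P.seq_sub_mono[OF KE(1)] by blast
    have c: "a \<in> carrier P" "b \<in> carrier P" using a' ab SPE(1) KE(1) by blast+
    have "x j \<odot>\<^bsub>P\<^esub> (y \<oplus>\<^bsub>P\<^esub> \<ominus>\<^bsub>P\<^esub> b) = (q \<oplus>\<^bsub>P\<^esub> w) \<oplus>\<^bsub>P\<^esub> \<ominus>\<^bsub>P\<^esub> (x j \<odot>\<^bsub>P\<^esub> b)"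
      using x y c by (simp add: P.smult_r_distr qw(3) P.smult_r_minus)
    also have "\<dots> = q \<oplus>\<^bsub>P\<^esub> a"
      unfolding ab using x y c qc by (simp add: P.M.a_assoc P.M.r_neg)
    also have "\<dots> \<in> seq_sub P x (carrier P) j" using SPE(5) qw a' by blast
    finally have "y \<oplus>\<^bsub>P\<^esub> \<ominus>\<^bsub>P\<^esub> b \<in> seq_sub P x (carrier P) j"
      using regP y c by (simp add: weakly_regular_on_def)
    then have "f (y \<oplus>\<^bsub>P\<^esub> \<ominus>\<^bsub>P\<^esub> b) \<in> seq_sub N x U j" using image_P by blast
    moreover have "f (y \<oplus>\<^bsub>P\<^esub> \<ominus>\<^bsub>P\<^esub> b) = z"
      using y c ab(3) F z(1) by (auto simp: f_minus module_ker_def)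
    ultimately show False using z(2) by simp
  qed
  moreover have "x i \<odot>\<^bsub>P\<^esub> w \<in> seq_sub P x K (Suc j)" if i: "i < p" for i
  proof -
    obtain q' w' where qw': "q' \<in> seq_sub P x (carrier P) j" "w' \<in> K" "x i \<odot>\<^bsub>P\<^esub> y = q' \<oplus>\<^bsub>P\<^esub> w'"
      using split[OF i] by blast
    have qc': "q' \<in> carrier P" "w' \<in> carrier P" using qw' SPE(1) KE(1) by blast+
    \<comment> \<open>Comparing x_i (x_j y) with x_j (x_i y) in the two decompositions gives
      \<open>x i w = r + x j w'\<close>; \<open>r\<close> lies in \<open>K\<close> because the other
      two terms do.\<close>
    define r where "r = x j \<odot>\<^bsub>P\<^esub> q' \<oplus>\<^bsub>P\<^esub> \<ominus>\<^bsub>P\<^esub> (x i \<odot>\<^bsub>P\<^esub> q)"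
    have rc: "r \<in> carrier P" using qc qc' x by (simp add: r_def)
    have "x i \<odot>\<^bsub>P\<^esub> (x j \<odot>\<^bsub>P\<^esub> y) = x j \<odot>\<^bsub>P\<^esub> (x i \<odot>\<^bsub>P\<^esub> y)"
      using x y by (simp add: P.smult_assoc1[symmetric] P.R.m_comm)
    then have "x i \<odot>\<^bsub>P\<^esub> q \<oplus>\<^bsub>P\<^esub> x i \<odot>\<^bsub>P\<^esub> w = x j \<odot>\<^bsub>P\<^esub> q' \<oplus>\<^bsub>P\<^esub> x j \<odot>\<^bsub>P\<^esub> w'"
      using x qc qc' by (simp add: qw qw' P.smult_r_distr)
    then have "\<ominus>\<^bsub>P\<^esub> (x i \<odot>\<^bsub>P\<^esub> q) \<oplus>\<^bsub>P\<^esub> (x i \<odot>\<^bsub>P\<^esub> q \<oplus>\<^bsub>P\<^esub> x i \<odot>\<^bsub>P\<^esub> w)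
        = \<ominus>\<^bsub>P\<^esub> (x i \<odot>\<^bsub>P\<^esub> q) \<oplus>\<^bsub>P\<^esub> (x j \<odot>\<^bsub>P\<^esub> q' \<oplus>\<^bsub>P\<^esub> x j \<odot>\<^bsub>P\<^esub> w')" by simp
    then have eq: "x i \<odot>\<^bsub>P\<^esub> w = r \<oplus>\<^bsub>P\<^esub> x j \<odot>\<^bsub>P\<^esub> w'"
      using x qc qc' by (simp add: r_def P.M.a_assoc[symmetric] P.M.l_neg) (simp add: P.M.a_ac)
    have "r \<in> seq_sub P x (carrier P) j"
      unfolding r_def by (intro SPE(5) SPE(4)[OF x] SPE(3) qw(1) qw'(1))
    moreover have "r = x i \<odot>\<^bsub>P\<^esub> w \<oplus>\<^bsub>P\<^esub> \<ominus>\<^bsub>P\<^esub> (x j \<odot>\<^bsub>P\<^esub> w')"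
      unfolding eq using rc qc' x by (simp add: P.M.a_assoc P.M.r_neg)
    then have "r \<in> K" 
      using KE(5)[OF KE(4)[OF x qw(2)] KE(3)[OF KE(4)[OF x qw'(2)]]] by simp
    ultimately have "r \<in> seq_sub P x K j" using seq_sub_ker regU by blast
    then show ?thesis using eq qw'(2) by auto
  qed
  ultimately show ?thesis using qw(2) by blast
qed

end

section \<open>Sequences on free and projective modules, and the length of a resolution\<close>

lemma (in cring) seq_sub_free_module:
  assumes x: "\<And>i. x i \<in> carrier R"
  shows "seq_sub (free_module R B) x (carrier (free_module R B)) k =
    {f \<in> carrier (free_module R B). \<forall>b. f b \<in> seq_sub (regular_module R) x (carrier R) k}"
proof (induction k)
  case 0
  show ?case by (auto simp: free_module_simps)
next
  case (Suc k)
  let ?F = "free_module R B" and ?S = "seq_sub (regular_module R) x (carrier R)"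
  interpret F: Module.module R ?F by (rule free_module_module)
  have c: "f b \<in> carrier R" if "f \<in> carrier ?F" for f b
    using that by (simp add: free_module_carrier)
  have z: "\<zero> \<in> ?S k" for k
    by (induction k) (auto intro!: exI[of _ \<zero>] simp: x)
  show ?case
  proof (intro equalityI subsetI)
    fix v assume v: "v \<in> seq_sub ?F x (carrier ?F) (Suc k)"
    then obtain a e where ae: "v = (\<lambda>b. a b \<oplus> x k \<otimes> e b)" "e \<in> carrier ?F"
        "\<And>b. a b \<in> ?S k"
      unfolding seq_sub.simps Suc by (auto simp: free_module_simps)
    have "v b \<in> ?S (Suc k)" for b
      unfolding ae(1) using ae(3)[of b] c[OF ae(2), of b] by auto
    moreover have "v \<in> carrier ?F"
      using F.seq_sub_submodule[where x = x, OF F.carrier_submodule x, of "Suc k"] v by blast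
    ultimately show "v \<in> {f \<in> carrier ?F. \<forall>b. f b \<in> ?S (Suc k)}" by blast
  next
    fix v assume v: "v \<in> {f \<in> carrier ?F. \<forall>b. f b \<in> ?S (Suc k)}"
    \<comment> \<open>Choosing (0, 0) wherever \<open>v b\<close> vanishes keeps the supports of
      both chosen families finite.\<close>
    have "\<exists>p. (v b = fst p \<oplus> x k \<otimes> snd p \<and> fst p \<in> ?S k \<and> snd p \<in> carrier R \<and>
       (v b = \<zero> \<longrightarrow> p = (\<zero>, \<zero>)))" for b
    proof (cases "v b = \<zero>")
      case True
      then show ?thesis using z x by (intro exI[of _ "(\<zero>, \<zero>)"]) auto
    next
      case False
      then show ?thesis using v by auto
    qed
    then obtain p where p: "\<And>b. v b = fst (p b) \<oplus> x k \<otimes> snd (p b) \<and> fst (p b) \<in> ?S k \<and>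
       snd (p b) \<in> carrier R \<and> (v b = \<zero> \<longrightarrow> p b = (\<zero>, \<zero>))" by metis
    interpret G: Module.module R "regular_module R"
      by (rule moduleI) (auto simp: cring_axioms l_distr r_distr m_assoc
        intro!: abelian_groupI a_ac bexI[of _ "\<ominus> _"] l_neg)
    have Sc: "?S k \<subseteq> carrier R"
      using G.seq_sub_submodule[where x = x, OF G.carrier_submodule x, of k] by simp
    have fin: "finite {b. v b \<noteq> \<zero>}" using v by (simp add: free_module_simps)
    have "p b = (\<zero>, \<zero>)" if "v b = \<zero>" for b using p that by blast
    then have p0: "fst (p b) = \<zero>" "snd (p b) = \<zero>" if "v b = \<zero>" for b
      using that by simp_all
    have p1: "v b = fst (p b) \<oplus> x k \<otimes> snd (p b)" "fst (p b) \<in> ?S k" "snd (p b) \<in> carrier R" for b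
      using p by blast+
    have "finite {b. fst (p b) \<noteq> \<zero>}" "finite {b. snd (p b) \<noteq> \<zero>}"
      by (rule finite_subset[OF _ fin], use p0 in blast)+
    moreover have "v b = \<zero>" if "b \<notin> B" for b using v that by (simp add: free_module_simps)
    ultimately have pc: "(\<lambda>b. fst (p b)) \<in> carrier ?F" "(\<lambda>b. snd (p b)) \<in> carrier ?F"
      using p0 p1(2,3) Sc by (simp_all add: free_module_simps subset_iff)
    then have "(\<lambda>b. fst (p b)) \<in> seq_sub ?F x (carrier ?F) k"
      unfolding Suc using p1(2) by simp
    then have "(\<lambda>b. fst (p b)) \<oplus>\<^bsub>?F\<^esub> x k \<odot>\<^bsub>?F\<^esub> (\<lambda>b. snd (p b)) \<in> seq_sub ?F x (carrier ?F) (Suc k)"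
      using pc(2) by (rule seq_sub_SucI)
    moreover have "v = (\<lambda>b. fst (p b)) \<oplus>\<^bsub>?F\<^esub> x k \<odot>\<^bsub>?F\<^esub> (\<lambda>b. snd (p b))"
      unfolding free_module_simps using p1(1) by (rule ext)
    ultimately show "v \<in> seq_sub ?F x (carrier ?F) (Suc k)" by simp
  qed
qed

text \<open>Regularity passes to a retract of a free module: map into the free module, argue
  coordinatewise there, and return by \<open>\<pi>\<close>.\<close>

lemma (in cring) projective_weakly_regular:
  fixes P :: "('a, 'c, 'm) module_scheme"
  assumes P: "projective R P" and x: "\<And>i. x i \<in> carrier R"
    and reg: "weakly_regular_on (regular_module R) x (carrier R) k"
  shows "weakly_regular_on P x (carrier P) k"
proof -
  interpret P: Module.module R P using P by (simp add: projective_def)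
  obtain B :: "'c set" and \<iota> \<pi> where hom: "\<iota> \<in> module_hom R P (free_module R B)"
      "\<pi> \<in> module_hom R (free_module R B) P" and ret: "\<And>y. y \<in> carrier P \<Longrightarrow> \<pi> (\<iota> y) = y"
    using P unfolding projective_def by blast
  let ?F = "free_module R B"
  interpret F: Module.module R ?F by (rule free_module_module)
  have img: "\<iota> ` carrier P \<subseteq> carrier ?F" "\<pi> ` carrier ?F \<subseteq> carrier P"
    using hom by (auto simp: module_hom_def)
  show ?thesis
    unfolding weakly_regular_on_def
  proof (intro allI ballI impI)
    fix j u assume j: "j < k" and u: "u \<in> carrier P" and xu: "x j \<odot>\<^bsub>P\<^esub> u \<in> seq_sub P x (carrier P) j"
    have "\<iota> (x j \<odot>\<^bsub>P\<^esub> u) \<in> seq_sub ?F x (\<iota> ` carrier P) j"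
      using seq_sub_image[where x = x, OF P.module_axioms F.module_axioms hom(1) x P.carrier_submodule] xu by blast
    then have "x j \<odot>\<^bsub>?F\<^esub> \<iota> u \<in> seq_sub ?F x (carrier ?F) j"
      using F.seq_sub_mono[OF img(1)] module_homD(3)[OF hom(1)] x u by auto
    then have "\<And>b. x j \<otimes> \<iota> u b \<in> seq_sub (regular_module R) x (carrier R) j"
      by (simp add: seq_sub_free_module[where x = x, OF x]) (simp add: free_module_simps)
    moreover have \<iota>u: "\<iota> u \<in> carrier ?F" using img u by blast
    then have "\<And>b. \<iota> u b \<in> carrier R"
      by (simp add: free_module_simps) (metis zero_closed)
    ultimately have "\<And>b. \<iota> u b \<in> seq_sub (regular_module R) x (carrier R) j"
      using reg j by (auto simp: weakly_regular_on_def)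
    then have "\<iota> u \<in> seq_sub ?F x (carrier ?F) j"
      using \<iota>u by (simp add: seq_sub_free_module[where x = x, OF x])
    then have "\<pi> (\<iota> u) \<in> seq_sub P x (\<pi> ` carrier ?F) j"
      using seq_sub_image[where x = x, OF F.module_axioms P.module_axioms hom(2) x F.carrier_submodule] by blast
    then show "u \<in> seq_sub P x (carrier P) j"
      using P.seq_sub_mono[OF img(2)] ret u by auto
  qed
qed

text \<open>\<open>z\<close> is nonzero and killed by all x_i; each \<open>syzygy_socle\<close> step
  turns it into such an element of the next syzygy, modulo one more member of the sequence. If
  \<open>q < p\<close>, the chase arrives at the image of \<open>P (Suc q) = 0\<close>, which has no
  nonzero element.\<close>

theorem (in cring) projective_resolution_length:
  fixes M :: "('a, 'c, 'm) module_scheme"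
  assumes M: "Module.module R M" and x: "\<And>i. x i \<in> carrier R"
    and reg: "weakly_regular_on (regular_module R) x (carrier R) p"
    and z: "z \<in> carrier M" "z \<noteq> \<zero>\<^bsub>M\<^esub>" "\<And>i. i < p \<Longrightarrow> x i \<odot>\<^bsub>M\<^esub> z = \<zero>\<^bsub>M\<^esub>"
    and res: "has_projective_resolution R M q"
  shows "p \<le> q"
proof (rule ccontr)
  assume "\<not> p \<le> q"
  then have q: "q < p" by simp
  obtain P :: "nat \<Rightarrow> ('a, 'c \<times> nat \<Rightarrow> 'a) module" and \<epsilon> \<delta> where
    P: "\<forall>i. projective R (P i)" and fin: "\<forall>i>q. carrier (P i) = {\<zero>\<^bsub>P i\<^esub>}" and
    e: "\<epsilon> \<in> module_hom R (P 0) M" "\<epsilon> ` carrier (P 0) = carrier M" and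
    d: "\<forall>i. \<delta> i \<in> module_hom R (P (Suc i)) (P i)" and
    ex: "\<delta> 0 ` carrier (P (Suc 0)) = module_ker (P 0) M \<epsilon>"
      "\<forall>i. \<delta> (Suc i) ` carrier (P (Suc (Suc i))) = module_ker (P (Suc i)) (P i) (\<delta> i)"
    using res unfolding has_projective_resolution_def
    by (elim exE conjE) (rule that, assumption+)
  note P = spec[OF P] and d = spec[OF d]
  have mod: "Module.module R (P i)" for i using P by (simp add: projective_def)
  have regP: "weakly_regular_on (P i) x (carrier (P i)) k" if "k \<le> p" for i k
    by (rule projective_weakly_regular[OF P x])
      (use reg that in \<open>auto simp: weakly_regular_on_def\<close>)
  let ?U = "\<lambda>j. \<delta> j ` carrier (P (Suc j))"
  have "weakly_regular_on (P j) x (?U j) (Suc j) \<and>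
    (\<exists>w\<in>?U j. w \<notin> seq_sub (P j) x (?U j) (Suc j) \<and>
      (\<forall>i<p. x i \<odot>\<^bsub>P j\<^esub> w \<in> seq_sub (P j) x (?U j) (Suc j)))" if "j < p" for j
    using that
  proof (induction j)
    case 0
    interpret syzygy_step R "P 0" M \<epsilon> x
      by (intro syzygy_step.intro mod M syzygy_step_axioms.intro e x)
    have p: "Suc 0 \<le> p" using 0 by simp
    have reg: "weakly_regular_on M x (\<epsilon> ` carrier (P 0)) 0" by (simp add: weakly_regular_on_def)
    have w: "z \<in> \<epsilon> ` carrier (P 0)" "z \<notin> seq_sub M x (\<epsilon> ` carrier (P 0)) 0"
      "x i \<odot>\<^bsub>M\<^esub> z \<in> seq_sub M x (\<epsilon> ` carrier (P 0)) 0" if "i < p" for i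
      using z that by (simp_all add: e(2))
    show ?case
      unfolding ex(1)
      by (intro conjI syzygy_regular[OF reg regP[OF p]]
          syzygy_socle[OF reg regP[OF p] 0 w(1,2)[OF 0] w(3)])
  next
    case (Suc j)
    interpret syzygy_step R "P (Suc j)" "P j" "\<delta> j" x
      by (intro syzygy_step.intro mod M syzygy_step_axioms.intro d x)
    have j: "j < p" "Suc (Suc j) \<le> p" using Suc.prems by simp_all
    obtain w where w: "w \<in> ?U j" "w \<notin> seq_sub (P j) x (?U j) (Suc j)"
      "\<forall>i<p. x i \<odot>\<^bsub>P j\<^esub> w \<in> seq_sub (P j) x (?U j) (Suc j)"
      using Suc.IH[OF j(1)] by blast
    have reg: "weakly_regular_on (P j) x (?U j) (Suc j)" using Suc.IH[OF j(1)] by blast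
    show ?case
      unfolding spec[OF ex(2)]
      by (intro conjI syzygy_regular[OF reg regP[OF j(2)]]
          syzygy_socle[OF reg regP[OF j(2)] Suc.prems w(1,2) mp[OF spec[OF w(3)]]])
  qed
  from this[OF q] obtain w where w: "w \<in> ?U q" "w \<notin> seq_sub (P q) x (?U q) (Suc q)" by blast
  interpret Q: Module.module R "P q" by (rule mod)
  have U0: "?U q = {\<zero>\<^bsub>P q\<^esub>}" 
    using spec[OF fin, of "Suc q"] module_hom_zero[OF mod mod d[of q]] by simp
  have "submodule {\<zero>\<^bsub>P q\<^esub>} R (P q)" by (rule Q.submoduleI) auto
  then have "\<zero>\<^bsub>P q\<^esub> \<in> seq_sub (P q) x (?U q) (Suc q)"
    unfolding U0
    by (intro Q.submodule_zero conjunct1[OF Q.seq_sub_submodule[where x = x, OF _ x]])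
  then show False using w U0 by simp
qed

section \<open>Finite free resolutions over a subring\<close>

definition smul :: "'a::comm_ring_1 \<Rightarrow> (nat \<Rightarrow> 'a) \<Rightarrow> nat \<Rightarrow> 'a" where
  "smul a v = (\<lambda>i. a * v i)"

definition comb :: "(nat \<Rightarrow> nat \<Rightarrow> 'a::comm_ring_1) \<Rightarrow> nat \<Rightarrow> (nat \<Rightarrow> 'a) \<Rightarrow> nat \<Rightarrow> 'a" where
  "comb b r c = (\<Sum>i<r. smul (c i) (b i))"

definition linear_map :: "((nat \<Rightarrow> 'a::comm_ring_1) \<Rightarrow> nat \<Rightarrow> 'a) \<Rightarrow> bool" where
  "linear_map f \<longleftrightarrow> (\<forall>u v. f (u + v) = f u + f v) \<and> (\<forall>a u. f (smul a u) = smul a (f u))"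

text \<open>Puts ring elements into the type of coordinate vectors, so that ideals and modules of
  syzygies are both submodules of one type and one notion of resolution covers them.\<close>

definition emb :: "'a::comm_ring_1 \<Rightarrow> nat \<Rightarrow> 'a" where
  "emb x = (\<lambda>i. if i = 0 then x else 0)"

lemma smul_simps [simp]:
  "smul a 0 = 0" "smul 0 v = 0" "smul 1 v = v" "smul a (u + v) = smul a u + smul a v"
  "smul (a + b) v = smul a v + smul b v" "smul (a * b) v = smul a (smul b v)"
  "smul (- a) v = - smul a v" "smul a (- v) = - smul a v" "smul a (u - v) = smul a u - smul a v"
  by (simp_all add: smul_def fun_eq_iff algebra_simps)

lemma smul_commute: "smul a (smul b v) = smul b (smul a v)"
  by (simp add: smul_def fun_eq_iff algebra_simps)

lemma smul_sum: "smul a (\<Sum>i\<in>I. f i) = (\<Sum>i\<in>I. smul a (f i))"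
  by (rule sum_comp_morphism[symmetric, where h = "smul a" and g = f, unfolded o_def]) simp_all

lemma smul_apply: "smul a v i = a * v i"
  by (simp add: smul_def)

lemma comb_0 [simp]: "comb b 0 c = 0" and comb_Suc: "comb b (Suc r) c = comb b r c + smul (c r) (b r)"
  by (simp_all add: comb_def)

lemma comb_add: "comb b r (c + d) = comb b r c + comb b r d"
  by (simp add: comb_def sum.distrib)

lemma comb_smul: "comb b r (smul a c) = smul a (comb b r c)"
  by (simp add: comb_def smul_sum smul_apply)

lemma comb_uminus: "comb b r (- c) = - comb b r c"
  by (simp add: comb_def sum_negf)

lemma comb_zero [simp]: "comb b r 0 = 0"
  by (simp add: comb_def)

lemma comb_cong: "(\<And>i. i < r \<Longrightarrow> b i = b' i) \<Longrightarrow> (\<And>i. i < r \<Longrightarrow> c i = c' i) \<Longrightarrow> comb b r c = comb b' r c'"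
  by (simp add: comb_def)

lemma comb_append:
  "comb (\<lambda>i. if i < r then b i else h (i - r)) (r + s) c = comb b r c + comb h s (\<lambda>i. c (i + r))"
proof (induction s)
  case 0
  show ?case by (auto intro!: comb_cong)
next
  case (Suc s)
  then show ?case by (simp add: comb_Suc add.commute add.left_commute)
qed

lemma linear_mapD:
  assumes "linear_map f"
  shows "f (u + v) = f u + f v" "f (smul a u) = smul a (f u)" "f 0 = 0" "f (- u) = - f u"
    "f (u - v) = f u - f v"
proof -
  show add: "f (u + v) = f u + f v" for u v using assms by (simp add: linear_map_def)
  show smul: "f (smul a u) = smul a (f u)" for a u using assms by (simp add: linear_map_def)
  show "f 0 = 0" using smul[of 0 0] by simp
  show uminus: "f (- u) = - f u" for u using smul[of "-1" u] by simp
  show "f (u - v) = f u - f v" using add[of u "- v"] uminus[of v] by simp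
qed

lemma linear_map_comb:
  assumes "linear_map f"
  shows "f (comb b r c) = comb (\<lambda>i. f (b i)) r c"
  using sum_comp_morphism[of f "\<lambda>i. smul (c i) (b i)" "{..<r}"] linear_mapD[OF assms]
  by (simp add: comb_def o_def)

lemma linear_map_id: "linear_map (\<lambda>u. u)"
  by (simp add: linear_map_def)

lemma linear_map_smul: "linear_map (smul a)"
  by (simp add: linear_map_def smul_commute)

lemma linear_map_shift: "linear_map (\<lambda>c i. c (i + r))"
  by (simp add: linear_map_def fun_eq_iff smul_def)

lemma emb_simps [simp]:
  "emb 0 = 0" "emb x + emb y = emb (x + y)" "emb x - emb y = emb (x - y)" "- emb x = emb (- x)"
  "smul a (emb x) = emb (a * x)" "emb x 0 = x" "emb x = emb y \<longleftrightarrow> x = y" "emb x = 0 \<longleftrightarrow> x = 0"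
  by (auto simp: emb_def fun_eq_iff smul_def)

lemma linear_map_emb: "linear_map (\<lambda>c. emb (c i))"
  by (simp add: linear_map_def smul_apply)

lemma in_emb_image [simp]: "emb x \<in> emb ` X \<longleftrightarrow> x \<in> X"
  by (auto simp: image_iff)

text \<open>The polynomials in n variables form a subset of the type of all polynomials. Working in
  a subring of a type class ring keeps the arithmetic of the type class; records enter only when the
  results are transferred.\<close>

locale comm_subring =
  fixes A :: "'a::comm_ring_1 set"
  assumes one_mem [simp]: "1 \<in> A"
    and diff_mem [simp]: "a \<in> A \<Longrightarrow> b \<in> A \<Longrightarrow> a - b \<in> A"
    and mult_mem [simp]: "a \<in> A \<Longrightarrow> b \<in> A \<Longrightarrow> a * b \<in> A"
begin

lemma zero_mem [simp]: "0 \<in> A"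
  using diff_mem[OF one_mem one_mem] by simp

lemma uminus_mem [simp]: "a \<in> A \<Longrightarrow> - a \<in> A"
  using diff_mem[OF zero_mem, of a] by simp

lemma add_mem [simp]: "a \<in> A \<Longrightarrow> b \<in> A \<Longrightarrow> a + b \<in> A"
  using diff_mem[of a "- b"] by simp

lemma sum_mem: "(\<And>i. i \<in> I \<Longrightarrow> f i \<in> A) \<Longrightarrow> sum f I \<in> A"
  by (induction I rule: infinite_finite_induct) simp_all

lemma prod_mem: "(\<And>i. i \<in> I \<Longrightarrow> f i \<in> A) \<Longrightarrow> prod f I \<in> A"
  by (induction I rule: infinite_finite_induct) simp_all

lemma power_mem [simp]: "a \<in> A \<Longrightarrow> a ^ k \<in> A"
  by (induction k) simp_all

definition is_ideal :: "'a set \<Rightarrow> bool" where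
  "is_ideal J \<longleftrightarrow> J \<subseteq> A \<and> 0 \<in> J \<and> (\<forall>x\<in>J. \<forall>y\<in>J. x + y \<in> J) \<and> (\<forall>a\<in>A. \<forall>x\<in>J. a * x \<in> J)"

lemma is_idealD:
  assumes "is_ideal J"
  shows "x \<in> J \<Longrightarrow> x \<in> A" "0 \<in> J" "x \<in> J \<Longrightarrow> y \<in> J \<Longrightarrow> x + y \<in> J"
    "a \<in> A \<Longrightarrow> x \<in> J \<Longrightarrow> a * x \<in> J" "a \<in> A \<Longrightarrow> x \<in> J \<Longrightarrow> x * a \<in> J"
    "x \<in> J \<Longrightarrow> - x \<in> J" "x \<in> J \<Longrightarrow> y \<in> J \<Longrightarrow> x - y \<in> J"
proof -
  show 1: "a \<in> A \<Longrightarrow> x \<in> J \<Longrightarrow> a * x \<in> J" for a x using assms by (simp add: is_ideal_def)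
  show "a \<in> A \<Longrightarrow> x \<in> J \<Longrightarrow> x * a \<in> J" using 1[of a x] by (simp add: mult.commute)
  show 2: "x \<in> J \<Longrightarrow> - x \<in> J" for x using 1[of "-1" x] by simp
  show 3: "x \<in> J \<Longrightarrow> y \<in> J \<Longrightarrow> x + y \<in> J" for x y using assms by (simp add: is_ideal_def)
  show "x \<in> J \<Longrightarrow> y \<in> J \<Longrightarrow> x - y \<in> J" using 3[of x "- y"] 2[of y] by simp
qed (use assms in \<open>auto simp: is_ideal_def\<close>)

lemma is_ideal_A: "is_ideal A"
  by (simp add: is_ideal_def)

definition adjoin :: "'a set \<Rightarrow> 'a \<Rightarrow> 'a set" where
  "adjoin J x = {j + x * a |j a. j \<in> J \<and> a \<in> A}"

definition colon :: "'a set \<Rightarrow> 'a \<Rightarrow> 'a set" where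
  "colon J x = {a \<in> A. x * a \<in> J}"

lemma adjoinI: "j \<in> J \<Longrightarrow> a \<in> A \<Longrightarrow> j + x * a \<in> adjoin J x"
  by (auto simp: adjoin_def)

lemma adjoin_superset: "J \<subseteq> adjoin J x"
  using adjoinI[of _ J 0 x] by auto

lemma adjoin_self: "0 \<in> J \<Longrightarrow> x \<in> adjoin J x"
  using adjoinI[of 0 J 1 x] by simp

lemma is_ideal_adjoin:
  assumes "is_ideal J" "x \<in> A"
  shows "is_ideal (adjoin J x)"
  unfolding is_ideal_def
proof (intro conjI ballI)
  note D = is_idealD[OF assms(1)]
  show "adjoin J x \<subseteq> A" using D(1) assms(2) by (auto simp: adjoin_def)
  show "0 \<in> adjoin J x" using adjoinI[OF D(2) zero_mem, of x] by simp
  fix u assume "u \<in> adjoin J x"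
  then obtain j a where u: "u = j + x * a" "j \<in> J" "a \<in> A" by (auto simp: adjoin_def)
  {
    fix v assume "v \<in> adjoin J x"
    then obtain j' a' where v: "v = j' + x * a'" "j' \<in> J" "a' \<in> A" by (auto simp: adjoin_def)
    show "u + v \<in> adjoin J x"
      using adjoinI[OF D(3)[OF u(2) v(2)] add_mem[OF u(3) v(3)], of x] u(1) v(1)
      by (simp add: algebra_simps)
  next
    fix b assume b: "b \<in> A"
    show "b * u \<in> adjoin J x"
      using adjoinI[OF D(4)[OF b u(2)] mult_mem[OF b u(3)], of x] u(1)
      by (simp add: algebra_simps)
  }
qed

lemma is_ideal_colon:
  assumes "is_ideal J" "x \<in> A"
  shows "is_ideal (colon J x)"
  unfolding is_ideal_def
proof (intro conjI ballI)
  fix u v assume "u \<in> colon J x" "v \<in> colon J x"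
  then show "u + v \<in> colon J x" using is_idealD(3)[OF assms(1)] by (simp add: colon_def distrib_left)
next
  fix a u assume "a \<in> A" "u \<in> colon J x"
  then show "a * u \<in> colon J x"
    using is_idealD(4)[OF assms(1), of a "x * u"] by (simp add: colon_def mult.left_commute)
qed (use is_idealD(2)[OF assms(1)] in \<open>auto simp: colon_def\<close>)

text \<open>Coordinates from \<open>r\<close> on are zero, so that A^r lies inside A^s for r \<le> s
  and equality of vectors is equality of functions.\<close>

definition vec :: "nat \<Rightarrow> (nat \<Rightarrow> 'a) set" where
  "vec r = {c. (\<forall>i<r. c i \<in> A) \<and> (\<forall>i\<ge>r. c i = 0)}"

definition smod :: "(nat \<Rightarrow> 'a) set \<Rightarrow> bool" where
  "smod V \<longleftrightarrow> 0 \<in> V \<and> (\<forall>u\<in>V. \<forall>v\<in>V. u + v \<in> V) \<and> (\<forall>a\<in>A. \<forall>v\<in>V. smul a v \<in> V)"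

lemma vecD: "c \<in> vec r \<Longrightarrow> c i \<in> A"
  by (cases "i < r") (auto simp: vec_def)

lemma smodD:
  assumes "smod V"
  shows "0 \<in> V" "u \<in> V \<Longrightarrow> v \<in> V \<Longrightarrow> u + v \<in> V" "a \<in> A \<Longrightarrow> v \<in> V \<Longrightarrow> smul a v \<in> V"
    "v \<in> V \<Longrightarrow> - v \<in> V" "u \<in> V \<Longrightarrow> v \<in> V \<Longrightarrow> u - v \<in> V"
proof -
  show add: "u \<in> V \<Longrightarrow> v \<in> V \<Longrightarrow> u + v \<in> V" for u v using assms by (simp add: smod_def)
  show smul: "a \<in> A \<Longrightarrow> v \<in> V \<Longrightarrow> smul a v \<in> V" for a v using assms by (simp add: smod_def)
  show neg: "v \<in> V \<Longrightarrow> - v \<in> V" for v using smul[of "- 1" v] by simp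
  show "u \<in> V \<Longrightarrow> v \<in> V \<Longrightarrow> u - v \<in> V" using add[of u "- v"] neg by simp
qed (use assms in \<open>simp add: smod_def\<close>)

lemma smod_comb: "smod V \<Longrightarrow> (\<And>i. i < r \<Longrightarrow> b i \<in> V) \<Longrightarrow> c \<in> vec r' \<Longrightarrow> comb b r c \<in> V"
  by (induction r) (simp_all add: smodD comb_Suc vecD)

lemma smod_vec: "smod (vec r)"
  by (auto simp: smod_def vec_def smul_def)

lemma smod_zero: "smod {0}"
  by (simp add: smod_def)

lemma smod_emb: "is_ideal J \<Longrightarrow> smod (emb ` J)"
  unfolding smod_def emb_simps(1)[symmetric]
  by (simp only: in_emb_image ball_simps emb_simps) (simp add: is_idealD)

lemma smod_ker: "smod U \<Longrightarrow> smod {c \<in> vec r. comb b r c \<in> U}"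
  by (simp add: smod_def[of "{c \<in> vec r. comb b r c \<in> U}"] comb_add comb_smul smodD smodD[OF smod_vec])

lemma vec_0 [simp]: "vec 0 = {0}"
  by (auto simp: vec_def)

lemma vec_Suc_0: "vec (Suc 0) = emb ` A"
proof (intro equalityI subsetI)
  fix c assume "c \<in> vec (Suc 0)"
  then have "c = emb (c 0)" "c 0 \<in> A" by (auto simp: vec_def emb_def fun_eq_iff)
  then show "c \<in> emb ` A" by blast
qed (auto simp: vec_def emb_def)

lemma vec_mono: "c \<in> vec r \<Longrightarrow> r \<le> s \<Longrightarrow> c \<in> vec s"
  unfolding vec_def[of s] using vecD[of c r] by (simp add: vec_def)

text \<open>For submodules \<open>U \<subseteq> V\<close>, \<open>res p V U\<close> says that \<open>V/U\<close> has a resolution by at most \<open>p\<close> free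
  modules of finite rank, that is, one of length \<open>p - 1\<close>.\<close>

primrec res :: "nat \<Rightarrow> (nat \<Rightarrow> 'a) set \<Rightarrow> (nat \<Rightarrow> 'a) set \<Rightarrow> bool" where
  "res 0 V U \<longleftrightarrow> V \<subseteq> U"
| "res (Suc p) V U \<longleftrightarrow> (\<exists>r b. (\<forall>i<r. b i \<in> V) \<and> (\<forall>v\<in>V. \<exists>c\<in>vec r. v - comb b r c \<in> U) \<and>
     res p {c \<in> vec r. comb b r c \<in> U} {0})"

lemma res_Suc: "smod U \<Longrightarrow> res p V U \<Longrightarrow> res (Suc p) V U"
proof (induction p arbitrary: V U)
  case 0
  then have "(\<forall>i<0. b i \<in> V) \<and> (\<forall>v\<in>V. \<exists>c\<in>vec 0. v - comb b 0 c \<in> U) \<and>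
     res 0 {c \<in> vec 0. comb b 0 c \<in> U} {0}" for b
    by auto
  then show ?case unfolding res.simps(2) by blast
next
  case (Suc p)
  from Suc.prems(2) obtain r b where
    "(\<forall>i<r. b i \<in> V) \<and> (\<forall>v\<in>V. \<exists>c\<in>vec r. v - comb b r c \<in> U) \<and>
     res p {c \<in> vec r. comb b r c \<in> U} {0}" by auto
  then have "(\<forall>i<r. b i \<in> V) \<and> (\<forall>v\<in>V. \<exists>c\<in>vec r. v - comb b r c \<in> U) \<and>
     res (Suc p) {c \<in> vec r. comb b r c \<in> U} {0}"
    using Suc.IH[OF smod_zero] by blast
  then show ?case unfolding res.simps(2)[of "Suc p"] by blast
qed

text \<open>An exact sequence
  \<open>0 \<rightarrow> V\<^sub>1/U\<^sub>1 \<rightarrow> V\<^sub>2/U\<^sub>2 \<rightarrow> V\<^sub>3/U\<^sub>3 \<rightarrow> 0\<close>.\<close>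

definition short_exact where
  "short_exact V1 U1 V2 U2 V3 U3 f g \<longleftrightarrow> smod V1 \<and> smod U1 \<and> smod V2 \<and> smod U2 \<and> smod V3 \<and> smod U3 \<and>
    linear_map f \<and> linear_map g \<and> (\<forall>v\<in>V1. f v \<in> V2) \<and> (\<forall>v\<in>V2. g v \<in> V3) \<and>
    (\<forall>v\<in>V1. f v \<in> U2 \<longleftrightarrow> v \<in> U1) \<and> (\<forall>v\<in>V3. \<exists>w\<in>V2. v - g w \<in> U3) \<and>
    (\<forall>v\<in>V2. g v \<in> U3 \<longleftrightarrow> (\<exists>w\<in>V1. v - f w \<in> U2))"

lemma short_exactI:
  assumes "smod V1" "smod U1" "smod V2" "smod U2" "smod V3" "smod U3"
    and "linear_map f" "linear_map g"
    and "\<And>v. v \<in> V1 \<Longrightarrow> f v \<in> V2" "\<And>v. v \<in> V2 \<Longrightarrow> g v \<in> V3"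
    and "\<And>v. v \<in> V1 \<Longrightarrow> f v \<in> U2 \<longleftrightarrow> v \<in> U1"
    and "\<And>v. v \<in> V3 \<Longrightarrow> \<exists>w\<in>V2. v - g w \<in> U3"
    and "\<And>v. v \<in> V2 \<Longrightarrow> g v \<in> U3 \<longleftrightarrow> (\<exists>w\<in>V1. v - f w \<in> U2)"
  shows "short_exact V1 U1 V2 U2 V3 U3 f g"
  unfolding short_exact_def by (intro conjI ballI assms)

lemma short_exactD:
  assumes "short_exact V1 U1 V2 U2 V3 U3 f g"
  shows "smod V1" "smod U1" "smod V2" "smod U2" "smod V3" "smod U3"
    and "linear_map f" "linear_map g"
    and "\<And>v. v \<in> V1 \<Longrightarrow> f v \<in> V2" "\<And>v. v \<in> V2 \<Longrightarrow> g v \<in> V3"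
    and "\<And>v. v \<in> V1 \<Longrightarrow> f v \<in> U2 \<longleftrightarrow> v \<in> U1"
    and "\<And>v. v \<in> V3 \<Longrightarrow> \<exists>w\<in>V2. v - g w \<in> U3"
    and "\<And>v. v \<in> V2 \<Longrightarrow> g v \<in> U3 \<longleftrightarrow> (\<exists>w\<in>V1. v - f w \<in> U2)"
  using assms unfolding short_exact_def by blast+

lemma short_exact_trivial:
  assumes ex: "short_exact V1 U1 V2 U2 V3 U3 f g" and "V1 \<subseteq> U1" "V3 \<subseteq> U3"
  shows "V2 \<subseteq> U2"
proof
  note prems = short_exactD[OF ex]
  fix v assume v: "v \<in> V2"
  have "g v \<in> U3" using prems(10)[OF v] assms(3) by auto
  then obtain w where w: "w \<in> V1" "v - f w \<in> U2" using prems(13)[OF v] by blast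
  have "f w \<in> U2" using prems(11)[OF w(1)] w(1) assms(2) by auto
  then show "v \<in> U2" using smodD(2)[OF prems(4) w(2)] by fastforce
qed

text \<open>The images of the generators of the first module together with lifts of the generators
  of the third generate the middle one. The three modules of syzygies again form a short exact
  sequence, to which the hypothesis for \<open>p\<close> applies.\<close>

lemma res_horseshoe_step:
  assumes ses: "short_exact V1 U1 V2 U2 V3 U3 f g"
    and "res (Suc p) V1 U1" "res (Suc p) V3 U3"
    and IH: "\<And>V1 U1 V2 U2 V3 U3 f g. short_exact V1 U1 V2 U2 V3 U3 f g \<Longrightarrow>
      res p V1 U1 \<Longrightarrow> res p V3 U3 \<Longrightarrow> res p V2 U2"
  shows "res (Suc p) V2 U2"
proof -
  note prems = short_exactD[OF ses]
  note V1 = smodD[OF prems(1)] and U1 = smodD[OF prems(2)] and V2 = smodD[OF prems(3)]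
    and U2 = smodD[OF prems(4)] and V3 = smodD[OF prems(5)] and U3 = smodD[OF prems(6)]
  note f = linear_mapD[OF prems(7)] and g = linear_mapD[OF prems(8)]
  note fV = prems(9) and gV = prems(10) and fU = prems(11) and gs = prems(12) and ex = prems(13)
  obtain r b where b: "\<forall>i<r. b i \<in> V1" "\<forall>v\<in>V1. \<exists>c\<in>vec r. v - comb b r c \<in> U1"
    "res p {c \<in> vec r. comb b r c \<in> U1} {0}" using assms(2) by auto
  obtain s d where d: "\<forall>i<s. d i \<in> V3" "\<forall>v\<in>V3. \<exists>c\<in>vec s. v - comb d s c \<in> U3"
    "res p {c \<in> vec s. comb d s c \<in> U3} {0}" using assms(3) by auto
  have "\<forall>i. \<exists>w. i < s \<longrightarrow> w \<in> V2 \<and> d i - g w \<in> U3" using gs d(1) by blast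
  then obtain h where h: "\<And>i. i < s \<Longrightarrow> h i \<in> V2" "\<And>i. i < s \<Longrightarrow> d i - g (h i) \<in> U3" by metis
  define b' where "b' = (\<lambda>i. if i < r then f (b i) else h (i - r))"
  have b'V: "b' i \<in> V2" if "i < r + s" for i
    using that b(1) fV h(1) by (auto simp: b'_def)
  have comb_b': "comb b' (r + s) c = f (comb b r c) + comb h s (\<lambda>i. c (i + r))" for c
    unfolding b'_def using comb_append[of r "\<lambda>i. f (b i)" h s c] by (simp add: linear_map_comb[OF prems(7)])
  have combV1: "comb b r c \<in> V1" if "c \<in> vec r'" for c r'
    using smod_comb[OF prems(1) _ that] b(1) by blast
  have combV2: "comb h s c \<in> V2" if "c \<in> vec r'" for c r'
    using smod_comb[OF prems(3) _ that] h(1) by blast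
  have combU3: "comb d s c - g (comb h s c) \<in> U3" if "c \<in> vec r'" for c r'
  proof -
    have "comb d s c - g (comb h s c) = comb (\<lambda>i. d i - g (h i)) s c"
      unfolding linear_map_comb[OF prems(8)] by (simp add: comb_def sum_subtractf)
    then show ?thesis using smod_comb[OF prems(6) _ that] h(2) by simp
  qed
  have combU3_iff: "comb d s c \<in> U3 \<longleftrightarrow> g (comb h s c) \<in> U3" if "c \<in> vec r'" for c r'
    using U3(2)[OF combU3[OF that], of "g (comb h s c)"]
      U3(5)[OF _ combU3[OF that], of "comb d s c"] by auto
  have shift: "(\<lambda>i. c (i + r)) \<in> vec s" if "c \<in> vec (r + s)" for c
    using that by (auto simp: vec_def)
  define join where "join = (\<lambda>(c1 :: nat \<Rightarrow> 'a) (c2 :: nat \<Rightarrow> 'a) i. if i < r then c1 i else c2 (i - r))"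
  have join: "join c1 c2 \<in> vec (r + s)" "comb b' (r + s) (join c1 c2) = f (comb b r c1) + comb h s c2"
    "(\<lambda>i. join c1 c2 (i + r)) = c2"
    if "c1 \<in> vec r" "c2 \<in> vec s" for c1 c2
  proof -
    show "join c1 c2 \<in> vec (r + s)" using that by (auto simp: vec_def join_def)
    show "(\<lambda>i. join c1 c2 (i + r)) = c2" by (simp add: join_def)
    then show "comb b' (r + s) (join c1 c2) = f (comb b r c1) + comb h s c2"
      unfolding comb_b' by (simp add: join_def cong: comb_cong)
  qed
  let ?K1 = "{c \<in> vec r. comb b r c \<in> U1}" and ?K2 = "{c \<in> vec (r + s). comb b' (r + s) c \<in> U2}"
    and ?K3 = "{c \<in> vec s. comb d s c \<in> U3}"
  have gf: "g (f v) \<in> U3" if "v \<in> V1" for v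
    using ex[OF fV[OF that]] that U2(1) by (auto intro: bexI[of _ v])
  have gU: "g v \<in> U3" if "v \<in> V2" "v \<in> U2" for v
    using ex[OF that(1)] that V1(1) by (auto simp: f intro: bexI[of _ 0])
  have K1_iff: "c \<in> ?K2 \<longleftrightarrow> c \<in> ?K1" if "c \<in> vec r" for c
  proof -
    have "(\<lambda>i. c (i + r)) = 0" using that by (auto simp: vec_def)
    then have "comb b' (r + s) c = f (comb b r c)" by (simp add: comb_b')
    then show ?thesis using fU[OF combV1[OF that]] that vec_mono[OF that, of "r + s"] by simp
  qed
  have gen: "\<exists>c\<in>vec r. f v - f (comb b r c) \<in> U2" if "v \<in> V1" for v
  proof -
    obtain c where c: "c \<in> vec r" "v - comb b r c \<in> U1" using b(2) \<open>v \<in> V1\<close> by blast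
    then have "f (v - comb b r c) \<in> U2" using fU V1(5)[OF that combV1] by blast
    then show ?thesis using c(1) by (auto simp: f)
  qed
  \<comment> \<open>The maps are the inclusion of the first \<open>r\<close> coordinates and the
    projection to the last \<open>s\<close>.\<close>
  have "short_exact ?K1 {0} ?K2 {0} ?K3 {0} (\<lambda>c. c) (\<lambda>c i. c (i + r))"
  proof (rule short_exactI)
    fix c assume c: "c \<in> ?K2"
    have s: "(\<lambda>i. c (i + r)) \<in> vec s" using c shift by simp
    have cc: "c \<in> vec (r + s)" using c by simp
    have "g (comb b' (r + s) c) \<in> U3"
      using gU smod_comb[OF prems(3) b'V cc] c by simp
    then have "g (f (comb b r c)) + g (comb h s (\<lambda>i. c (i + r))) \<in> U3"
      by (simp add: comb_b' g)
    then have "g (comb h s (\<lambda>i. c (i + r))) \<in> U3"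
      using U3(5)[OF _ gf[OF combV1[OF cc]]] by fastforce
    then show "(\<lambda>i. c (i + r)) \<in> ?K3" using combU3_iff[OF s] s by simp
    show "(\<lambda>i. c (i + r)) \<in> {0} \<longleftrightarrow> (\<exists>w\<in>?K1. c - w \<in> {0})"
    proof
      assume z: "(\<lambda>i. c (i + r)) \<in> {0}"
      have "c i = 0" if "r \<le> i" for i
        using fun_cong[of "\<lambda>i. c (i + r)" 0 "i - r"] z that by simp
      then have "c \<in> vec r" using cc vecD[OF cc] by (simp add: vec_def)
      then show "\<exists>w\<in>?K1. c - w \<in> {0}" using K1_iff c by (intro bexI[of _ c]) simp_all
    qed (auto simp: vec_def)
  next
    fix c assume c: "c \<in> ?K3"
    then have cv: "c \<in> vec s" by simp
    have "g (comb h s c) \<in> U3" using combU3_iff[OF cv] c by simp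
    \<comment> \<open>For surjectivity a syzygy \<open>c\<close> of the third module has to be
      extended to the left: \<open>comb h s c\<close> lies only in f(V1) + U2, and its part in
      f(V1), written in the generators, is cancelled by the first \<open>r\<close>
      coordinates.\<close>
    then obtain v where v: "v \<in> V1" "comb h s c - f v \<in> U2" using ex[OF combV2[OF cv]] by blast
    obtain c1 where c1: "c1 \<in> vec r" "f v - f (comb b r c1) \<in> U2" using gen[OF v(1)] by blast
    have m: "- c1 \<in> vec r" using smodD(4)[OF smod_vec c1(1)] .
    have "comb b' (r + s) (join (- c1) c) \<in> U2"
      using U2(2)[OF v(2) c1(2)] by (simp add: join(2)[OF m cv] comb_uminus f)
    then show "\<exists>w\<in>?K2. c - (\<lambda>i. w (i + r)) \<in> {0}"
      by (intro bexI[of _ "join (- c1) c"]) (simp_all add: join[OF m cv])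
  next
    fix c assume "c \<in> ?K1"
    then show "c \<in> ?K2" using K1_iff by simp
  qed (use prems in \<open>simp_all only: smod_ker smod_zero linear_map_id linear_map_shift\<close>)
  then have "res p ?K2 {0}" using b(3) d(3) by (rule IH)
  moreover have "\<exists>c\<in>vec (r + s). v - comb b' (r + s) c \<in> U2" if v: "v \<in> V2" for v
  proof -
    obtain c2 where c2: "c2 \<in> vec s" "g v - comb d s c2 \<in> U3" using d(2) gV[OF v] by blast
    have "g (v - comb h s c2) \<in> U3"
      using U3(2)[OF c2(2) combU3[OF c2(1)]] by (simp add: g)
    then obtain w where w: "w \<in> V1" "v - comb h s c2 - f w \<in> U2"
      using ex[OF V2(5)[OF v combV2[OF c2(1)]]] by blast
    obtain c1 where c1: "c1 \<in> vec r" "f w - f (comb b r c1) \<in> U2" using gen[OF w(1)] by blast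
    have "v - comb b' (r + s) (join c1 c2) \<in> U2"
      using U2(2)[OF w(2) c1(2)] by (simp add: join(2)[OF c1(1) c2(1)] algebra_simps)
    then show ?thesis using join(1)[OF c1(1) c2(1)] by blast
  qed
  ultimately show ?thesis
    unfolding res.simps(2) using b'V by (intro exI[of _ "r + s"] exI[of _ b'] conjI) blast+
qed

lemma res_horseshoe:
  "short_exact V1 U1 V2 U2 V3 U3 f g \<Longrightarrow> res p V1 U1 \<Longrightarrow> res p V3 U3 \<Longrightarrow> res p V2 U2"
proof (induction p arbitrary: V1 U1 V2 U2 V3 U3 f g)
  case 0
  then show ?case using short_exact_trivial by simp
next
  case (Suc p)
  show ?case by (rule res_horseshoe_step[OF Suc.prems Suc.IH])
qed

text \<open>A syzygy of the generators of \<open>J\<close> together with \<open>x\<close> has its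
  last coordinate in \<open>J\<close>, since \<open>x\<close> is a nonzerodivisor modulo
  \<open>J\<close>. So 0 -> Syz(J) -> Syz(J + (x)) -> J -> 0 is exact, and the horseshoe lemma
  applies to it; up to this bookkeeping it is the mapping cone of multiplication by
  \<open>x\<close>.\<close>

lemma res_adjoin:
  assumes J: "is_ideal J" and x: "x \<in> A" and nzd: "\<And>s. s \<in> A \<Longrightarrow> x * s \<in> J \<Longrightarrow> s \<in> J"
    and res: "res k (emb ` J) {0}"
  shows "res (Suc k) (emb ` adjoin J x) {0}"
proof -
  note D = is_idealD[OF J]
  \<comment> \<open>\<open>res_Suc\<close> supplies generators of \<open>J\<close> even for
    \<open>k = 0\<close>, where the hypothesis only says that \<open>J\<close> is zero.\<close>
  obtain r b where b: "\<forall>i<r. b i \<in> emb ` J" "\<forall>v\<in>emb ` J. \<exists>c\<in>vec r. v - comb b r c \<in> {0}"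
    and K: "res k {c \<in> vec r. comb b r c \<in> {0}} {0}"
    using res_Suc[OF smod_zero res] by auto
  define b' where "b' = (\<lambda>i. if i < r then b i else emb x)"
  have comb_b': "comb b' (Suc r) c = comb b r c + emb (c r * x)" for c
    unfolding comb_Suc by (simp add: b'_def cong: comb_cong)
  have combJ: "comb b r c \<in> emb ` J" if "c \<in> vec r'" for c r'
    using smod_comb[OF smod_emb[OF J] _ that] b(1) by blast
  let ?K1 = "{c \<in> vec r. comb b r c \<in> {0}}" and ?K2 = "{c \<in> vec (Suc r). comb b' (Suc r) c \<in> {0}}"
  have "short_exact ?K1 {0} ?K2 {0} (emb ` J) {0} (\<lambda>c. c) (\<lambda>c. emb (c r))"
  proof (rule short_exactI)
    fix c assume "c \<in> ?K1"
    then show "c \<in> ?K2" using vec_mono[of c r "Suc r"] by (auto simp: comb_b' vec_def)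
  next
    fix c assume c: "c \<in> ?K2"
    then obtain j where j: "comb b r c = emb j" "j \<in> J" using combJ by blast
    have "emb (j + c r * x) = 0" using c j(1) by (simp add: comb_b')
    then have "x * c r = - j" by (simp add: mult.commute eq_neg_iff_add_eq_0 add.commute)
    then have "c r \<in> J" using nzd[of "c r"] D(6)[OF j(2)] c vecD[of c "Suc r" r] by simp
    then show "emb (c r) \<in> emb ` J" by simp
    show "emb (c r) \<in> {0} \<longleftrightarrow> (\<exists>w\<in>?K1. c - w \<in> {0})"
    proof
      assume "emb (c r) \<in> {0}"
      then have "c r = 0" by simp
      then have "c \<in> ?K1" using c by (auto simp: vec_def comb_b' le_less_Suc_eq) (metis not_less_eq_eq le_antisym)
      then show "\<exists>w\<in>?K1. c - w \<in> {0}" by (intro bexI[of _ c]) simp_all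
    qed (auto simp: vec_def)
  next
    fix v assume "v \<in> emb ` J"
    then obtain s where s: "v = emb s" "s \<in> J" by blast
    then obtain e where e: "e \<in> vec r" "comb b r e = emb s" using b(2) by auto
    \<comment> \<open>The trivial relation between \<open>s\<close> and \<open>x\<close>: writing
      \<open>s\<close> in the generators of \<open>J\<close> with coefficients \<open>e\<close>, the
      syzygy has coordinates \<open>- x e\<close> and last coordinate \<open>s\<close>.\<close>
    define c where "c = smul (- x) e + (\<lambda>i. if i = r then s else 0)"
    have e0: "e r = 0" using e(1) by (simp add: vec_def)
    have "comb b r c = comb b r (smul (- x) e)" by (intro comb_cong) (simp_all add: c_def)
    then have "comb b' (Suc r) c = 0"
      by (simp only: comb_b' comb_smul e(2)) (simp add: c_def smul_apply e0 mult.commute)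
    moreover have "c \<in> vec (Suc r)"
      using e(1) x s D(1) vecD[OF e(1)] by (auto simp: vec_def c_def smul_def)
    moreover have "c r = s" by (simp add: c_def smul_apply e0)
    ultimately show "\<exists>w\<in>?K2. v - emb (w r) \<in> {0}" using s by (intro bexI[of _ c]) simp_all
  qed (simp_all only: smod_ker smod_zero smod_emb J linear_map_id linear_map_emb)
  then have "res k ?K2 {0}" using K res by (rule res_horseshoe)
  moreover have "b' i \<in> emb ` adjoin J x" if "i < Suc r" for i
    using that b(1) adjoin_superset[of J x] adjoin_self[OF D(2), of x] by (auto simp: b'_def less_Suc_eq)
  moreover have "\<exists>c\<in>vec (Suc r). v - comb b' (Suc r) c \<in> {0}" if "v \<in> emb ` adjoin J x" for v
  proof -
    obtain y where "v = emb y" "y \<in> adjoin J x" using \<open>v \<in> emb ` adjoin J x\<close> by blast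
    then obtain j a where v: "v = emb (j + x * a)" "j \<in> J" "a \<in> A" by (auto simp: adjoin_def)
    then obtain e where e: "e \<in> vec r" "comb b r e = emb j" using b(2) by auto
    define c where "c = e + (\<lambda>i. if i = r then a else 0)"
    have e0: "e r = 0" using e(1) by (simp add: vec_def)
    have "comb b r c = comb b r e" by (intro comb_cong) (simp_all add: c_def)
    moreover have "c \<in> vec (Suc r)"
      using e(1) v(3) vecD[OF e(1)] by (auto simp: vec_def c_def)
    moreover have "c r = a" by (simp add: c_def e0)
    ultimately show ?thesis using e v by (intro bexI[of _ c]) (simp_all add: comb_b' mult.commute)
  qed
  ultimately show ?thesis
    unfolding res.simps(2) by (intro exI[of _ "Suc r"] exI[of _ b'] conjI) blast+
qed

lemma res_quotient:
  assumes "is_ideal J" "res k (emb ` J) {0}"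
  shows "res (Suc k) (emb ` A) (emb ` J)"
proof -
  note D = is_idealD[OF assms(1)]
  have c: "comb (\<lambda>i. emb 1) (Suc 0) c = emb (c 0)" for c :: "nat \<Rightarrow> 'a" by (simp add: comb_Suc)
  have "{c \<in> vec (Suc 0). comb (\<lambda>i. emb 1) (Suc 0) c \<in> emb ` J} = emb ` J"
    using D(1) by (auto simp: c vec_Suc_0)
  moreover have "\<exists>c\<in>vec (Suc 0). v - comb (\<lambda>i. emb 1) (Suc 0) c \<in> emb ` J" if "v \<in> emb ` A" for v
    using that D(2) by (intro bexI[of _ v]) (auto simp: c vec_Suc_0)
  ultimately show ?thesis
    unfolding res.simps(2) using assms(2)
    by (intro exI[of _ "Suc 0"] exI[of _ "\<lambda>i. emb 1"] conjI) auto
qed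

text \<open>The exact sequence 0 -> A/(J : x) -> A/J -> A/(J + (x)) -> 0, whose first map is
  multiplication by \<open>x\<close>.\<close>

lemma res_extension:
  assumes J: "is_ideal J" and x: "x \<in> A"
    and "res p (emb ` A) (emb ` colon J x)" "res p (emb ` A) (emb ` adjoin J x)"
  shows "res p (emb ` A) (emb ` J)"
proof (rule res_horseshoe[OF short_exactI, where f = "smul x" and g = "\<lambda>c. c"])
  fix v assume "v \<in> emb ` A"
  then obtain a where a: "v = emb a" "a \<in> A" by blast
  show "smul x v \<in> emb ` A" using a x by simp
  show "smul x v \<in> emb ` J \<longleftrightarrow> v \<in> emb ` colon J x" using a by (simp add: colon_def)
  show "\<exists>w\<in>emb ` A. v - w \<in> emb ` adjoin J x"
    using a is_idealD(2)[OF is_ideal_adjoin[OF J x]] by (intro bexI[of _ v]) (auto intro: image_eqI[of _ _ 0])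
  have "a \<in> adjoin J x \<longleftrightarrow> (\<exists>w\<in>A. a - x * w \<in> J)"
  proof
    assume "\<exists>w\<in>A. a - x * w \<in> J"
    then obtain w where "w \<in> A" "a - x * w \<in> J" by blast
    then show "a \<in> adjoin J x" using adjoinI[of "a - x * w" J w x] by simp
  next
    assume "a \<in> adjoin J x"
    then obtain j w where "a = j + x * w" "j \<in> J" "w \<in> A" by (auto simp: adjoin_def)
    then show "\<exists>w\<in>A. a - x * w \<in> J" by (intro bexI[of _ w]) simp_all
  qed
  then show "v \<in> emb ` adjoin J x \<longleftrightarrow> (\<exists>w\<in>emb ` A. v - smul x w \<in> emb ` J)"
    using a by simp
qed (use assms in \<open>simp_all add: smod_emb is_ideal_A is_ideal_colon is_ideal_adjoin linear_map_id linear_map_smul\<close>)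

text \<open>The recursion \<open>res\<close> unfolded into ranks \<open>r i\<close> and matrices
  with columns \<open>b i j\<close>, indexed by the homological degree, as a resolution in the
  official sense requires.\<close>

definition free_chain :: "(nat \<Rightarrow> 'a) set \<Rightarrow> nat \<Rightarrow> (nat \<Rightarrow> nat) \<Rightarrow> (nat \<Rightarrow> nat \<Rightarrow> nat \<Rightarrow> 'a) \<Rightarrow> bool" where
  "free_chain V p r b \<longleftrightarrow> (\<forall>i\<ge>p. r i = 0) \<and> (\<forall>i. \<forall>j<r (Suc i). b (Suc i) j \<in> vec (r i)) \<and>
    comb (b 0) (r 0) ` vec (r 0) = V \<and> (\<forall>i<r 0. b 0 i \<in> V) \<and>
    (\<forall>i. comb (b (Suc i)) (r (Suc i)) ` vec (r (Suc i)) = {c \<in> vec (r i). comb (b i) (r i) c \<in> {0}})"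

lemma free_chain_step:
  assumes V: "smod V" and "res (Suc p) V {0}"
    and IH: "\<And>V. smod V \<Longrightarrow> res p V {0} \<Longrightarrow> \<exists>r b. free_chain V p r b"
  shows "\<exists>r b. free_chain V (Suc p) r b"
proof -
  obtain s d where d: "\<forall>i<s. d i \<in> V" "\<forall>v\<in>V. \<exists>c\<in>vec s. v - comb d s c \<in> {0}"
    "res p {c \<in> vec s. comb d s c \<in> {0}} {0}" using assms(2) by auto
  obtain r b where rb: "free_chain {c \<in> vec s. comb d s c \<in> {0}} p r b"
    using IH[OF smod_ker[OF smod_zero] d(3)] by blast
  have "comb d s ` vec s = V"
  proof (intro equalityI subsetI)
    fix v assume "v \<in> V"
    then obtain c where "c \<in> vec s" "v = comb d s c" using d(2) by auto
    then show "v \<in> comb d s ` vec s" by blast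
  qed (use smod_comb[OF V] d(1) in auto)
  then have "free_chain V (Suc p) (case_nat s r) (case_nat d b)"
    unfolding free_chain_def
  proof (intro conjI allI impI)
    fix i
    show "case_nat s r i = 0" if "Suc p \<le> i"
      using that rb by (cases i) (auto simp: free_chain_def)
    show "comb (case_nat d b (Suc i)) (case_nat s r (Suc i)) ` vec (case_nat s r (Suc i)) =
        {c \<in> vec (case_nat s r i). comb (case_nat d b i) (case_nat s r i) c \<in> {0}}"
      using rb by (cases i) (simp_all add: free_chain_def)
    show "case_nat d b (Suc i) j \<in> vec (case_nat s r i)" if "j < case_nat s r (Suc i)" for j
      using that rb by (cases i) (simp_all add: free_chain_def)
  qed (use d(1) in simp_all)
  then show ?thesis by blast
qed

lemma res_free_chain: "smod V \<Longrightarrow> res p V {0} \<Longrightarrow> \<exists>r b. free_chain V p r b"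
proof (induction p arbitrary: V)
  case 0
  have "V \<subseteq> {0}" using "0.prems"(2) by (simp only: res.simps)
  then have "V = {0}" using smodD(1)[OF "0.prems"(1)] by blast
  then have "free_chain V 0 (\<lambda>_. 0) (\<lambda>_ _. 0)" by (auto simp: free_chain_def)
  then show ?case by blast
next
  case (Suc p)
  show ?case by (rule free_chain_step[OF Suc.prems Suc.IH])
qed

end

section \<open>Transfer to module records: quotients, free modules and official resolutions\<close>

lemma free_module_carrier_finite:
  "finite B \<Longrightarrow> carrier (free_module R B) = {f. (\<forall>b\<in>B. f b \<in> carrier R) \<and> (\<forall>b. b \<notin> B \<longrightarrow> f b = \<zero>\<^bsub>R\<^esub>)}"
  by (auto simp: free_module_simps intro: finite_subset)

text \<open>The basis has to be moved into the type of elements of the module.\<close>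

lemma (in cring) projective_free_module:
  fixes B :: "'c set"
  assumes "\<one> \<noteq> \<zero>"
  shows "projective R (free_module R B)"
  unfolding projective_def
proof (intro conjI exI)
  define \<chi> where "\<chi> = (\<lambda>(b :: 'c) y. if y = b then \<one> else \<zero>)"
  have inj: "inj \<chi>" using assms by (auto simp: inj_def \<chi>_def fun_eq_iff)
  let ?F = "free_module R B" and ?G = "free_module R (\<chi> ` B)"
  define \<iota> where "\<iota> = (\<lambda>(f :: 'c \<Rightarrow> 'a) g. if g \<in> \<chi> ` B then f (inv_into UNIV \<chi> g) else \<zero>)"
  define \<pi> where "\<pi> = (\<lambda>(h :: ('c \<Rightarrow> 'a) \<Rightarrow> 'a) b. if b \<in> B then h (\<chi> b) else \<zero>)"
  show "Module.module R ?F" by (rule free_module_module)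
  have fin: "finite {g. \<iota> f g \<noteq> \<zero>}" if "f \<in> carrier ?F" for f
    by (rule finite_subset[of _ "\<chi> ` {b. f b \<noteq> \<zero>}"])
      (use that inv_f_f[OF inj] in \<open>auto simp: \<iota>_def free_module_simps split: if_splits\<close>)
  have fin': "finite {b. \<pi> h b \<noteq> \<zero>}" if "h \<in> carrier ?G" for h
    by (rule finite_subset[of _ "\<chi> -` {g. h g \<noteq> \<zero>}"])
      (use that finite_vimageI[OF _ inj, of "{g. h g \<noteq> \<zero>}"] in \<open>auto simp: \<pi>_def free_module_simps\<close>)
  show "\<iota> \<in> module_hom R ?F ?G"
    unfolding module_hom_def using fin inv_f_f[OF inj]
    by (auto simp: free_module_simps \<iota>_def fun_eq_iff)
  show "\<pi> \<in> module_hom R ?G ?F"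
    unfolding module_hom_def using fin'
    by (auto simp: free_module_simps \<pi>_def fun_eq_iff)
  show "\<forall>f\<in>carrier ?F. \<pi> (\<iota> f) = f"
    using inv_f_f[OF inj] by (auto simp: free_module_simps \<iota>_def \<pi>_def fun_eq_iff)
qed

context comm_subring
begin

definition sub_ring :: "'a ring" where
  "sub_ring = \<lparr>carrier = A, mult = (*), one = 1, zero = 0, add = (+)\<rparr>"

lemma sub_ring_simps [simp]:
  "carrier sub_ring = A" "mult sub_ring = (*)" "one sub_ring = 1" "zero sub_ring = 0"
  "add sub_ring = (+)"
  by (simp_all add: sub_ring_def)

lemma sub_ring_cring: "cring sub_ring"
proof (rule cringI)
  show "abelian_group sub_ring"
    by (rule abelian_groupI) (auto simp: add.assoc add.commute intro: bexI[of _ "- _"])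
  show "Group.comm_monoid sub_ring"
    by (rule Group.comm_monoidI) (auto simp: mult.assoc mult.commute)
qed (simp add: distrib_right)

sublocale R: cring sub_ring
  by (rule sub_ring_cring)

lemma a_inv_sub_ring [simp]: "x \<in> A \<Longrightarrow> \<ominus>\<^bsub>sub_ring\<^esub> x = - x"
  using R.minus_equality[of "- x" x] by simp

lemma ideal_iff: "ideal J sub_ring \<longleftrightarrow> is_ideal J"
proof
  assume "ideal J sub_ring"
  then interpret ideal J sub_ring .
  show "is_ideal J"
    unfolding is_ideal_def using a_subset zero_closed a_closed I_l_closed by auto
next
  assume J: "is_ideal J"
  note D = is_idealD[OF J]
  show "ideal J sub_ring"
  proof (rule idealI)
    show "subgroup J (add_monoid sub_ring)"
    proof (rule group.subgroupI)
      show "Group.group (add_monoid sub_ring)" using R.a_group .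
      fix a assume a: "a \<in> J"
      then show "inv\<^bsub>add_monoid sub_ring\<^esub> a \<in> J"
        using D(6)[OF a] a_inv_sub_ring[OF D(1)[OF a]] by (simp add: a_inv_def)
    qed (use D in auto)
  qed (use D sub_ring_cring in \<open>auto simp: cring_def\<close>)
qed

abbreviation coset :: "'a set \<Rightarrow> 'a \<Rightarrow> 'a set" where
  "coset J a \<equiv> J +>\<^bsub>sub_ring\<^esub> a"

abbreviation quot :: "'a set \<Rightarrow> ('a, 'a set) module" where
  "quot J \<equiv> quot_module sub_ring J"

lemma coset_eq_iff:
  assumes "is_ideal J" "a \<in> A" "b \<in> A"
  shows "coset J a = coset J b \<longleftrightarrow> a - b \<in> J"
proof -
  have "a \<ominus>\<^bsub>sub_ring\<^esub> b = a - b" using assms by (simp add: a_minus_def)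
  then show ?thesis
    using R.quotient_eq_iff_same_a_r_cos[of J a b] assms by (simp add: ideal_iff)
qed

lemma coset_zero_iff:
  assumes "is_ideal J" "a \<in> A"
  shows "coset J a = J \<longleftrightarrow> a \<in> J"
  using coset_eq_iff[OF assms zero_mem] R.a_rcos_zero[of J 0] is_idealD(2)[OF assms(1)] assms(1)
  by (simp add: ideal_iff)

lemma quot_module_simps:
  assumes "is_ideal J"
  shows "carrier (quot J) = coset J ` A"
    and "\<zero>\<^bsub>quot J\<^esub> = J"
    and "a \<in> A \<Longrightarrow> b \<in> A \<Longrightarrow> coset J a \<oplus>\<^bsub>quot J\<^esub> coset J b =
      coset J (a + b)"
    and "a \<in> A \<Longrightarrow> b \<in> A \<Longrightarrow> a \<odot>\<^bsub>quot J\<^esub> coset J b = coset J (a * b)"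
proof -
  interpret J: ideal J sub_ring using assms by (simp add: ideal_iff)
  show "carrier (quot J) = coset J ` A"
    by (auto simp: quot_module_def FactRing_def A_RCOSETS_def')
  show "\<zero>\<^bsub>quot J\<^esub> = J" by (simp add: quot_module_def FactRing_def)
  show "coset J a \<oplus>\<^bsub>quot J\<^esub> coset J b = coset J (a + b)"
    if "a \<in> A" "b \<in> A" for a b
    using J.a_rcos_sum[of a b] that by (simp add: quot_module_def FactRing_def)
  show "a \<odot>\<^bsub>quot J\<^esub> coset J b = coset J (a * b)"
    if "a \<in> A" "b \<in> A" for a b
    using J.rcoset_mult_add[of a b] that by (simp add: quot_module_def FactRing_def)
qed

lemma quot_module_module:
  assumes J: "is_ideal J"
  shows "Module.module sub_ring (quot J)"
proof (rule moduleI)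
  note S = quot_module_simps[OF J]
  show "cring sub_ring" by (rule sub_ring_cring)
  show "abelian_group (quot J)"
  proof (rule abelian_groupI)
    fix x assume "x \<in> carrier (quot J)"
    then obtain a where a: "x = coset J a" "a \<in> A" by (auto simp: S)
    have z: "J = coset J 0" using coset_zero_iff[OF J zero_mem] is_idealD(2)[OF J] by simp
    have "\<zero>\<^bsub>quot J\<^esub> \<oplus>\<^bsub>quot J\<^esub> x =
        coset J 0 \<oplus>\<^bsub>quot J\<^esub> coset J a"
      unfolding S(2) a(1) using z by simp
    then show "\<zero>\<^bsub>quot J\<^esub> \<oplus>\<^bsub>quot J\<^esub> x = x"
      using a S(3)[OF zero_mem a(2)] by simp
    have "coset J (- a) \<oplus>\<^bsub>quot J\<^esub> x = J"
      using a z by (simp add: S(3))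
    then show "\<exists>y\<in>carrier (quot J). y \<oplus>\<^bsub>quot J\<^esub> x =
        \<zero>\<^bsub>quot J\<^esub>"
      using a by (intro bexI[of _ "coset J (- a)"]) (simp_all add: S)
  next
    show "\<zero>\<^bsub>quot J\<^esub> \<in> carrier (quot J)"
      unfolding S(1,2) using coset_zero_iff[OF J zero_mem] is_idealD(2)[OF J]
      by (intro image_eqI[of _ _ 0]) simp_all
  qed (auto simp: S ac_simps)
qed (auto simp: quot_module_simps[OF J] algebra_simps)

end

text \<open>Coordinates for the free modules on the finite subsets \<open>{w} \<times> {..<r}\<close> of \<^typ>\<open>'b \<times> nat\<close>.\<close>

definition enc :: "'b \<Rightarrow> (nat \<Rightarrow> 'a::comm_ring_1) \<Rightarrow> 'b \<times> nat \<Rightarrow> 'a" where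
  "enc w v = (\<lambda>(y, j). if y = w then v j else 0)"

definition dec :: "'b \<Rightarrow> ('b \<times> nat \<Rightarrow> 'a::comm_ring_1) \<Rightarrow> nat \<Rightarrow> 'a" where
  "dec w f = (\<lambda>j. f (w, j))"

lemma dec_enc [simp]: "dec w (enc w v) = v"
  by (simp add: dec_def enc_def)

lemma enc_dec_simps [simp]:
  "enc w (u + v) = (\<lambda>b. enc w u b + enc w v b)" "enc w (smul a v) = (\<lambda>b. a * enc w v b)"
  "dec w (\<lambda>b. f b + g b) = dec w f + dec w g" "dec w (\<lambda>b. a * f b) = smul a (dec w f)"
  by (auto simp: enc_def dec_def smul_def fun_eq_iff)

context comm_subring
begin

abbreviation coord_module :: "'b \<Rightarrow> nat \<Rightarrow> ('a, 'b \<times> nat \<Rightarrow> 'a) module" where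
  "coord_module w r \<equiv> free_module sub_ring ({w} \<times> {..<r})"

lemma coord_module_simps:
  shows "carrier (coord_module w r) = enc w ` vec r"
    and "\<zero>\<^bsub>coord_module w r\<^esub> = enc w 0"
    and "f \<oplus>\<^bsub>coord_module w r\<^esub> g = (\<lambda>b. f b + g b)"
    and "a \<odot>\<^bsub>coord_module w r\<^esub> f = (\<lambda>b. a * f b)"
proof -
  show "carrier (coord_module w r) = enc w ` vec r"
  proof (intro equalityI subsetI)
    fix f assume f: "f \<in> carrier (coord_module w r)"
    then have "f = enc w (dec w f)" "dec w f \<in> vec r"
      by (auto simp: free_module_carrier_finite enc_def dec_def vec_def fun_eq_iff)
    then show "f \<in> enc w ` vec r" by blast
  qed (auto simp: free_module_carrier_finite enc_def vec_def)
qed (auto simp: free_module_simps enc_def fun_eq_iff)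

lemma enc_eq_zero_iff: "enc w v = enc w 0 \<longleftrightarrow> v = 0"
  by (metis dec_enc)

lemma coord_module_hom:
  assumes "\<And>j. j < s \<Longrightarrow> b j \<in> vec r"
  shows "(\<lambda>f. enc w (comb b s (dec w f))) \<in> module_hom sub_ring (coord_module w s) (coord_module w r)"
proof -
  have "comb b s c \<in> vec r" if "c \<in> vec s" for c
    using smod_comb[OF smod_vec assms that] .
  then show ?thesis
    unfolding module_hom_def by (auto simp: coord_module_simps comb_add comb_smul)
qed

text \<open>The generators \<open>d\<close> of A/J give the module in degree 0, and the free chain
  of their syzygies gives all higher degrees.\<close>

theorem res_projective_resolution:
  assumes J: "is_ideal J" and res: "res (Suc p) (emb ` A) (emb ` J)"
  shows "has_projective_resolution sub_ring (quot J) p"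
proof -
  obtain s d where d: "\<forall>i<s. d i \<in> emb ` A" "\<forall>v\<in>emb ` A. \<exists>c\<in>vec s. v - comb d s c \<in> emb ` J"
    "res p {c \<in> vec s. comb d s c \<in> emb ` J} {0}" using res by auto
  obtain r b where rb: "free_chain {c \<in> vec s. comb d s c \<in> emb ` J} p r b"
    using res_free_chain[OF smod_ker[OF smod_emb[OF J]] d(3)] by blast
  \<comment> \<open>A fixed label, which turns the indices below a rank into elements of the index
    type prescribed by \<open>has_projective_resolution\<close>.\<close>
  define w :: "'a set" where "w = undefined"
  \<comment> \<open>The chain starts at the first syzygies, so its ranks are shifted by one and
    \<open>s\<close> is put in front.\<close>
  define \<rho> where "\<rho> = case_nat s r"
  define P where "P = (\<lambda>i. coord_module w (\<rho> i))"
  define \<delta> where "\<delta> = (\<lambda>i f. enc w (comb (b i) (\<rho> (Suc i)) (dec w f)))"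
  define \<epsilon> where "\<epsilon> = (\<lambda>f. coset J (comb d s (dec w f) 0))"
  note Q = quot_module_simps[OF J]
  note P_simps = P_def coord_module_simps
  have bV: "b i j \<in> vec (\<rho> i)" if "j < \<rho> (Suc i)" for i j
    using that rb by (cases i) (auto simp: free_chain_def \<rho>_def)
  have combA: "\<exists>a\<in>A. comb d s c = emb a" if "c \<in> vec r'" for c r'
    using smod_comb[OF smod_emb[OF is_ideal_A] _ that] d(1) by blast
  have ex: "comb (b (Suc i)) (\<rho> (Suc (Suc i))) ` vec (\<rho> (Suc (Suc i))) =
      {c \<in> vec (\<rho> (Suc i)). comb (b i) (\<rho> (Suc i)) c = 0}" for i
    using rb by (simp add: free_chain_def \<rho>_def)
  have ex0: "comb (b 0) (\<rho> (Suc 0)) ` vec (\<rho> (Suc 0)) = {c \<in> vec s. comb d s c \<in> emb ` J}"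
    using rb by (simp add: free_chain_def \<rho>_def)
  have ker: "module_ker (P (Suc i)) (P i) (\<delta> i) = enc w ` {c \<in> vec (\<rho> (Suc i)). comb (b i) (\<rho> (Suc i)) c = 0}" for i
    unfolding module_ker_def P_simps by (auto simp: \<delta>_def enc_eq_zero_iff)
  have img: "\<delta> i ` carrier (P (Suc i)) = enc w ` comb (b i) (\<rho> (Suc i)) ` vec (\<rho> (Suc i))" for i
    unfolding P_simps by (simp add: image_image \<delta>_def)
  have ker0: "module_ker (P 0) (quot J) \<epsilon> = enc w ` {c \<in> vec s. comb d s c \<in> emb ` J}"
  proof -
    have "\<epsilon> (enc w c) = J \<longleftrightarrow> comb d s c \<in> emb ` J" if c: "c \<in> vec s" for c
    proof -
      obtain a where "a \<in> A" "comb d s c = emb a" using combA[OF c] by blast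
      then show ?thesis using coset_zero_iff[OF J, of a] by (simp add: \<epsilon>_def)
    qed
    moreover have "carrier (P 0) = enc w ` vec s" by (simp add: P_simps \<rho>_def)
    moreover have "{x \<in> enc w ` vec s. \<epsilon> x = J} = enc w ` {c \<in> vec s. \<epsilon> (enc w c) = J}" by blast
    ultimately show ?thesis unfolding module_ker_def Q(2) by (simp cong: conj_cong)
  qed
  have "projective sub_ring (P i)" for i
    unfolding P_def by (rule R.projective_free_module) simp
  moreover have "carrier (P i) = {\<zero>\<^bsub>P i\<^esub>}" if "p < i" for i
  proof -
    have "\<rho> i = 0" using that rb by (cases i) (auto simp: \<rho>_def free_chain_def)
    then show ?thesis unfolding P_simps by simp
  qed
  moreover have "\<epsilon> \<in> module_hom sub_ring (P 0) (quot J)"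
    unfolding module_hom_def
  proof (intro CollectI conjI funcsetI ballI)
    fix f assume "f \<in> carrier (P 0)"
    then obtain c where c: "f = enc w c" "c \<in> vec s" by (auto simp: P_simps \<rho>_def)
    obtain a where a: "a \<in> A" "comb d s c = emb a" using combA[OF c(2)] by blast
    show "\<epsilon> f \<in> carrier (quot J)" using a by (simp add: Q \<epsilon>_def c)
    {
      fix g assume "g \<in> carrier (P 0)"
      then obtain c' where c': "g = enc w c'" "c' \<in> vec s" by (auto simp: P_simps \<rho>_def)
      obtain a' where a': "a' \<in> A" "comb d s c' = emb a'" using combA[OF c'(2)] by blast
      show "\<epsilon> (f \<oplus>\<^bsub>P 0\<^esub> g) = \<epsilon> f \<oplus>\<^bsub>quot J\<^esub> \<epsilon> g"
        using a a' by (simp add: Q \<epsilon>_def c c' P_simps comb_add)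
    next
      fix x assume "x \<in> carrier sub_ring"
      then show "\<epsilon> (x \<odot>\<^bsub>P 0\<^esub> f) = x \<odot>\<^bsub>quot J\<^esub> \<epsilon> f"
        using a by (simp add: Q \<epsilon>_def c P_simps comb_smul)
    }
  qed
  moreover have "\<epsilon> ` carrier (P 0) = carrier (quot J)"
  proof (intro equalityI subsetI)
    fix X assume "X \<in> \<epsilon> ` carrier (P 0)"
    then show "X \<in> carrier (quot J)"
      using calculation(3) by (auto simp: module_hom_def)
  next
    fix X assume "X \<in> carrier (quot J)"
    then obtain a where a: "X = coset J a" "a \<in> A" by (auto simp: Q)
    then obtain c where c: "c \<in> vec s" "emb a - comb d s c \<in> emb ` J" using d(2) by blast
    obtain a' where a': "a' \<in> A" "comb d s c = emb a'" using combA[OF c(1)] by blast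
    have "\<epsilon> (enc w c) = X" using c(2) a a' coset_eq_iff[OF J a(2) a'(1)] by (simp add: \<epsilon>_def)
    moreover have "enc w c \<in> carrier (P 0)" using c(1) by (simp add: P_simps \<rho>_def)
    ultimately show "X \<in> \<epsilon> ` carrier (P 0)" by blast
  qed
  moreover have "\<delta> i \<in> module_hom sub_ring (P (Suc i)) (P i)" for i
    unfolding \<delta>_def P_def using bV by (rule coord_module_hom)
  moreover have "\<delta> 0 ` carrier (P (Suc 0)) = module_ker (P 0) (quot J) \<epsilon>"
    unfolding img ker0 ex0 ..
  moreover have "\<delta> (Suc i) ` carrier (P (Suc (Suc i))) = module_ker (P (Suc i)) (P i) (\<delta> i)" for i
    unfolding img ker ex ..
  ultimately show ?thesis
    unfolding has_projective_resolution_def by (intro exI[of _ P] exI[of _ \<epsilon>] exI[of _ \<delta>]) simp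
qed

end

section \<open>Regular sequences on cyclic modules\<close>

context comm_subring
begin

text \<open>\<open>gen J as\<close> is \<open>J + (as)\<close>; \<open>nzd J a\<close> and \<open>regs J as\<close> say that \<open>a\<close> is a nonzerodivisor and \<open>as\<close> a
  regular sequence on \<open>A/J\<close>, where \<open>A/(J + (as))\<close> may be zero.\<close>

primrec gen :: "'a set \<Rightarrow> 'a list \<Rightarrow> 'a set" where
  "gen J [] = J"
| "gen J (a # as) = gen (adjoin J a) as"

definition nzd :: "'a set \<Rightarrow> 'a \<Rightarrow> bool" where
  "nzd J a \<longleftrightarrow> (\<forall>f\<in>A. a * f \<in> J \<longrightarrow> f \<in> J)"

primrec regs :: "'a set \<Rightarrow> 'a list \<Rightarrow> bool" where
  "regs J [] \<longleftrightarrow> True"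
| "regs J (a # as) \<longleftrightarrow> nzd J a \<and> regs (adjoin J a) as"

lemma nzdD: "nzd J a \<Longrightarrow> f \<in> A \<Longrightarrow> a * f \<in> J \<Longrightarrow> f \<in> J"
  by (simp add: nzd_def)

lemma nzd_mult: "nzd J a \<Longrightarrow> nzd J b \<Longrightarrow> b \<in> A \<Longrightarrow> nzd J (a * b)"
  by (simp add: nzd_def mult.assoc)

lemma nzd_power: "nzd J a \<Longrightarrow> a \<in> A \<Longrightarrow> nzd J (a ^ k)"
proof (induction k)
  case 0
  show ?case by (simp add: nzd_def)
qed (simp add: nzd_mult)

lemma gen_append: "gen J (as @ bs) = gen (gen J as) bs"
  by (induction as arbitrary: J) simp_all

lemma is_ideal_gen: "is_ideal J \<Longrightarrow> set as \<subseteq> A \<Longrightarrow> is_ideal (gen J as)"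
  by (induction as arbitrary: J) (simp_all add: is_ideal_adjoin)

lemma gen_superset: "J \<subseteq> gen J as"
proof (induction as arbitrary: J)
  case (Cons a as)
  then show ?case using adjoin_superset[of J a] by force
qed simp

lemma regs_iff_nth: "regs J as \<longleftrightarrow> (\<forall>i<length as. nzd (gen J (take i as)) (as ! i))"
  by (induction as arbitrary: J) (simp_all add: All_less_Suc2)

lemma adjoin_subset: "is_ideal L \<Longrightarrow> J \<subseteq> L \<Longrightarrow> x \<in> L \<Longrightarrow> adjoin J x \<subseteq> L"
  by (auto simp: adjoin_def subset_iff is_idealD)

lemma adjoin_commute: "adjoin (adjoin J a) b = adjoin (adjoin J b) a"
proof -
  have "adjoin (adjoin J a) b \<subseteq> adjoin (adjoin J b) a" for a b
  proof
    fix f assume "f \<in> adjoin (adjoin J a) b"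
    then obtain j g h where f: "f = j + a * g + b * h" "j \<in> J" "g \<in> A" "h \<in> A"
      by (auto simp: adjoin_def)
    have "(j + b * h) + a * g \<in> adjoin (adjoin J b) a"
      by (intro adjoinI f)
    then show "f \<in> adjoin (adjoin J b) a" by (simp add: f algebra_simps)
  qed
  then show ?thesis by blast
qed

lemma adjoin_absorb:
  assumes "is_ideal J" "x \<in> J"
  shows "adjoin J x = J"
  using adjoin_subset[OF assms(1) order.refl assms(2)] adjoin_superset[of J x] by blast

text \<open>In x g = j + b h, regularity of \<open>b\<close> modulo J + (x) puts \<open>h\<close>
  into J + (x), so that a multiple of \<open>b\<close> can be split off from \<open>g\<close>. This
  is what keeps the exact sequence of colon and sum exact modulo \<open>b\<close>.\<close>

lemma colon_adjoin:
  assumes J: "is_ideal J" and x: "x \<in> A" and b: "b \<in> A" and nzd: "nzd (adjoin J x) b"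
  shows "colon (adjoin J b) x = adjoin (colon J x) b"
proof (intro equalityI subsetI)
  note D = is_idealD[OF J]
  fix g assume "g \<in> colon (adjoin J b) x"
  then obtain j h where g: "g \<in> A" "x * g = j + b * h" "j \<in> J" "h \<in> A"
    by (auto simp: colon_def adjoin_def)
  have "b * h = - j + x * g" using g(2) by simp
  then have "b * h \<in> adjoin J x" using adjoinI[OF D(6)[OF g(3)] g(1), of x] by simp
  then have "h \<in> adjoin J x" using nzdD[OF nzd g(4)] by simp
  then obtain j' k where h: "h = j' + x * k" "j' \<in> J" "k \<in> A" by (auto simp: adjoin_def)
  have "x * (g - b * k) = j + b * j'" using g(2) h(1) by (simp add: algebra_simps)
  then have "g - b * k \<in> colon J x"
    using D(3)[OF g(3) D(4)[OF b h(2)]] g(1) b h(3) by (simp add: colon_def)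
  then show "g \<in> adjoin (colon J x) b" using adjoinI[of "g - b * k" _ k b] h(3) by simp
next
  fix g assume "g \<in> adjoin (colon J x) b"
  then obtain n k where g: "g = n + b * k" "n \<in> A" "x * n \<in> J" "k \<in> A"
    by (auto simp: colon_def adjoin_def)
  have "x * n + b * (x * k) \<in> adjoin J b" using g x by (intro adjoinI) simp_all
  then show "g \<in> colon (adjoin J b) x" using g b by (simp add: colon_def algebra_simps)
qed

text \<open>A sequence regular on both ends of 0 -> A/(J : x) -> A/J -> A/(J + (x)) -> 0 is regular
  in the middle. By \<open>colon_adjoin\<close> the sequence stays of this form after dividing out
  its first element, which drives the induction.\<close>

lemma regs_extension:
  assumes "is_ideal J" "x \<in> A" "set as \<subseteq> A" "regs (colon J x) as" "regs (adjoin J x) as"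
  shows "regs J as"
  using assms
proof (induction as arbitrary: J)
  case (Cons b as)
  note D = is_idealD[OF Cons.prems(1)]
  have b: "b \<in> A" "nzd (colon J x) b" "nzd (adjoin J x) b" using Cons.prems by simp_all
  have "nzd J b"
    unfolding nzd_def
  proof (intro ballI impI)
    fix f assume f: "f \<in> A" "b * f \<in> J"
    have "f \<in> adjoin J x" using nzdD[OF b(3) f(1)] f(2) adjoin_superset[of J x] by blast
    then obtain j g where g: "f = j + x * g" "j \<in> J" "g \<in> A" by (auto simp: adjoin_def)
    have "x * (b * g) = b * f - b * j" by (simp add: g algebra_simps)
    then have "b * g \<in> colon J x" using D(7)[OF f(2) D(4)[OF b(1) g(2)]] b(1) g(3) by (simp add: colon_def)
    then have "g \<in> colon J x" by (rule nzdD[OF b(2) g(3)])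
    then show "f \<in> J" using D(3)[OF g(2)] by (simp add: g colon_def)
  qed
  moreover have "regs (adjoin J b) as"
    using Cons.prems Cons.IH[of "adjoin J b"] is_ideal_adjoin[OF Cons.prems(1) b(1)]
      colon_adjoin[OF Cons.prems(1,2) b(1,3)] adjoin_commute[of J b x] by simp
  ultimately show ?case by simp
qed simp

lemma regs_A: "set as \<subseteq> A \<Longrightarrow> regs A as"
proof (induction as)
  case (Cons a as)
  then show ?case using adjoin_absorb[OF is_ideal_A, of a] by (simp add: nzd_def)
qed simp

text \<open>Multiplication by \<open>x\<close> identifies A/(J + (y)) with the kernel of A/(J +
  (xy)) -> A/(J + (x)), as \<open>x\<close> is a nonzerodivisor modulo \<open>J\<close>; then
  \<open>regs_extension\<close> applies.\<close>

lemma regs_adjoin_mult: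
  assumes J: "is_ideal J" and "x \<in> A" "y \<in> A" "set as \<subseteq> A" and nzd: "nzd J x"
    and regs: "regs (adjoin J x) as" "regs (adjoin J y) as"
  shows "regs (adjoin J (x * y)) as"
proof (rule regs_extension[of _ x])
  note D = is_idealD[OF J]
  show "is_ideal (adjoin J (x * y))" using assms by (simp add: is_ideal_adjoin)
  have "x * y \<in> adjoin J x" using adjoinI[OF D(2) assms(3), of x] by simp
  then show "regs (adjoin (adjoin J (x * y)) x) as"
    using regs(1) adjoin_commute[of J "x * y" x] adjoin_absorb[OF is_ideal_adjoin[OF J assms(2)]] by simp
  have "colon (adjoin J (x * y)) x = adjoin J y"
  proof (intro equalityI subsetI)
    fix g assume "g \<in> colon (adjoin J (x * y)) x"
    then obtain j h where g: "g \<in> A" "x * g = j + x * y * h" "j \<in> J" "h \<in> A"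
      by (auto simp: colon_def adjoin_def)
    have "x * (g - y * h) \<in> J" using g by (simp add: algebra_simps)
    then have "g - y * h \<in> J" using nzdD[OF nzd] g assms(3) by simp
    then show "g \<in> adjoin J y" using adjoinI[of "g - y * h" J h y] g(4) by simp
  next
    fix g assume "g \<in> adjoin J y"
    then obtain j h where g: "g = j + y * h" "j \<in> J" "h \<in> A" by (auto simp: adjoin_def)
    have "x * j + x * y * h \<in> adjoin J (x * y)"
      using g D(4)[OF assms(2) g(2)] by (intro adjoinI)
    then show "g \<in> colon (adjoin J (x * y)) x"
      using g D(1) assms(3) by (simp add: colon_def algebra_simps)
  qed
  then show "regs (colon (adjoin J (x * y)) x) as" using regs(2) by simp
qed (use assms in auto)

lemma regs_adjoin_prod:
  assumes J: "is_ideal J" and as: "set as \<subseteq> A" and "finite I"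
    and "\<And>i. i \<in> I \<Longrightarrow> f i \<in> A \<and> nzd J (f i) \<and> regs (adjoin J (f i)) as"
  shows "regs (adjoin J (\<Prod>i\<in>I. f i)) as"
  using assms(3,4)
proof (induction I rule: finite_induct)
  case empty
  have "adjoin J 1 = A"
    using is_idealD(1,2)[OF J] adjoinI[OF is_idealD(2)[OF J], of _ 1] by (auto simp: adjoin_def)
  then show ?case using regs_A[OF as] by simp
next
  case (insert i I)
  then show ?case
    using regs_adjoin_mult[OF J _ prod_mem as, of "f i" I f] by simp
qed

text \<open>A/(J + (a^k)) is filtered by k copies of A/(J + (a)). The induction replaces the tail by
  powers modulo J + (a), and the product lemma for a constant family then passes from
  \<open>a\<close> to \<open>a ^ k\<close>.\<close>

lemma regs_power:
  assumes "is_ideal J" "set as \<subseteq> A" "regs J as"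
  shows "regs J (map (\<lambda>a. a ^ k) as)"
  using assms
proof (induction as arbitrary: J)
  case (Cons a as)
  have a: "a \<in> A" "nzd J a" "set as \<subseteq> A" using Cons.prems by simp_all
  have as: "set (map (\<lambda>a. a ^ k) as) \<subseteq> A" using a(3) by auto
  have "regs (adjoin J a) (map (\<lambda>a. a ^ k) as)"
    using Cons.IH[OF is_ideal_adjoin[OF Cons.prems(1) a(1)] a(3)] Cons.prems(3) by simp
  then have "regs (adjoin J (\<Prod>i<k. a)) (map (\<lambda>a. a ^ k) as)"
    using a by (intro regs_adjoin_prod[OF Cons.prems(1) as]) simp_all
  then show ?case using nzd_power[OF a(2,1)] by simp
qed simp

text \<open>The last hypothesis plays the role of Krull's intersection theorem.\<close>

lemma regs_lift:
  assumes "is_ideal J" "x \<in> A" "set as \<subseteq> A" "nzd J x" "regs (adjoin J x) as"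
    and "\<And>i f. i \<le> length as \<Longrightarrow> (\<And>k. f \<in> adjoin (gen J (take i as)) (x ^ k)) \<Longrightarrow> f \<in> gen J (take i as)"
  shows "regs J as"
  using assms
proof (induction as arbitrary: J)
  case (Cons a as)
  note J = Cons.prems(1) and x = Cons.prems(2)
  note D = is_idealD[OF J]
  have a: "a \<in> A" "nzd (adjoin J x) a" using Cons.prems by simp_all
  have sep: "f \<in> J" if "\<And>k. f \<in> adjoin J (x ^ k)" for f using Cons.prems(6)[of 0 f] that by simp
  \<comment> \<open>If a f is in \<open>J\<close>, then f = j + x g by regularity modulo
    \<open>x\<close>, and cancelling \<open>x\<close> shows that a g is in \<open>J\<close> again.
    Repeating this for \<open>g\<close> yields one factor \<open>x\<close> after the other.\<close>
  have pow: "f \<in> adjoin J (x ^ k)" if "f \<in> A" "a * f \<in> J" for f k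
    using that
  proof (induction k arbitrary: f)
    case 0
    then show ?case using adjoinI[OF D(2), of f 1] by simp
  next
    case (Suc k)
    have "f \<in> adjoin J x" using nzdD[OF a(2) Suc.prems(1)] Suc.prems(2) adjoin_superset[of J x] by blast
    then obtain j g where g: "f = j + x * g" "j \<in> J" "g \<in> A" by (auto simp: adjoin_def)
    have "x * (a * g) = a * f - a * j" by (simp add: g algebra_simps)
    then have "a * g \<in> J" using nzdD[OF Cons.prems(4)] D(7)[OF Suc.prems(2) D(4)[OF a(1) g(2)]] a(1) g(3) by simp
    then obtain j' h where h: "g = j' + x ^ k * h" "j' \<in> J" "h \<in> A"
      using Suc.IH[OF g(3)] by (auto simp: adjoin_def)
    have "(j + x * j') + x ^ Suc k * h \<in> adjoin J (x ^ Suc k)"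
      using g h x by (intro adjoinI D(3) D(4))
    then show ?case by (simp add: g h algebra_simps)
  qed
  have "nzd J a" unfolding nzd_def using pow sep by blast
  moreover have "regs (adjoin J a) as"
  proof (rule Cons.IH)
    show "is_ideal (adjoin J a)" by (rule is_ideal_adjoin[OF J a(1)])
    \<comment> \<open>In x f = j + a g the element \<open>g\<close> must lie in J + (x), because
      \<open>a\<close> is regular there; then \<open>x\<close> can be cancelled.\<close>
    show "nzd (adjoin J a) x"
      unfolding nzd_def
    proof (intro ballI impI)
      fix f assume f: "f \<in> A" "x * f \<in> adjoin J a"
      then obtain j g where g: "x * f = j + a * g" "j \<in> J" "g \<in> A" by (auto simp: adjoin_def)
      have "a * g = - j + x * f" by (simp add: g)
      then have "a * g \<in> adjoin J x" using adjoinI[OF D(6)[OF g(2)] f(1), of x] by simp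
      then have "g \<in> adjoin J x" by (rule nzdD[OF a(2) g(3)])
      then obtain j' h where h: "g = j' + x * h" "j' \<in> J" "h \<in> A" by (auto simp: adjoin_def)
      have "x * (f - a * h) = j + a * j'" using g(1) by (simp add: h algebra_simps)
      then have "x * (f - a * h) \<in> J" using D(3)[OF g(2) D(4)[OF a(1) h(2)]] by simp
      then have "f - a * h \<in> J" using nzdD[OF Cons.prems(4)] f(1) a(1) h(3) by simp
      then show "f \<in> adjoin J a" using adjoinI[of "f - a * h" J h a] h(3) by simp
    qed
    show "regs (adjoin (adjoin J a) x) as" using Cons.prems(5) adjoin_commute[of J a x] by simp
    fix i f assume "i \<le> length as" "\<And>k. f \<in> adjoin (gen (adjoin J a) (take i as)) (x ^ k)"
    then show "f \<in> gen (adjoin J a) (take i as)" using Cons.prems(6)[of "Suc i" f] by simp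
  qed (use Cons.prems x in simp_all)
  ultimately show ?case by simp
qed simp

text \<open>A common form of two situations: the ideals generated by initial segments of a regular
  sequence, and a chain of primes with an element picked from each step. In both, every element is a
  nonzerodivisor modulo one ideal and lies in the next.\<close>

primrec nzd_chain :: "'a set \<Rightarrow> 'a list \<Rightarrow> 'a set \<Rightarrow> bool" where
  "nzd_chain J [] L \<longleftrightarrow> J \<subseteq> L"
| "nzd_chain J (a # as) L \<longleftrightarrow>
     (\<exists>J'. is_ideal J' \<and> J \<subseteq> J' \<and> a \<in> J' \<and> nzd J a \<and> nzd_chain J' as L)"

lemma nzd_chain_gen: "is_ideal J \<Longrightarrow> set as \<subseteq> A \<Longrightarrow> regs J as \<Longrightarrow> nzd_chain J as (gen J as)"
proof (induction as arbitrary: J)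
  case (Cons a as)
  then have "is_ideal (adjoin J a) \<and> J \<subseteq> adjoin J a \<and> a \<in> adjoin J a \<and> nzd J a \<and>
      nzd_chain (adjoin J a) as (gen J (a # as))"
    using is_ideal_adjoin[of J a] adjoin_superset[of J a] adjoin_self[OF is_idealD(2), of J a] by simp
  then show ?case unfolding nzd_chain.simps by blast
qed simp

end

section \<open>Power products and relations between them\<close>

definition exponents :: "nat \<Rightarrow> nat \<Rightarrow> nat list set" where
  "exponents N r = {e. length e = r \<and> set e \<subseteq> {..<N}}"

definition power_product :: "'a::comm_ring_1 list \<Rightarrow> nat list \<Rightarrow> 'a" where
  "power_product as e = prod_list (map2 (^) as e)"

lemma exponents_0 [simp]: "exponents N 0 = {[]}"
  by (auto simp: exponents_def)

lemma finite_exponents [simp]: "finite (exponents N r)"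
  unfolding exponents_def using finite_lists_length_eq[of "{..<N}" r] by (simp add: conj_commute)

lemma card_exponents: "card (exponents N r) = N ^ r"
  unfolding exponents_def using card_lists_length_eq[of "{..<N}" r] by (simp add: conj_commute)

lemma sum_exponents_Suc: "(\<Sum>e\<in>exponents N (Suc r). g e) = (\<Sum>i<N. \<Sum>e\<in>exponents N r. g (i # e))"
proof -
  have "exponents N (Suc r) = (\<lambda>(i, e). i # e) ` ({..<N} \<times> exponents N r)"
    by (auto simp: exponents_def length_Suc_conv image_iff)
  moreover have "inj_on (\<lambda>(i, e). i # e) ({..<N} \<times> exponents N r)" by (auto simp: inj_on_def)
  ultimately have "(\<Sum>e\<in>exponents N (Suc r). g e) = (\<Sum>(i, e)\<in>{..<N} \<times> exponents N r. g (i # e))"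
    by (simp add: sum.reindex case_prod_unfold)
  then show ?thesis by (simp add: sum.cartesian_product)
qed

lemma power_product_simps [simp]:
  "power_product [] e = 1" "power_product (a # as) (i # e) = a ^ i * power_product as e"
  by (simp_all add: power_product_def)

context comm_subring
begin

lemma power_product_mem: "set as \<subseteq> A \<Longrightarrow> power_product as e \<in> A"
proof (induction as arbitrary: e)
  case (Cons a as)
  then show ?case by (cases e) (simp_all add: power_product_def)
qed simp

text \<open>Divide the relation by the lowest power of the first element and reduce modulo the next ideal
  of the chain.\<close>

lemma nzd_chain_relation:
  assumes "nzd_chain J as L" "is_ideal J" "set as \<subseteq> A" "z \<in> A"
    and "\<And>e. c e \<in> A" "\<And>e. c e = 0 \<or> (\<exists>u\<in>A. u * c e = 1)"
    and "e0 \<in> exponents N (length as)" "c e0 \<noteq> 0"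
    and "(\<Sum>e\<in>exponents N (length as). c e * power_product as e * z) \<in> J"
  shows "z \<in> L"
  using assms
proof (induction as arbitrary: J c e0)
  case Nil
  have "c [] \<noteq> 0" using Nil(7,8) by simp
  then obtain u where u: "u \<in> A" "u * c [] = 1" using Nil(6) by blast
  have "c [] * z \<in> J" using Nil by simp
  then have "u * (c [] * z) \<in> J" by (rule is_idealD(4)[OF Nil(2) u(1)])
  then have "z \<in> J" using u(2) by (simp add: mult.assoc[symmetric])
  then show ?case using Nil(1) by auto
next
  case (Cons a as)
  note J = Cons.prems(2)
  let ?E = "exponents N (length as)"
  obtain J' where J': "is_ideal J'" "J \<subseteq> J'" "a \<in> J'" "nzd J a" "nzd_chain J' as L"
    using Cons.prems(1) by auto
  note D' = is_idealD[OF J'(1)]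
  have a: "a \<in> A" "set as \<subseteq> A" using Cons.prems(3) by simp_all
  define S where "S = (\<lambda>i. \<Sum>e\<in>?E. c (i # e) * power_product as e * z)"
  have SA: "S i \<in> A" for i
    unfolding S_def by (intro sum_mem mult_mem Cons.prems(4,5) power_product_mem a(2))
  have "\<exists>m. m < N \<and> (\<exists>e\<in>?E. c (m # e) \<noteq> 0)"
    using Cons.prems(7,8) by (cases e0) (auto simp: exponents_def)
  then obtain m where m: "m < N" "\<exists>e\<in>?E. c (m # e) \<noteq> 0"
    and least: "\<And>i. i < m \<Longrightarrow> \<not> (i < N \<and> (\<exists>e\<in>?E. c (i # e) \<noteq> 0))"
    using exists_least_iff[of "\<lambda>m. m < N \<and> (\<exists>e\<in>?E. c (m # e) \<noteq> 0)"] by blast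
  have S0: "S i = 0" if "i < m" for i
    unfolding S_def using least[OF that] that m(1) by (intro sum.neutral) auto
  \<comment> \<open>What remains of the higher powers after division by \<open>a ^ m\<close>. Each
    term still contains a factor \<open>a\<close>, so \<open>W\<close> lies in the next ideal
    \<open>J'\<close> and only the coefficient \<open>S m\<close> survives modulo it.\<close>
  define W where "W = (\<Sum>i\<in>{m<..<N}. a ^ (i - m) * S i)"
  have split: "{..<N} = {..<m} \<union> insert m {m<..<N}" using m(1) by auto
  have "(\<Sum>e\<in>exponents N (length (a # as)). c e * power_product (a # as) e * z) = (\<Sum>i<N. a ^ i * S i)"
    by (simp add: sum_exponents_Suc S_def sum_distrib_left mult_ac)
  also have "\<dots> = (\<Sum>i<m. a ^ i * S i) + (\<Sum>i\<in>insert m {m<..<N}. a ^ i * S i)"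
    unfolding split by (rule sum.union_disjoint) auto
  also have "(\<Sum>i<m. a ^ i * S i) = 0" using S0 by (intro sum.neutral) simp
  also have "(\<Sum>i\<in>insert m {m<..<N}. a ^ i * S i) = a ^ m * S m + (\<Sum>i\<in>{m<..<N}. a ^ i * S i)"
    by simp
  also have "(\<Sum>i\<in>{m<..<N}. a ^ i * S i) = a ^ m * W"
    unfolding W_def sum_distrib_left
    by (intro sum.cong) (simp_all add: mult.assoc[symmetric] power_add[symmetric])
  finally have "a ^ m * (S m + W) \<in> J" using Cons.prems(9) by (simp add: distrib_left)
  moreover have "W \<in> A" unfolding W_def by (intro sum_mem mult_mem power_mem a(1) SA)
  ultimately have "S m + W \<in> J" using nzdD[OF nzd_power[OF J'(4) a(1)]] SA by simp
  moreover have "W \<in> J'"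
  proof -
    have "a ^ (i - m) * S i \<in> J'" if "i \<in> {m<..<N}" for i
    proof -
      have "a ^ (i - m) * S i = a * (a ^ (i - m - 1) * S i)"
        using that by (simp add: mult.assoc[symmetric] power_eq_if)
      then show ?thesis using D'(5)[OF _ J'(3), of "a ^ (i - m - 1) * S i"] a(1) SA by simp
    qed
    then have "sum (\<lambda>i. a ^ (i - m) * S i) I \<in> J'" if "I \<subseteq> {m<..<N}" for I
      using that by (induction I rule: infinite_finite_induct) (simp_all add: D')
    then show ?thesis unfolding W_def by blast
  qed
  ultimately have "S m \<in> J'" using D'(7)[of "S m + W" W] J'(2) by auto
  moreover obtain e where "e \<in> ?E" "c (m # e) \<noteq> 0" using m(2) by blast
  ultimately show ?case
    using Cons.IH[OF J'(5,1) a(2) Cons.prems(4), of "\<lambda>e. c (m # e)" e] Cons.prems(5,6)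
    unfolding S_def by blast
qed

text \<open>Links the finite sums of the official definition with repeated adjunction. The induction
  runs from the end of the list because the sum splits off its last term.\<close>

lemma seq_smult_quot_module:
  assumes J: "is_ideal J" and as: "set as \<subseteq> A"
  shows "seq_smult (quot J) as = coset J ` gen J as"
  using as
proof (induction as rule: rev_induct)
  case Nil
  interpret M: Module.module sub_ring "quot J" by (rule quot_module_module[OF J])
  have "coset J h = J" if "h \<in> J" for h
    using coset_zero_iff[OF J] is_idealD(1)[OF J] that by blast
  then have "coset J ` J = {J}" using is_idealD(2)[OF J] by force
  then show ?case by (auto simp: seq_smult_def quot_module_simps[OF J])
next
  case (snoc a as)
  let ?M = "quot J"
  interpret M: Module.module sub_ring ?M by (rule quot_module_module[OF J])
  note Q = quot_module_simps[OF J]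
  have a: "a \<in> A" "set as \<subseteq> A" using snoc.prems by simp_all
  have nthA: "as ! j \<in> A" if "j < length as" for j using a(2) that by (auto simp: subset_iff)
  note IH = snoc.IH[OF a(2)]
  have G: "gen J as \<subseteq> A" using is_idealD(1)[OF is_ideal_gen[OF J a(2)]] by blast
  have "seq_smult ?M (as @ [a]) = {x \<oplus>\<^bsub>?M\<^esub> a \<odot>\<^bsub>?M\<^esub> y |x y. x \<in> seq_smult ?M as \<and> y \<in> carrier ?M}"
  proof -
    have sum: "finsum ?M (\<lambda>j. (as @ [a]) ! j \<odot>\<^bsub>?M\<^esub> f j) {..<length (as @ [a])} =
      finsum ?M (\<lambda>j. as ! j \<odot>\<^bsub>?M\<^esub> f j) {..<length as} \<oplus>\<^bsub>?M\<^esub> a \<odot>\<^bsub>?M\<^esub> f (length as)"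
      if f: "f \<in> {..<length as} \<rightarrow> carrier ?M" "f (length as) \<in> carrier ?M" for f
    proof -
      have "finsum ?M (\<lambda>j. (as @ [a]) ! j \<odot>\<^bsub>?M\<^esub> f j) (insert (length as) {..<length as}) =
        (as @ [a]) ! length as \<odot>\<^bsub>?M\<^esub> f (length as) \<oplus>\<^bsub>?M\<^esub>
          finsum ?M (\<lambda>j. (as @ [a]) ! j \<odot>\<^bsub>?M\<^esub> f j) {..<length as}"
        using f a nthA by (intro M.M.finsum_insert) (auto simp: nth_append)
      also have "finsum ?M (\<lambda>j. (as @ [a]) ! j \<odot>\<^bsub>?M\<^esub> f j) {..<length as} =
          finsum ?M (\<lambda>j. as ! j \<odot>\<^bsub>?M\<^esub> f j) {..<length as}"
        using f nthA by (intro M.M.finsum_cong') (auto simp: nth_append)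
      finally show ?thesis
        using f a nthA by (simp add: lessThan_Suc M.M.a_comm M.M.finsum_closed Pi_iff)
    qed
    show ?thesis
    proof (intro equalityI subsetI)
      fix x assume "x \<in> seq_smult ?M (as @ [a])"
      then obtain f where f: "f \<in> {..<length (as @ [a])} \<rightarrow> carrier ?M"
        "x = finsum ?M (\<lambda>j. (as @ [a]) ! j \<odot>\<^bsub>?M\<^esub> f j) {..<length (as @ [a])}"
        by (auto simp: seq_smult_def)
      have f': "f \<in> {..<length as} \<rightarrow> carrier ?M" "f (length as) \<in> carrier ?M" using f(1) by auto
      then show "x \<in> {x \<oplus>\<^bsub>?M\<^esub> a \<odot>\<^bsub>?M\<^esub> y |x y. x \<in> seq_smult ?M as \<and> y \<in> carrier ?M}"
        unfolding f(2) sum[OF f'] seq_smult_def by blast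
    next
      fix x assume "x \<in> {x \<oplus>\<^bsub>?M\<^esub> a \<odot>\<^bsub>?M\<^esub> y |x y. x \<in> seq_smult ?M as \<and> y \<in> carrier ?M}"
      then obtain f y where f: "f \<in> {..<length as} \<rightarrow> carrier ?M" "y \<in> carrier ?M"
        "x = finsum ?M (\<lambda>j. as ! j \<odot>\<^bsub>?M\<^esub> f j) {..<length as} \<oplus>\<^bsub>?M\<^esub> a \<odot>\<^bsub>?M\<^esub> y"
        by (auto simp: seq_smult_def)
      define g where "g = f(length as := y)"
      have g: "g \<in> {..<length as} \<rightarrow> carrier ?M" "g (length as) \<in> carrier ?M"
        using f by (auto simp: g_def)
      have "finsum ?M (\<lambda>j. as ! j \<odot>\<^bsub>?M\<^esub> g j) {..<length as} = finsum ?M (\<lambda>j. as ! j \<odot>\<^bsub>?M\<^esub> f j) {..<length as}"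
        using f nthA by (intro M.M.finsum_cong') (auto simp: g_def)
      then have "x = finsum ?M (\<lambda>j. (as @ [a]) ! j \<odot>\<^bsub>?M\<^esub> g j) {..<length (as @ [a])}"
        unfolding sum[OF g] f(3) by (simp add: g_def)
      moreover have "g \<in> {..<length (as @ [a])} \<rightarrow> carrier ?M"
        using g by (auto simp: less_Suc_eq)
      ultimately show "x \<in> seq_smult ?M (as @ [a])" unfolding seq_smult_def by blast
    qed
  qed
  also have "\<dots> = {coset J h \<oplus>\<^bsub>?M\<^esub> a \<odot>\<^bsub>?M\<^esub> coset J k |h k. h \<in> gen J as \<and> k \<in> A}"
    unfolding IH Q(1) by blast
  also have "\<dots> = {coset J (h + a * k) |h k. h \<in> gen J as \<and> k \<in> A}"
  proof -
    have eq: "coset J h \<oplus>\<^bsub>?M\<^esub> a \<odot>\<^bsub>?M\<^esub> coset J k = coset J (h + a * k)"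
      if "h \<in> gen J as" "k \<in> A" for h k
      using that G a(1) by (simp add: Q subset_iff)
    show ?thesis
    proof (intro equalityI subsetI)
      fix x assume "x \<in> {coset J (h + a * k) |h k. h \<in> gen J as \<and> k \<in> A}"
      then obtain h k where "x = coset J (h + a * k)" and hk: "h \<in> gen J as" "k \<in> A" by blast
      then have "x = coset J h \<oplus>\<^bsub>?M\<^esub> a \<odot>\<^bsub>?M\<^esub> coset J k" using eq by simp
      then show "x \<in> {coset J h \<oplus>\<^bsub>?M\<^esub> a \<odot>\<^bsub>?M\<^esub> coset J k |h k. h \<in> gen J as \<and> k \<in> A}"
        using hk by blast
    next
      fix x assume "x \<in> {coset J h \<oplus>\<^bsub>?M\<^esub> a \<odot>\<^bsub>?M\<^esub> coset J k |h k. h \<in> gen J as \<and> k \<in> A}"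
      then obtain h k where "x = coset J h \<oplus>\<^bsub>?M\<^esub> a \<odot>\<^bsub>?M\<^esub> coset J k"
        and hk: "h \<in> gen J as" "k \<in> A" by blast
      then have "x = coset J (h + a * k)" using eq by simp
      then show "x \<in> {coset J (h + a * k) |h k. h \<in> gen J as \<and> k \<in> A}" using hk by blast
    qed
  qed
  also have "\<dots> = coset J ` gen J (as @ [a])"
    unfolding gen_append by (auto simp: adjoin_def)
  finally show ?case .
qed

lemma coset_in_image_iff:
  assumes J: "is_ideal J" and L: "is_ideal L" "J \<subseteq> L" and h: "h \<in> A"
  shows "coset J h \<in> coset J ` L \<longleftrightarrow> h \<in> L"
proof
  note D = is_idealD[OF L(1)]
  assume "coset J h \<in> coset J ` L"
  then obtain k where k: "k \<in> L" "coset J h = coset J k" by blast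
  then have "h - k \<in> L" using coset_eq_iff[OF J h D(1)[OF k(1)]] L(2) by blast
  then show "h \<in> L" using D(3)[OF _ k(1), of "h - k"] by simp
qed blast

lemma regular_sequence_iff:
  assumes J: "is_ideal J"
  shows "regular_sequence sub_ring (quot J) as \<longleftrightarrow>
    set as \<subseteq> A \<and> regs J as \<and> 1 \<notin> gen J as"
proof (cases "set as \<subseteq> A")
  case True
  let ?M = "quot J"
  note Q = quot_module_simps[OF J]
  have tk: "set (take i as) \<subseteq> A" for i using True set_take_subset[of i as] by blast
  note I = is_ideal_gen[OF J]
  have nthA: "as ! j \<in> A" if "j < length as" for j using True that by (auto simp: subset_iff)
  have "(\<forall>x\<in>carrier ?M. as ! i \<odot>\<^bsub>?M\<^esub> x \<in> seq_smult ?M (take i as) \<longrightarrow> x \<in> seq_smult ?M (take i as))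
      \<longleftrightarrow> nzd (gen J (take i as)) (as ! i)" if "i < length as" for i
    unfolding Q(1) seq_smult_quot_module[OF J tk] nzd_def
    using nthA[OF that] by (auto simp: Q coset_in_image_iff[OF J I[OF tk] gen_superset])
  moreover have "seq_smult ?M as = carrier ?M \<longleftrightarrow> 1 \<in> gen J as"
  proof
    assume "seq_smult ?M as = carrier ?M"
    then show "1 \<in> gen J as"
      unfolding Q(1) seq_smult_quot_module[OF J True]
      using coset_in_image_iff[OF J I[OF True] gen_superset one_mem] one_mem by blast
  next
    assume "1 \<in> gen J as"
    then have "gen J as = A"
      using is_idealD(1,4)[OF I[OF True]] by (metis mult.right_neutral subsetI subset_antisym)
    then show "seq_smult ?M as = carrier ?M" unfolding Q(1) seq_smult_quot_module[OF J True] by simp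
  qed
  ultimately show ?thesis using True by (simp add: regular_sequence_def regs_iff_nth)
next
  case False
  then show ?thesis by (simp add: regular_sequence_def)
qed

end

section \<open>Monomial ideals in polynomial rings\<close>

abbreviation (input) "supp \<equiv> Poly_Mapping.keys"
abbreviation (input) "coef \<equiv> Poly_Mapping.lookup"
abbreviation (input) "sing \<equiv> Poly_Mapping.single"

lemma keys_plus_nat: "supp (a + b) = supp a \<union> supp (b :: monomial)"
  by (auto simp: in_keys_iff lookup_add)

lemma keys_diff_subset: "supp (p - q) \<subseteq> supp p \<union> supp (q :: 'a \<Rightarrow>\<^sub>0 'b::ab_group_add)"
  by (auto simp: in_keys_iff lookup_minus)

lemma poly_expand: "(\<Sum>m\<in>supp p. sing m (coef p m)) = p"
  by (rule poly_mapping_eqI)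
    (simp add: lookup_sum lookup_single when_def in_keys_iff sum.If_cases Int_def cong: conj_cong)

lemma monom_mult: "monomial_poly a * monomial_poly b = monomial_poly (a + b)"
  by (simp add: monomial_poly_def mult_single)

lemma monom_power: "monomial_poly a ^ k = monomial_poly (\<Sum>i<k. a)"
proof (induction k)
  case 0
  show ?case by (simp add: monomial_poly_def)
next
  case (Suc k)
  show ?case unfolding power_Suc Suc monom_mult by (simp only: sum.lessThan_Suc add.commute)
qed

lemma keys_monom [simp]: "supp (monomial_poly m :: 'k::field polynomial) = {m}"
  by (simp add: monomial_poly_def)

lemma keys_monom_times: "supp (monomial_poly m * p) = (+) m ` supp (p :: 'k::field polynomial)"
proof -
  have "coef (monomial_poly m * p) (m + k) = coef p k" for k
  proof -
    have "monomial_poly m * p = (\<Sum>l\<in>supp p. sing (m + l) (coef p l))"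
      by (subst poly_expand[of p, symmetric])
        (simp add: sum_distrib_left monomial_poly_def mult_single)
    then show ?thesis
      by (simp add: lookup_sum lookup_single when_def in_keys_iff sum.If_cases Int_def cong: conj_cong)
  qed
  moreover have "supp (monomial_poly m * p) \<subseteq> (+) m ` supp p"
    using keys_mult[of "monomial_poly m" p] by auto
  ultimately show ?thesis by (auto simp: in_keys_iff)
qed

definition part :: "(monomial \<Rightarrow> bool) \<Rightarrow> 'k::field polynomial \<Rightarrow> 'k polynomial" where
  "part P p = Poly_Mapping.mapp (\<lambda>m c. if P m then c else 0) p"

lemma lookup_part: "coef (part P p) m = (if P m then coef p m else 0)"
  by (auto simp: part_def lookup_mapp in_keys_iff when_def)

lemma keys_part: "supp (part P p) = {m \<in> supp p. P m}"
  by (auto simp: in_keys_iff lookup_part split: if_splits)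

lemma part_add: "part P (p + q) = part P p + part P q"
  by (rule poly_mapping_eqI) (simp add: lookup_part lookup_add)

lemma part_compl: "part P p + part (\<lambda>m. \<not> P m) p = p"
  by (rule poly_mapping_eqI) (simp add: lookup_part lookup_add)

lemma part_all: "(\<And>m. m \<in> supp p \<Longrightarrow> P m) \<Longrightarrow> part P p = p"
  by (rule poly_mapping_eqI) (auto simp: lookup_part in_keys_iff)

lemma part_none: "(\<And>m. m \<in> supp p \<Longrightarrow> \<not> P m) \<Longrightarrow> part P p = 0"
  by (rule poly_mapping_eqI) (auto simp: lookup_part in_keys_iff)

definition sqf :: "nat set \<Rightarrow> monomial" where
  "sqf S = (\<Sum>i\<in>S. sing i 1)"

definition var :: "nat \<Rightarrow> 'k::field polynomial" where
  "var i = monomial_poly (sing i 1)"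

definition vertices :: "nat \<Rightarrow> nat set" where
  "vertices n = {1..n}"

lemma vertices_simps [simp]: "finite (vertices n)" "card (vertices n) = n"
  by (simp_all add: vertices_def)

lemma keys_single_one_plus: "supp (sing i 1 + m) = insert i (supp (m :: monomial))"
  by (simp add: keys_plus_nat)

lemma keys_var [simp]: "supp (var i :: 'k::field polynomial) = {sing i 1}"
  by (simp add: var_def)

lemma keys_var_times: "supp (var i * p) = (+) (sing i 1) ` supp (p :: 'k::field polynomial)"
  unfolding var_def by (rule keys_monom_times)

lemma lookup_sqf: "finite S \<Longrightarrow> coef (sqf S) i = (if i \<in> S then 1 else 0)"
  by (simp add: sqf_def lookup_sum lookup_single when_def sum.If_cases Int_def cong: conj_cong)

lemma keys_sqf: "finite S \<Longrightarrow> supp (sqf S) = S"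
  by (auto simp: in_keys_iff lookup_sqf split: if_splits)

lemma prod_var: "finite S \<Longrightarrow> (\<Prod>i\<in>S. var i) = monomial_poly (sqf S)"
proof (induction S rule: finite_induct)
  case empty
  show ?case by (simp add: sqf_def monomial_poly_def)
next
  case (insert i S)
  then show ?case
    unfolding var_def sqf_def prod.insert[OF insert(1,2)] sum.insert[OF insert(1,2)] by (simp only: monom_mult)
qed

definition upward :: "nat \<Rightarrow> nat set set \<Rightarrow> bool" where
  "upward n N \<longleftrightarrow> N \<subseteq> Pow (vertices n) \<and> (\<forall>S\<in>N. \<forall>S'. S \<subseteq> S' \<longrightarrow> S' \<subseteq> vertices n \<longrightarrow> S' \<in> N)"

lemma upwardD: "upward n N \<Longrightarrow> S \<in> N \<Longrightarrow> S \<subseteq> S' \<Longrightarrow> S' \<subseteq> vertices n \<Longrightarrow> S' \<in> N"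
  by (auto simp: upward_def)

lemma upward_nonfaces: "upward n {S. S \<subseteq> vertices n \<and> \<not> S \<subseteq> V}"
  by (auto simp: upward_def)

locale poly_subring = comm_subring A for A :: "'k::field polynomial set" +
  fixes n :: nat
  assumes A_iff: "p \<in> A \<longleftrightarrow> (\<forall>m\<in>supp p. supp m \<subseteq> vertices n)"

lemma keys_multE:
  assumes "m \<in> supp (a * b)"
  obtains k l where "m = k + l" "k \<in> supp a" "l \<in> supp b"
  using subsetD[OF keys_mult assms] by auto

lemma poly_subring_carrier: "poly_subring (carrier (poly_ring n :: 'k::field polynomial ring)) n"
proof
  show iff: "p \<in> carrier (poly_ring n) \<longleftrightarrow> (\<forall>m\<in>supp p. supp m \<subseteq> vertices n)" for p :: "'k polynomial"
    by (simp add: poly_ring_def vertices_def)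
  show "(1 :: 'k polynomial) \<in> carrier (poly_ring n)" by (simp add: iff)
  fix a b :: "'k polynomial"
  assume ab: "a \<in> carrier (poly_ring n)" "b \<in> carrier (poly_ring n)"
  then show "a - b \<in> carrier (poly_ring n)"
    unfolding iff using keys_diff_subset[of a b] by blast
  show "a * b \<in> carrier (poly_ring n)"
    unfolding iff
  proof
    fix m assume "m \<in> supp (a * b)"
    then obtain k l where "m = k + l" "k \<in> supp a" "l \<in> supp b" by (elim keys_multE)
    then show "supp m \<subseteq> vertices n"
      using ab by (simp add: iff keys_plus_nat)
  qed
qed

context poly_subring
begin

lemma sub_ring_eq: "sub_ring = poly_ring n"
proof -
  have "A = carrier (poly_ring n)" by (simp add: set_eq_iff A_iff poly_ring_def vertices_def)
  then show ?thesis unfolding sub_ring_def by (simp add: poly_ring_def)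
qed

lemma monom_mem: "monomial_poly m \<in> A \<longleftrightarrow> supp m \<subseteq> vertices n"
  by (simp add: A_iff)

lemma var_mem [simp]: "i \<in> vertices n \<Longrightarrow> var i \<in> A"
  by (simp add: A_iff)

lemma const_mem [simp]: "sing 0 c \<in> A"
  by (auto simp: A_iff)

lemma part_mem: "p \<in> A \<Longrightarrow> part P p \<in> A"
  by (auto simp: A_iff keys_part)

lemma ideal_contains_monoms:
  assumes J: "is_ideal J" and "\<And>m. m \<in> supp p \<Longrightarrow> monomial_poly m \<in> J"
  shows "p \<in> J"
proof -
  have "sing m (coef p m) \<in> J" if "m \<in> supp p" for m
    using is_idealD(4)[OF J const_mem assms(2)[OF that], of "coef p m"]
    by (simp add: monomial_poly_def mult_single)
  then have "(\<Sum>m\<in>I. sing m (coef p m)) \<in> J" if "I \<subseteq> supp p" for I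
    using that by (induction I rule: infinite_finite_induct) (simp_all add: is_idealD[OF J])
  then show ?thesis using poly_expand[of p] by force
qed

definition monom_set :: "(monomial \<Rightarrow> bool) \<Rightarrow> 'k polynomial set" where
  "monom_set Q = {p \<in> A. \<forall>m\<in>supp p. Q m}"

lemma is_ideal_monom_set:
  assumes "\<And>k m. supp k \<subseteq> vertices n \<Longrightarrow> supp m \<subseteq> vertices n \<Longrightarrow> Q m \<Longrightarrow> Q (k + m)"
  shows "is_ideal (monom_set Q)"
  unfolding is_ideal_def
proof (intro conjI ballI)
  fix p q assume pq: "p \<in> monom_set Q" "q \<in> monom_set Q"
  then show "p + q \<in> monom_set Q" using keys_add[of p q] by (auto simp: monom_set_def)
next
  fix a p assume ap: "a \<in> A" "p \<in> monom_set Q"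
  have "Q m" if "m \<in> supp (a * p)" for m
  proof -
    obtain k l where "m = k + l" "k \<in> supp a" "l \<in> supp p"
      using \<open>m \<in> supp (a * p)\<close> by (elim keys_multE)
    then show ?thesis using ap assms by (auto simp: monom_set_def A_iff)
  qed
  then show "a * p \<in> monom_set Q" using ap by (simp add: monom_set_def)
qed (auto simp: monom_set_def)

text \<open>The Stanley-Reisner correspondence: a squarefree monomial ideal is recorded by the
  supports of its monomials, that is, by the nonfaces \<open>N\<close> of its complex. It is an
  ideal when \<open>N\<close> is \<open>upward\<close>.\<close>

definition mon_ideal :: "nat set set \<Rightarrow> 'k polynomial set" where
  "mon_ideal N = monom_set (\<lambda>m. supp m \<in> N)"

lemma mon_ideal_iff: "p \<in> mon_ideal N \<longleftrightarrow> p \<in> A \<and> (\<forall>m\<in>supp p. supp m \<in> N)"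
  by (simp add: mon_ideal_def monom_set_def)

lemma is_ideal_mon_ideal: "upward n N \<Longrightarrow> is_ideal (mon_ideal N)"
  unfolding mon_ideal_def by (rule is_ideal_monom_set) (auto simp: keys_plus_nat elim!: upwardD)

text \<open>Colon by a variable, like adding one, is a set operation on the nonfaces. Filtrations
  can therefore be built on set families alone, without polynomials.\<close>

lemma colon_mon_ideal:
  assumes "i \<in> vertices n"
  shows "colon (mon_ideal N) (var i) = mon_ideal {S. insert i S \<in> N}"
proof -
  have "var i * p \<in> mon_ideal N \<longleftrightarrow> (\<forall>m\<in>supp p. insert i (supp m) \<in> N)" if "p \<in> A" for p
    using that mult_mem[OF var_mem[OF assms] that]
    by (simp only: mon_ideal_iff keys_var_times ball_simps keys_single_one_plus) simp
  then have "x \<in> colon (mon_ideal N) (var i) \<longleftrightarrow> x \<in> mon_ideal {S. insert i S \<in> N}" for x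
    unfolding colon_def mon_ideal_iff[of x] mem_Collect_eq by (rule conj_cong[OF refl])
  then show ?thesis by blast
qed

lemma adjoin_mon_ideal:
  assumes N: "upward n N" and i: "i \<in> vertices n"
  shows "adjoin (mon_ideal N) (var i) = mon_ideal (N \<union> {S. S \<subseteq> vertices n \<and> i \<in> S})" (is "?L = mon_ideal ?N")
proof
  have up: "upward n ?N" using N unfolding upward_def by blast
  show "?L \<subseteq> mon_ideal ?N"
    by (rule adjoin_subset[OF is_ideal_mon_ideal[OF up]]) (use i in \<open>auto simp: mon_ideal_iff A_iff\<close>)
  show "mon_ideal ?N \<subseteq> ?L"
  proof
    fix p assume p: "p \<in> mon_ideal ?N"
    have L: "is_ideal ?L" using is_ideal_adjoin[OF is_ideal_mon_ideal[OF N]] i by simp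
    show "p \<in> ?L"
    proof (rule ideal_contains_monoms[OF L])
      fix m assume m: "m \<in> supp p"
      then have mn: "supp m \<subseteq> vertices n" using p by (auto simp: mon_ideal_iff A_iff)
      show "monomial_poly m \<in> ?L"
      proof (cases "i \<in> supp m")
        case True
        have "sing i 1 + (m - sing i 1) = m"
          using True by (intro poly_mapping_eqI) (auto simp: lookup_add lookup_minus lookup_single when_def in_keys_iff)
        moreover have "supp (m - sing i 1) \<subseteq> vertices n" using mn by (auto simp: in_keys_iff lookup_minus subset_iff)
        ultimately have q: "monomial_poly (m - sing i 1) \<in> A" "var i * monomial_poly (m - sing i 1) = monomial_poly m"
          unfolding var_def monom_mult monom_mem by simp_all
        show ?thesis
          using adjoinI[OF is_idealD(2)[OF is_ideal_mon_ideal[OF N]] q(1), of "var i"] unfolding q(2) by simp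
      next
        case False
        then have "monomial_poly m \<in> mon_ideal N"
          using p m mn by (auto simp: mon_ideal_iff monom_mem)
        then show ?thesis using adjoin_superset by blast
      qed
    qed
  qed
qed

text \<open>The prime ideal generated by the variables outside \<open>V\<close>.\<close>

definition face_ideal :: "nat set \<Rightarrow> 'k polynomial set" where
  "face_ideal V = mon_ideal {S. S \<subseteq> vertices n \<and> \<not> S \<subseteq> V}"

lemma face_ideal_iff: "p \<in> face_ideal V \<longleftrightarrow> p \<in> A \<and> (\<forall>m\<in>supp p. \<not> supp m \<subseteq> V)"
  by (auto simp: face_ideal_def mon_ideal_iff A_iff)

lemma is_ideal_face_ideal: "is_ideal (face_ideal V)"
  unfolding face_ideal_def by (rule is_ideal_mon_ideal[OF upward_nonfaces])

lemma face_ideal_all: "face_ideal (vertices n) = {0}"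
proof -
  have "p \<in> face_ideal (vertices n) \<longleftrightarrow> supp p = {}" for p
    unfolding face_ideal_iff A_iff by blast
  then show ?thesis by auto
qed

lemma adjoin_face_ideal:
  assumes "i \<in> vertices n"
  shows "adjoin (face_ideal V) (var i) = face_ideal (V - {i})"
  unfolding face_ideal_def adjoin_mon_ideal[OF upward_nonfaces assms]
  by (rule arg_cong[of _ _ mon_ideal]) blast

lemma nzd_face_ideal:
  assumes "i \<in> vertices n" "i \<in> V"
  shows "nzd (face_ideal V) (var i)"
proof -
  have "var i * p \<in> face_ideal V \<longleftrightarrow> p \<in> face_ideal V" if "p \<in> A" for p
    using that mult_mem[OF var_mem[OF assms(1)] that] assms(2)
    by (simp only: face_ideal_iff keys_var_times ball_simps keys_single_one_plus) simp
  then show ?thesis by (simp add: nzd_def)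
qed

definition is_prime :: "'k polynomial set \<Rightarrow> bool" where
  "is_prime J \<longleftrightarrow> is_ideal J \<and> 1 \<notin> J \<and> (\<forall>a\<in>A. \<forall>b\<in>A. a * b \<in> J \<longrightarrow> a \<in> J \<or> b \<in> J)"

text \<open>Modulo the ideal, \<open>a\<close> and \<open>b\<close> may be replaced by their parts
  \<open>a1\<close>, \<open>b1\<close> supported in \<open>V\<close>. The product of these has only
  monomials in \<open>V\<close>, so it can lie in the ideal only by being zero, and polynomials have
  no zero divisors.\<close>

lemma is_prime_face_ideal: "is_prime (face_ideal V)"
  unfolding is_prime_def
proof (intro conjI ballI impI)
  let ?J = "face_ideal V"
  note D = is_idealD[OF is_ideal_face_ideal[of V]]
  show "is_ideal ?J" by (rule is_ideal_face_ideal)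
  show "1 \<notin> ?J" by (simp add: face_ideal_iff)
  fix a b assume ab: "a \<in> A" "b \<in> A" "a * b \<in> ?J"
  define P where "P = (\<lambda>m :: monomial. supp m \<subseteq> V)"
  have rest: "part (\<lambda>m. \<not> P m) p \<in> ?J" if "p \<in> A" for p
    using part_mem[OF that] by (simp add: face_ideal_iff keys_part P_def)
  define a1 a2 b1 b2 where "a1 = part P a" and "a2 = part (\<lambda>m. \<not> P m) a" and
    "b1 = part P b" and "b2 = part (\<lambda>m. \<not> P m) b"
  have eq: "a = a1 + a2" "b = b1 + b2" by (simp_all add: a1_def a2_def b1_def b2_def part_compl)
  have J2: "a2 \<in> ?J" "b2 \<in> ?J" using rest ab by (simp_all add: a2_def b2_def)
  have A1: "a1 \<in> A" "b1 \<in> A" using part_mem ab by (simp_all add: a1_def b1_def)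
  have "a1 * b1 = a * b - (a * b2 + a2 * b1)" by (simp add: eq algebra_simps)
  then have "a1 * b1 \<in> ?J"
    using D(7)[OF ab(3) D(3)[OF D(4)[OF ab(1) J2(2)] D(5)[OF A1(2) J2(1)]]] by simp
  moreover have "supp m \<subseteq> V" if "m \<in> supp (a1 * b1)" for m
    using \<open>m \<in> supp (a1 * b1)\<close> by (elim keys_multE) (simp add: a1_def b1_def keys_part P_def keys_plus_nat)
  ultimately have "supp (a1 * b1) = {}" by (auto simp: face_ideal_iff)
  then have "a1 * b1 = 0" by simp
  then have "a1 = 0 \<or> b1 = 0" by simp
  then show "a \<in> ?J \<or> b \<in> ?J" using J2 eq by auto
qed

end

section \<open>Filtrations by polynomial rings\<close>

text \<open>Squarefree monomial ideals with a filtration whose factors are polynomial rings in at least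
  \<open>D\<close> variables; the ideal is given by the supports of its monomials.\<close>

inductive layered :: "nat \<Rightarrow> nat \<Rightarrow> nat set set \<Rightarrow> bool" for n D where
  layered_leaf: "V \<subseteq> vertices n \<Longrightarrow> D \<le> card V \<Longrightarrow> layered n D {S. S \<subseteq> vertices n \<and> \<not> S \<subseteq> V}"
| layered_step: "upward n N \<Longrightarrow> i \<in> vertices n \<Longrightarrow> layered n D {S. insert i S \<in> N} \<Longrightarrow>
    layered n D (N \<union> {S. S \<subseteq> vertices n \<and> i \<in> S}) \<Longrightarrow> layered n D N"

lemma finite_vertices_subset: "S \<subseteq> vertices n \<Longrightarrow> finite S"
  by (rule finite_subset[of _ "vertices n"]) simp_all

lemma layered_upward: "layered n D N \<Longrightarrow> upward n N"
  by (cases rule: layered.cases) (auto simp: upward_nonfaces)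

context comm_subring
begin

definition ideal_res :: "nat \<Rightarrow> 'a set \<Rightarrow> bool" where
  "ideal_res k J \<longleftrightarrow> res k (emb ` J) {0}"

lemma ideal_res_zero: "ideal_res 0 {0}"
  by (simp add: ideal_res_def)

lemma ideal_res_adjoin:
  "is_ideal J \<Longrightarrow> x \<in> A \<Longrightarrow> nzd J x \<Longrightarrow> ideal_res k J \<Longrightarrow> ideal_res (Suc k) (adjoin J x)"
  unfolding ideal_res_def by (rule res_adjoin[OF _ _ nzdD])

lemma res_mono:
  assumes "smod U" "p \<le> q" "res p V U"
  shows "res q V U"
  using assms(2,3) by (induction q rule: dec_induct) (simp_all only: res_Suc[OF assms(1)])

lemma nzd_cong:
  assumes "is_ideal J" "a - b \<in> J" "nzd J b"
  shows "nzd J a"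
  unfolding nzd_def
proof (intro ballI impI)
  note D = is_idealD[OF assms(1)]
  fix f assume f: "f \<in> A" "a * f \<in> J"
  have "b * f = a * f - (a - b) * f" by (simp add: algebra_simps)
  then have "b * f \<in> J" using D(7)[OF f(2) D(5)[OF f(1) assms(2)]] by simp
  then show "f \<in> J" by (rule nzdD[OF assms(3) f(1)])
qed

lemma adjoin_cong:
  assumes J: "is_ideal J" and "a - b \<in> J" "a \<in> A" "b \<in> A"
  shows "adjoin J a = adjoin J b"
proof -
  note D = is_idealD[OF J]
  have *: "adjoin J a \<subseteq> adjoin J b" if ab: "a - b \<in> J" "a \<in> A" "b \<in> A" for a b
  proof (rule adjoin_subset[OF is_ideal_adjoin[OF J ab(3)] adjoin_superset])
    show "a \<in> adjoin J b" using adjoinI[OF ab(1) one_mem, of b] by simp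
  qed
  have "b - a \<in> J" using D(6)[OF assms(2)] by simp
  then show ?thesis using *[OF assms(2-4)] *[of b a] assms(3,4) by blast
qed

end

context poly_subring
begin

text \<open>The variables in \<open>C\<close> are adjoined to the zero ideal one at a time, each a
  nonzerodivisor modulo the earlier ones, and each costs one module, as in the Koszul
  complex.\<close>

lemma res_face_ideal_compl:
  "finite C \<Longrightarrow> C \<subseteq> vertices n \<Longrightarrow> ideal_res (card C) (face_ideal (vertices n - C))"
proof (induction C rule: finite_induct)
  case empty
  show ?case by (simp add: face_ideal_all ideal_res_zero)
next
  case (insert i C)
  let ?V = "vertices n - C"
  have i: "i \<in> vertices n" "i \<in> ?V" using insert by auto
  have "vertices n - insert i C = ?V - {i}" by auto
  then have "face_ideal (vertices n - insert i C) = adjoin (face_ideal ?V) (var i)"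
    using adjoin_face_ideal[OF i(1), of ?V] by simp
  moreover have "ideal_res (Suc (card C)) (adjoin (face_ideal ?V) (var i))"
    using insert
    by (intro ideal_res_adjoin[OF is_ideal_face_ideal var_mem[OF i(1)] nzd_face_ideal[OF i]]) simp_all
  ultimately show ?case using insert by simp
qed

lemma res_face_ideal:
  assumes "V \<subseteq> vertices n"
  shows "res (n - card V) (emb ` face_ideal V) {0}"
proof -
  have "card (vertices n - V) = n - card V" "vertices n - (vertices n - V) = V"
    using assms by (auto simp: card_Diff_subset finite_subset)
  then show ?thesis using res_face_ideal_compl[of "vertices n - V"] by (simp add: ideal_res_def)
qed

lemma layered_res:
  assumes "layered n D N"
  shows "res (Suc (n - D)) (emb ` A) (emb ` mon_ideal N)"
  using assms
proof (induction rule: layered.induct)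
  case (layered_leaf V)
  have "res (Suc (n - card V)) (emb ` A) (emb ` face_ideal V)"
    by (rule res_quotient[OF is_ideal_face_ideal res_face_ideal[OF layered_leaf(1)]])
  moreover have "Suc (n - card V) \<le> Suc (n - D)" using layered_leaf(2) by simp
  ultimately show ?case
    unfolding face_ideal_def[symmetric] using res_mono[OF smod_emb[OF is_ideal_face_ideal]] by blast
next
  case (layered_step N i)
  show ?case
    by (rule res_extension[OF is_ideal_mon_ideal[OF layered_step(1)] var_mem[OF layered_step(2)]])
      (use layered_step in \<open>simp_all only: colon_mon_ideal adjoin_mon_ideal\<close>)
qed

lemma layered_regs:
  assumes "layered n D N" and as: "set as \<subseteq> A"
    and leaf: "\<And>V. V \<subseteq> vertices n \<Longrightarrow> D \<le> card V \<Longrightarrow> regs (face_ideal V) as"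
  shows "regs (mon_ideal N) as"
  using assms(1)
proof (induction rule: layered.induct)
  case (layered_leaf V)
  then show ?case using leaf by (simp add: face_ideal_def)
next
  case (layered_step N i)
  show ?case
    by (rule regs_extension[OF is_ideal_mon_ideal[OF layered_step(1)] var_mem[OF layered_step(2)] as])
      (use layered_step in \<open>simp_all only: colon_mon_ideal adjoin_mon_ideal\<close>)
qed

definition deg :: "monomial \<Rightarrow> nat" where
  "deg m = (\<Sum>i\<in>vertices n. coef m i)"

lemma deg_add: "deg (a + b) = deg a + deg b"
  by (simp add: deg_def lookup_add sum.distrib)

lemma deg_sqf:
  assumes "S \<subseteq> vertices n"
  shows "deg (sqf S) = card S"
proof -
  have "finite S" using assms by (rule finite_vertices_subset)
  then have "deg (sqf S) = (\<Sum>i\<in>vertices n. if i \<in> S then 1 else 0)" by (simp add: deg_def lookup_sqf)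
  also have "\<dots> = card (vertices n \<inter> S)" by (simp add: sum.If_cases)
  finally show ?thesis using assms by (simp add: Int_absorb1)
qed

lemma deg_pos:
  assumes "supp m \<subseteq> vertices n" "supp m \<noteq> {}"
  shows "0 < deg m"
proof -
  obtain i where "i \<in> supp m" "i \<in> vertices n" using assms by blast
  then show ?thesis unfolding deg_def by (intro sum_pos2[of _ i]) (simp_all add: in_keys_iff)
qed

lemma deg_multiple: "deg (\<Sum>i<k. m) = k * deg m"
proof (induction k)
  case 0
  show ?case by (simp add: deg_def)
next
  case (Suc k)
  show ?case unfolding sum.lessThan_Suc deg_add Suc by simp
qed

definition homogeneous :: "'k polynomial set \<Rightarrow> bool" where
  "homogeneous J \<longleftrightarrow> (\<forall>f\<in>J. \<forall>d. part (\<lambda>m. deg m = d) f \<in> J)"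

lemma homogeneous_face_ideal: "homogeneous (face_ideal V)"
  by (simp add: homogeneous_def face_ideal_iff part_mem keys_part)

lemma homogeneous_adjoin:
  assumes J: "homogeneous J" "is_ideal J" and a: "a \<in> A" "\<And>m. m \<in> supp a \<Longrightarrow> deg m = e"
  shows "homogeneous (adjoin J a)"
  unfolding homogeneous_def
proof (intro ballI allI)
  fix f d assume "f \<in> adjoin J a"
  then obtain j g where f: "f = j + a * g" "j \<in> J" "g \<in> A" by (auto simp: adjoin_def)
  \<comment> \<open>Selects the part of \<open>g\<close> that contributes to degree \<open>d\<close>
    after multiplication by \<open>a\<close>. The additive form makes this part zero when
    \<open>d < e\<close>.\<close>
  define P where "P = (\<lambda>m. deg m + e = d)"
  have "part (\<lambda>m. deg m = d) (a * part P g) = a * part P g"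
  proof (rule part_all)
    fix m assume "m \<in> supp (a * part P g)"
    then show "deg m = d" by (elim keys_multE) (auto simp: keys_part P_def deg_add a(2))
  qed
  moreover have "part (\<lambda>m. deg m = d) (a * part (\<lambda>m. \<not> P m) g) = 0"
  proof (rule part_none)
    fix m assume "m \<in> supp (a * part (\<lambda>m. \<not> P m) g)"
    then show "deg m \<noteq> d" by (elim keys_multE) (auto simp: keys_part P_def deg_add a(2))
  qed
  moreover have "f = j + (a * part P g + a * part (\<lambda>m. \<not> P m) g)"
    unfolding f(1) distrib_left[symmetric] part_compl ..
  ultimately have "part (\<lambda>m. deg m = d) f = part (\<lambda>m. deg m = d) j + a * part P g"
    by (simp add: part_add)
  then show "part (\<lambda>m. deg m = d) f \<in> adjoin J a"
    using J(1) f(2) part_mem[OF f(3)] by (simp add: homogeneous_def adjoinI)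
qed

lemma homogeneous_gen:
  "homogeneous J \<Longrightarrow> is_ideal J \<Longrightarrow> set as \<subseteq> A \<Longrightarrow> (\<And>a. a \<in> set as \<Longrightarrow> \<exists>e. \<forall>m\<in>supp a. deg m = e) \<Longrightarrow>
    homogeneous (gen J as)"
proof (induction as arbitrary: J)
  case (Cons a as)
  obtain e where e: "\<forall>m\<in>supp a. deg m = e" using Cons.prems(4)[of a] by auto
  have "homogeneous (adjoin J a)" using Cons.prems e by (intro homogeneous_adjoin[of _ _ e]) auto
  then show ?case using Cons.IH Cons.prems is_ideal_adjoin by simp
qed simp

text \<open>The graded form of Krull's intersection theorem, which supplies the last hypothesis of
  \<open>regs_lift\<close>. A multiple of a high power of x_v has no components in the degrees
  occurring in \<open>f\<close>, so these components come from \<open>K\<close> alone.\<close>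

lemma homogeneous_separated:
  assumes K: "homogeneous K" "is_ideal K" and v: "v \<in> vertices n"
    and f: "\<And>k. f \<in> adjoin K (var v ^ k)"
  shows "f \<in> K"
proof -
  \<comment> \<open>One more than every degree occurring in \<open>f\<close>; the inserted 0 covers
    \<open>f = 0\<close>.\<close>
  define k where "k = Suc (Max (insert 0 (deg ` supp f)))"
  have k: "deg m < k" if "m \<in> supp f" for m
    unfolding k_def using that by (simp add: less_Suc_eq_le)
  obtain j g where jg: "f = j + var v ^ k * g" "j \<in> K" "g \<in> A"
    using f[of k] by (auto simp: adjoin_def)
  have "part (\<lambda>m. deg m = d) f \<in> K" if "d < k" for d
  proof -
    have dv: "deg (sing v 1) = 1" using deg_sqf[of "{v}"] v by (simp add: sqf_def)
    have "\<not> deg m = d" if "m \<in> supp (var v ^ k * g)" for m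
    proof -
      obtain l where "m = (\<Sum>i<k. sing v 1) + l"
        using \<open>m \<in> supp (var v ^ k * g)\<close> unfolding var_def monom_power keys_monom_times by blast
      then have "deg m = k + deg l" by (simp only: deg_add deg_multiple dv mult_1_right)
      then show ?thesis using \<open>d < k\<close> by simp
    qed
    then have "part (\<lambda>m. deg m = d) (var v ^ k * g) = 0" by (rule part_none)
    then have "part (\<lambda>m. deg m = d) f = part (\<lambda>m. deg m = d) j" by (simp add: jg(1) part_add)
    then show ?thesis using K(1) jg(2) by (simp add: homogeneous_def)
  qed
  then have "(\<Sum>d\<in>I. part (\<lambda>m. deg m = d) f) \<in> K" if "I \<subseteq> {..<k}" for I
    using that by (induction I rule: infinite_finite_induct) (simp_all add: is_idealD[OF K(2)])
  moreover have "(\<Sum>d<k. part (\<lambda>m. deg m = d) f) = f"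
  proof (rule poly_mapping_eqI)
    fix m
    show "coef (\<Sum>d<k. part (\<lambda>m. deg m = d) f) m = coef f m"
      using k[of m] by (cases "m \<in> supp f") (simp_all add: lookup_sum lookup_part in_keys_iff)
  qed
  ultimately show ?thesis by force
qed

definition elem_sym :: "nat \<Rightarrow> 'k polynomial" where
  "elem_sym j = (\<Sum>S\<in>{S. S \<subseteq> vertices n \<and> card S = j}. monomial_poly (sqf S))"

text \<open>The descending order matters: for |V| = D the polynomial of degree D is the product of
  the variables in \<open>V\<close> modulo the others, and after removing one of them the polynomial
  of degree D - 1 is again such a product.\<close>

primrec elem_syms :: "nat \<Rightarrow> 'k polynomial list" where
  "elem_syms 0 = []"
| "elem_syms (Suc D) = elem_sym (Suc D) # elem_syms D"

lemma sqf_mem: "S \<subseteq> vertices n \<Longrightarrow> monomial_poly (sqf S) \<in> A"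
  using finite_subset[of S "vertices n"] by (simp add: monom_mem keys_sqf)

lemma elem_sym_mem: "elem_sym j \<in> A"
  unfolding elem_sym_def by (intro sum_mem sqf_mem) simp

lemma deg_elem_sym:
  assumes "m \<in> supp (elem_sym j)"
  shows "deg m = j"
proof (rule ccontr)
  assume "deg m \<noteq> j"
  then have "coef (monomial_poly (sqf S) :: 'k polynomial) m = 0" if "S \<subseteq> vertices n" "card S = j" for S
    using that deg_sqf[OF that(1)] by (auto simp: monomial_poly_def lookup_single when_def)
  then have "coef (elem_sym j) m = 0" unfolding elem_sym_def lookup_sum by (intro sum.neutral) simp
  then show False using assms by (simp add: in_keys_iff)
qed

text \<open>Any other vertex set of the size of \<open>V\<close> contains a vertex outside
  \<open>V\<close>, so its monomial vanishes modulo the face ideal.\<close>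

lemma elem_sym_cong:
  assumes "V \<subseteq> vertices n"
  shows "elem_sym (card V) - (\<Prod>i\<in>V. var i) \<in> face_ideal V"
proof -
  note D = is_idealD[OF is_ideal_face_ideal[of V]]
  let ?C = "{S. S \<subseteq> vertices n \<and> card S = card V}"
  have fin: "finite ?C" by (rule finite_subset[of _ "Pow (vertices n)"]) auto
  have fV: "finite V" using assms by (rule finite_vertices_subset)
  have "elem_sym (card V) = monomial_poly (sqf V) + (\<Sum>S\<in>?C - {V}. monomial_poly (sqf S))"
    unfolding elem_sym_def using assms by (intro sum.remove[OF fin]) simp
  then have "elem_sym (card V) - (\<Prod>i\<in>V. var i) = (\<Sum>S\<in>?C - {V}. monomial_poly (sqf S))"
    by (simp add: prod_var[OF fV])
  moreover have "monomial_poly (sqf S) \<in> face_ideal V" if "S \<in> ?C - {V}" for S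
    using that card_subset_eq[OF fV, of S] finite_subset[of S "vertices n"]
    by (auto simp: face_ideal_iff sqf_mem keys_sqf)
  then have "(\<Sum>S\<in>I. monomial_poly (sqf S)) \<in> face_ideal V" if "I \<subseteq> ?C - {V}" for I
    using that by (induction I rule: infinite_finite_induct) (auto simp: D)
  ultimately show ?thesis by simp
qed

lemma elem_syms_mem: "set (elem_syms D) \<subseteq> A"
  by (induction D) (simp_all add: elem_sym_mem)

lemma elem_syms_homogeneous: "a \<in> set (elem_syms D) \<Longrightarrow> \<exists>e. \<forall>m\<in>supp a. deg m = e"
  by (induction D) (auto dest: deg_elem_sym)

lemma elem_syms_deg_pos: "a \<in> set (elem_syms D) \<Longrightarrow> m \<in> supp a \<Longrightarrow> 0 < deg m"
  by (induction D) (auto dest: deg_elem_sym)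

lemma length_elem_syms [simp]: "length (elem_syms D) = D"
  by (induction D) simp_all

text \<open>Modulo the variables outside a set \<open>V\<close> of size \<open>D\<close>, the elementary symmetric polynomial
  of degree \<open>D\<close> is the product of the variables in \<open>V\<close>, so that the quotient is filtered by
  polynomial rings in \<open>D - 1\<close> variables.\<close>

lemma regs_elem_syms_eq: "V \<subseteq> vertices n \<Longrightarrow> card V = D \<Longrightarrow> regs (face_ideal V) (elem_syms D)"
proof (induction D arbitrary: V)
  case (Suc D)
  note J = is_ideal_face_ideal[of V]
  have fV: "finite V" using Suc.prems(1) by (rule finite_vertices_subset)
  have V: "var i \<in> A \<and> nzd (face_ideal V) (var i)" if "i \<in> V" for i
    using that Suc.prems nzd_face_ideal[of i V] by auto
  have prod: "(\<Prod>i\<in>V. var i) \<in> A" using V by (intro prod_mem) simp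
  have cong: "elem_sym (Suc D) - (\<Prod>i\<in>V. var i) \<in> face_ideal V"
    using elem_sym_cong[OF Suc.prems(1)] Suc.prems(2) by simp
  have "nzd (face_ideal V) (\<Prod>i\<in>I. var i)" if "I \<subseteq> V" for I
    using finite_subset[OF that fV] that
  proof (induction I rule: finite_induct)
    case empty
    show ?case by (simp add: nzd_def)
  next
    case (insert i I)
    moreover have "(\<Prod>i\<in>I. var i) \<in> A" using insert V by (intro prod_mem) auto
    ultimately show ?case using V nzd_mult by simp
  qed
  then have "nzd (face_ideal V) (elem_sym (Suc D))" using nzd_cong[OF J cong] by simp
  moreover have "regs (adjoin (face_ideal V) (\<Prod>i\<in>V. var i)) (elem_syms D)"
  proof (rule regs_adjoin_prod[OF J elem_syms_mem fV])
    fix i assume i: "i \<in> V"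
    have "regs (face_ideal (V - {i})) (elem_syms D)"
      using Suc.prems i fV by (intro Suc.IH) auto
    then show "var i \<in> A \<and> nzd (face_ideal V) (var i) \<and> regs (adjoin (face_ideal V) (var i)) (elem_syms D)"
      using V[OF i] adjoin_face_ideal[of i V] i Suc.prems(1) by auto
  qed
  ultimately show ?case using adjoin_cong[OF J cong elem_sym_mem prod] by simp
qed simp

text \<open>Surplus variables are removed one at a time: modulo x_v the sequence is regular by
  induction, and \<open>regs_lift\<close> removes the x_v, as all ideals involved are
  homogeneous.\<close>

lemma regs_elem_syms:
  assumes "V \<subseteq> vertices n" "D \<le> card V"
  shows "regs (face_ideal V) (elem_syms D)"
  using assms
proof (induction "card V - D" arbitrary: V)
  case 0
  then show ?case using regs_elem_syms_eq by simp
next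
  case (Suc k)
  have fV: "finite V" using Suc.prems(1) by (rule finite_vertices_subset)
  have "V \<noteq> {}" using Suc.hyps(2) by auto
  then obtain v where v: "v \<in> V" by blast
  have v': "v \<in> vertices n" using v Suc.prems(1) by auto
  have "card (V - {v}) = card V - 1" using v fV by simp
  then have "regs (face_ideal (V - {v})) (elem_syms D)"
    using Suc.hyps(2) Suc.prems by (intro Suc.hyps(1)) auto
  then have reg: "regs (adjoin (face_ideal V) (var v)) (elem_syms D)"
    using adjoin_face_ideal[OF v', of V] by simp
  have sep: "f \<in> gen (face_ideal V) (take i (elem_syms D))"
    if "i \<le> length (elem_syms D)" "\<And>k. f \<in> adjoin (gen (face_ideal V) (take i (elem_syms D))) (var v ^ k)" for i f
  proof (rule homogeneous_separated[OF homogeneous_gen is_ideal_gen v' that(2)])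
    show "set (take i (elem_syms D)) \<subseteq> A" using elem_syms_mem set_take_subset by fast
    then show "set (take i (elem_syms D)) \<subseteq> A" .
    show "\<exists>e. \<forall>m\<in>supp a. deg m = e" if "a \<in> set (take i (elem_syms D))" for a
      using elem_syms_homogeneous in_set_takeD[OF that] by blast
  qed (simp_all add: homogeneous_face_ideal is_ideal_face_ideal)
  show ?case
    by (rule regs_lift[OF is_ideal_face_ideal var_mem[OF v'] elem_syms_mem nzd_face_ideal[OF v' v] reg sep])
qed

end

section \<open>Upper bounds from algebraic dependence and facets\<close>

context poly_subring
begin

lemma supp_vertices: "p \<in> A \<Longrightarrow> m \<in> supp p \<Longrightarrow> supp m \<subseteq> vertices n"
  by (simp add: A_iff)

lemma face_ideal_antimono: "V \<subseteq> W \<Longrightarrow> face_ideal W \<subseteq> face_ideal V"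
  by (meson face_ideal_iff order.trans subsetI)

text \<open>Bounding every exponent, not the degree, makes the number of monomials in
  \<open>V\<close> a plain power (b + 1)^|V|, and the bounds add under multiplication.\<close>

definition exp_bounded :: "nat \<Rightarrow> 'k polynomial \<Rightarrow> bool" where
  "exp_bounded b p \<longleftrightarrow> (\<forall>m\<in>supp p. \<forall>i. coef m i \<le> b)"

lemma exp_bounded_mult:
  assumes "exp_bounded b p" "exp_bounded c q"
  shows "exp_bounded (b + c) (p * q)"
  unfolding exp_bounded_def
proof (intro ballI allI)
  fix m i assume "m \<in> supp (p * q)"
  then obtain k l where "m = k + l" "k \<in> supp p" "l \<in> supp q" by (elim keys_multE)
  then show "coef m i \<le> b + c"
    using assms by (simp add: exp_bounded_def lookup_add add_mono)
qed

lemma exp_bounded_power: "exp_bounded b p \<Longrightarrow> exp_bounded (k * b) (p ^ k)"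
proof (induction k)
  case 0
  show ?case by (simp add: exp_bounded_def)
next
  case (Suc k)
  then show ?case using exp_bounded_mult[of b p "k * b" "p ^ k"] by simp
qed

lemma exp_bounded_mono: "exp_bounded b p \<Longrightarrow> b \<le> c \<Longrightarrow> exp_bounded c p"
  unfolding exp_bounded_def by (meson order.trans)

lemma exp_bounded_power_product:
  "(\<And>a. a \<in> set as \<Longrightarrow> exp_bounded E a) \<Longrightarrow> e \<in> exponents N (length as) \<Longrightarrow>
    exp_bounded (length as * (N * E)) (power_product as e)"
proof (induction as arbitrary: e)
  case Nil
  show ?case by (simp add: exp_bounded_def)
next
  case (Cons a as)
  obtain i e' where e: "e = i # e'" "i < N" "e' \<in> exponents N (length as)"
    using Cons.prems(2) by (cases e) (auto simp: exponents_def)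
  have "exp_bounded (N * E) (a ^ i)"
    using exp_bounded_power[OF Cons.prems(1)[of a], of i] e(2) by (auto elim!: exp_bounded_mono)
  moreover have "exp_bounded (length as * (N * E)) (power_product as e')"
    using Cons.IH[OF _ e(3)] Cons.prems(1) by simp
  ultimately show ?case using exp_bounded_mult by (simp add: e(1))
qed

lemma exp_bounded_exists:
  assumes "set as \<subseteq> A"
  shows "\<exists>E. \<forall>a\<in>set as. exp_bounded E a"
proof (intro exI ballI)
  fix a assume a: "a \<in> set as"
  have "coef m i \<le> (\<Sum>a\<in>set as. \<Sum>m\<in>supp a. deg m)" if m: "m \<in> supp a" for m i
  proof -
    have s: "supp m \<subseteq> vertices n" using supp_vertices[OF subsetD[OF assms a] m] .
    have "coef m i \<le> deg m"
    proof (cases "i \<in> supp m")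
      case True
      then show ?thesis
        unfolding deg_def using s by (intro member_le_sum) auto
    qed (simp add: in_keys_iff)
    also have "deg m \<le> (\<Sum>m\<in>supp a. deg m)" using m by (intro member_le_sum) simp_all
    also have "\<dots> \<le> (\<Sum>a\<in>set as. \<Sum>m\<in>supp a. deg m)"
      using member_le_sum[OF a, of "\<lambda>a. \<Sum>m\<in>supp a. deg m"] by simp
    finally show ?thesis .
  qed
  then show "exp_bounded (\<Sum>a\<in>set as. \<Sum>m\<in>supp a. deg m) a" by (simp add: exp_bounded_def)
qed

end

lemma bounded_monomials:
  assumes "finite V"
  shows "finite {m :: monomial. supp m \<subseteq> V \<and> (\<forall>i. coef m i \<le> b)}" (is "finite ?M")
    and "card {m :: monomial. supp m \<subseteq> V \<and> (\<forall>i. coef m i \<le> b)} \<le> Suc b ^ card V"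
proof -
  let ?f = "\<lambda>m :: monomial. restrict (coef m) V"
  have inj: "inj_on ?f ?M"
  proof (rule inj_onI, rule poly_mapping_eqI)
    fix m m' i assume m: "m \<in> ?M" "m' \<in> ?M" "?f m = ?f m'"
    show "coef m i = coef m' i"
    proof (cases "i \<in> V")
      case True
      then show ?thesis using fun_cong[OF m(3), of i] by simp
    next
      case False
      then have "i \<notin> supp m" "i \<notin> supp m'" using m by auto
      then show ?thesis by (simp add: in_keys_iff)
    qed
  qed
  have sub: "?f ` ?M \<subseteq> (\<Pi>\<^sub>E i\<in>V. {..b})" by auto
  have fin: "finite (\<Pi>\<^sub>E i\<in>V. {..b})" using assms by (simp add: finite_PiE)
  show "finite ?M" using finite_imageD[OF finite_subset[OF sub fin] inj] .
  show "card ?M \<le> Suc b ^ card V"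
    using card_inj_on_le[OF inj sub fin] assms by (simp add: card_PiE)
qed

lemma polynomial_vector_space: "vector_space (\<lambda>c (p :: 'k::field polynomial). sing 0 c * p)"
  by unfold_locales
    (simp_all add: distrib_left distrib_right single_add mult.assoc[symmetric] mult_single)

context poly_subring
begin

text \<open>Counting: in a polynomial ring in \<open>D\<close> variables, \<open>r > D\<close> elements have \<open>N\<^sup>r\<close> power products
  with exponents below \<open>N\<close>, while the monomials involved number at most \<open>(C N)\<^sup>D\<close>.\<close>

lemma algebraic_relation:
  assumes V: "V \<subseteq> vertices n" and as: "set as \<subseteq> A" and len: "card V < length as"
  shows "\<exists>N c e. e \<in> exponents N (length as) \<and> c e \<noteq> 0 \<and>
    (\<Sum>e\<in>exponents N (length as). sing 0 (c e) * power_product as e) \<in> face_ideal V"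
proof -
  interpret VS: vector_space "\<lambda>c (p :: 'k polynomial). sing 0 c * p" by (rule polynomial_vector_space)
  let ?r = "length as" and ?D = "card V"
  obtain E where E: "\<forall>a\<in>set as. exp_bounded E a" using exp_bounded_exists[OF as] by blast
  \<comment> \<open>Since \<open>b + 1\<close> is at most N (rE + 1) and \<open>N\<close> exceeds
    (rE + 1)^D, one gets (b + 1)^D < N^(D + 1) \<le> N^r: fewer monomials than power
    products.\<close>
  define N where "N = Suc ((Suc (?r * E)) ^ ?D)"
  define b where "b = ?r * (N * E)"
  define M where "M = {m :: monomial. supp m \<subseteq> V \<and> (\<forall>i. coef m i \<le> b)}"
  define G where "G = (\<lambda>e. part (\<lambda>m. supp m \<subseteq> V) (power_product as e))"
  let ?X = "exponents N ?r"
  have fV: "finite V" using V by (rule finite_vertices_subset)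
  have finM: "finite M" and cardM: "card M \<le> Suc b ^ ?D"
    unfolding M_def using bounded_monomials[OF fV, of b] by auto
  have "Suc b \<le> N * Suc (?r * E)" by (simp add: b_def N_def algebra_simps)
  then have "Suc b ^ ?D \<le> N ^ ?D * Suc (?r * E) ^ ?D"
    unfolding power_mult_distrib[symmetric] by (rule power_mono) simp
  also have "\<dots> < N ^ ?D * N" unfolding N_def by (rule mult_strict_left_mono) simp_all
  also have "\<dots> = N ^ Suc ?D" by simp
  also have "\<dots> \<le> N ^ ?r" using len by (intro power_increasing) (simp_all add: N_def)
  finally have count: "Suc b ^ ?D < N ^ ?r" .
  have span: "G e \<in> VS.span (monomial_poly ` M)" if e: "e \<in> ?X" for e
  proof -
    have "monomial_poly m \<in> VS.span (monomial_poly ` M)" if "m \<in> supp (G e)" for m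
      using that exp_bounded_power_product[of as E e N] E e
      by (intro VS.span_base imageI) (simp add: M_def G_def keys_part exp_bounded_def b_def)
    then have "sing m (coef (G e) m) \<in> VS.span (monomial_poly ` M)" if "m \<in> supp (G e)" for m
      using VS.span_scale[of "monomial_poly m" _ "coef (G e) m"] that
      by (simp add: monomial_poly_def mult_single)
    then have "(\<Sum>m\<in>supp (G e). sing m (coef (G e) m)) \<in> VS.span (monomial_poly ` M)"
      by (intro VS.span_sum)
    then show ?thesis by (simp only: poly_expand)
  qed
  have "\<exists>c. (\<exists>e\<in>?X. c e \<noteq> 0) \<and> (\<Sum>e\<in>?X. sing 0 (c e) * G e) = 0"
  proof (cases "inj_on G ?X")
    case True
    have "VS.dependent (G ` ?X)"
    proof (rule ccontr)
      assume "\<not> VS.dependent (G ` ?X)"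
      moreover have "G ` ?X \<subseteq> VS.span (monomial_poly ` M)" using span by blast
      ultimately have "card (G ` ?X) \<le> card (monomial_poly ` M :: 'k polynomial set)"
        using VS.independent_span_bound[of "monomial_poly ` M" "G ` ?X"] finM by simp
      also have "\<dots> \<le> card M" by (rule card_image_le[OF finM])
      finally show False using cardM count card_image[OF True] by (simp add: card_exponents)
    qed
    then obtain u where u: "\<exists>v\<in>G ` ?X. u v \<noteq> 0" "(\<Sum>v\<in>G ` ?X. sing 0 (u v) * v) = 0"
      by (auto simp: VS.dependent_finite)
    then show ?thesis by (intro exI[of _ "\<lambda>e. u (G e)"]) (auto simp: sum.reindex[OF True])
  next
    case False
    then obtain e1 e2 where e: "e1 \<in> ?X" "e2 \<in> ?X" "e1 \<noteq> e2" "G e1 = G e2" by (auto simp: inj_on_def)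
    define c where "c = (\<lambda>e. (if e = e1 then 1 else 0) - (if e = e2 then 1 else (0 :: 'k)))"
    have "sing 0 (c x) * G x = (if x = e1 then G e1 else 0) - (if x = e2 then G e2 else 0)" for x
      by (simp add: c_def)
    then have "(\<Sum>x\<in>?X. sing 0 (c x) * G x) = G e1 - G e2"
      using e(1,2) by (simp add: sum_subtractf)
    then show ?thesis using e by (intro exI[of _ c]) (auto simp: c_def intro!: bexI[of _ e1])
  qed
  then obtain c e where c: "e \<in> ?X" "c e \<noteq> 0" "(\<Sum>e\<in>?X. sing 0 (c e) * G e) = 0" by blast
  define H where "H = (\<lambda>e. part (\<lambda>m. \<not> supp m \<subseteq> V) (power_product as e))"
  have H: "H e \<in> face_ideal V" for e
    using part_mem[OF power_product_mem[OF as]] by (simp add: H_def face_ideal_iff keys_part)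
  have GH: "power_product as e = G e + H e" for e by (simp add: G_def H_def part_compl)
  have "(\<Sum>e\<in>?X. sing 0 (c e) * power_product as e) = (\<Sum>e\<in>?X. sing 0 (c e) * H e)"
    unfolding GH distrib_left sum.distrib c(3) by simp
  moreover have "(\<Sum>e\<in>I. sing 0 (c e) * H e) \<in> face_ideal V" for I
    using is_idealD[OF is_ideal_face_ideal[of V]] H
    by (induction I rule: infinite_finite_induct) simp_all
  ultimately show ?thesis using c(1,2) by (intro exI[of _ N] exI[of _ c] exI[of _ e]) simp
qed

lemma const_unit: "sing 0 c = (0 :: 'k polynomial) \<or> (\<exists>u\<in>A. u * sing 0 c = 1)"
proof (cases "c = 0")
  case False
  then have "sing 0 (inverse c) * sing 0 c = (1 :: 'k polynomial)" by (simp add: mult_single)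
  then show ?thesis using const_mem by blast
qed simp

text \<open>The common core of the bounds for depth and Krull dimension. More than |V| elements
  satisfy a relation modulo \<open>face_ideal V\<close>; multiplied by \<open>z\<close> it becomes a
  relation modulo \<open>J\<close>, and the chain then forces \<open>z\<close> into its last
  ideal.\<close>

lemma nzd_chain_face_ideal:
  assumes V: "V \<subseteq> vertices n" and as: "set as \<subseteq> A" "card V < length as"
    and J: "is_ideal J" "nzd_chain J as L"
    and z: "z \<in> A" "\<And>f. f \<in> face_ideal V \<Longrightarrow> f * z \<in> J"
  shows "z \<in> L"
proof -
  obtain N c e where c: "e \<in> exponents N (length as)" "c e \<noteq> 0"
    "(\<Sum>e\<in>exponents N (length as). sing 0 (c e) * power_product as e) \<in> face_ideal V"
    using algebraic_relation[OF V as] by blast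
  have "(\<Sum>e\<in>exponents N (length as). sing 0 (c e) * power_product as e * z) \<in> J"
    using z(2)[OF c(3)] by (simp add: sum_distrib_right)
  moreover have "sing 0 (c e) \<noteq> (0 :: 'k polynomial)"
    using c(2) by (metis lookup_single_eq lookup_zero)
  ultimately show ?thesis
    using nzd_chain_relation[OF J(2,1) as(1) z(1), of "\<lambda>e. sing 0 (c e)" e N] const_unit c(1) by simp
qed

lemma gen_subset:
  assumes "is_ideal L"
  shows "J \<subseteq> L \<Longrightarrow> set as \<subseteq> L \<Longrightarrow> gen J as \<subseteq> L"
  by (induction as arbitrary: J) (simp_all add: adjoin_subset[OF assms])

definition facet :: "nat set set \<Rightarrow> nat set \<Rightarrow> bool" where
  "facet N F \<longleftrightarrow> F \<subseteq> vertices n \<and> F \<notin> N \<and> (\<forall>i\<in>vertices n - F. insert i F \<in> N)"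

text \<open>Each monomial of \<open>f\<close> brings in a variable outside \<open>F\<close>, and
  adding it to the maximal face \<open>F\<close> gives a nonface.\<close>

lemma facet_monomial:
  assumes N: "upward n N" and F: "facet N F" and f: "f \<in> face_ideal F"
  shows "f * monomial_poly (sqf F) \<in> mon_ideal N"
proof -
  have F': "F \<subseteq> vertices n" using F by (simp add: facet_def)
  note fin = finite_vertices_subset[OF F']
  have fA: "f \<in> A" using f by (simp add: face_ideal_iff)
  have "supp m \<in> N" if m: "m \<in> supp (monomial_poly (sqf F) * f)" for m
  proof -
    obtain l where l: "l \<in> supp f" "m = sqf F + l" using m by (auto simp: keys_monom_times)
    have lv: "supp l \<subseteq> vertices n" by (rule supp_vertices[OF fA l(1)])
    obtain i where i: "i \<in> supp l" "i \<notin> F" using f l(1) by (auto simp: face_ideal_iff)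
    have "insert i F \<in> N" using F i lv by (auto simp: facet_def)
    then have "F \<union> supp l \<in> N" by (rule upwardD[OF N]) (use i F' lv in auto)
    then show ?thesis by (simp add: l(2) keys_plus_nat keys_sqf[OF fin])
  qed
  then show ?thesis
    using mult_mem[OF fA sqf_mem[OF F']] by (simp add: mon_ideal_iff mult.commute[of f])
qed

text \<open>A longer sequence, replaced by its powers with exponent |F| + 1, would put x_F into the
  ideal they generate together with \<open>mon_ideal N\<close>. But every monomial there has its
  support in \<open>N\<close> or degree at least |F| + 1, since the elements have no constant term,
  whereas \<open>F\<close> is a face and x_F has degree |F|.\<close>

lemma regular_sequence_length_le:
  assumes N: "upward n N" and F: "facet N F"
    and reg: "regular_sequence sub_ring (quot (mon_ideal N)) as"
    and max: "\<And>a m. a \<in> set as \<Longrightarrow> m \<in> supp a \<Longrightarrow> supp m \<noteq> {}"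
  shows "length as \<le> card F"
proof (rule ccontr)
  assume len: "\<not> length as \<le> card F"
  let ?J = "mon_ideal N" and ?k = "Suc (card F)"
  note J = is_ideal_mon_ideal[OF N]
  have F': "F \<subseteq> vertices n" "F \<notin> N" using F by (simp_all add: facet_def)
  note fin = finite_vertices_subset[OF F'(1)]
  have as: "set as \<subseteq> A" "regs ?J as" using reg by (simp_all add: regular_sequence_iff[OF J])
  define bs where "bs = map (\<lambda>a. a ^ ?k) as"
  have bs: "set bs \<subseteq> A" using as(1) by (auto simp: bs_def)
  have "nzd_chain ?J bs (gen ?J bs)"
    unfolding bs_def by (intro nzd_chain_gen J regs_power as bs[unfolded bs_def])
  then have "monomial_poly (sqf F) \<in> gen ?J bs"
    using nzd_chain_face_ideal[OF F'(1) bs _ J _ sqf_mem[OF F'(1)] facet_monomial[OF N F]] len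
    by (simp add: bs_def)
  moreover have "gen ?J bs \<subseteq> monom_set (\<lambda>m. supp m \<in> N \<or> ?k \<le> deg m)"
  proof -
    let ?L = "monom_set (\<lambda>m. supp m \<in> N \<or> ?k \<le> deg m)"
    have L: "is_ideal ?L"
    proof (rule is_ideal_monom_set)
      fix k m :: monomial
      assume "supp k \<subseteq> vertices n" "supp m \<subseteq> vertices n" "supp m \<in> N \<or> ?k \<le> deg m"
      then show "supp (k + m) \<in> N \<or> ?k \<le> deg (k + m)"
        using upwardD[OF N, of "supp m" "supp (k + m)"] by (auto simp: keys_plus_nat deg_add)
    qed
    have "?J \<subseteq> ?L" by (auto simp: mon_ideal_def monom_set_def)
    moreover have "set bs \<subseteq> ?L"
    proof
      fix b assume "b \<in> set bs"
      then obtain a where a: "b = a ^ ?k" "a \<in> set as" by (auto simp: bs_def)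
      have "\<forall>m\<in>supp (a ^ l). l \<le> deg m" for l
      proof (induction l)
        case (Suc l)
        show ?case
        proof
          fix m assume "m \<in> supp (a ^ Suc l)"
          then obtain u v where uv: "m = u + v" "u \<in> supp a" "v \<in> supp (a ^ l)"
            unfolding power_Suc by (elim keys_multE)
          have "supp u \<subseteq> vertices n" using supp_vertices[OF subsetD[OF as(1) a(2)] uv(2)] .
          then have "0 < deg u" using deg_pos max[OF a(2) uv(2)] by blast
          moreover have "l \<le> deg v" using Suc uv(3) by blast
          ultimately show "Suc l \<le> deg m" by (simp add: uv(1) deg_add)
        qed
      qed simp
      then show "b \<in> ?L" using a as(1) by (auto simp: monom_set_def simp del: power_Suc)
    qed
    ultimately show ?thesis using gen_subset[OF L] by blast
  qed
  ultimately have "monomial_poly (sqf F) \<in> monom_set (\<lambda>m. supp m \<in> N \<or> ?k \<le> deg m)" by blast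
  then show False using F' by (simp add: monom_set_def keys_sqf[OF fin] deg_sqf)
qed

lemma seq_sub_regular_module:
  "seq_sub (regular_module sub_ring) x A k = gen {0} (map x [0..<k])"
proof (induction k)
  case (Suc k)
  then show ?case by (auto simp: gen_append adjoin_def)
qed simp

lemma gen_variables:
  "set vs \<subseteq> vertices n \<Longrightarrow> gen (face_ideal V) (map var vs) = face_ideal (V - set vs)"
proof (induction vs arbitrary: V)
  case (Cons i vs)
  have "V - {i} - set vs = V - set (i # vs)" by auto
  then show ?case using Cons adjoin_face_ideal[of i V] by simp
qed simp

text \<open>The variables outside \<open>F\<close> are regular on the ring and kill the nonzero
  class of x_F, so that class starts the chase of
  \<open>projective_resolution_length\<close>.\<close>

lemma projective_resolution_length_ge:
  assumes N: "upward n N" and F: "facet N F"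
    and res: "has_projective_resolution sub_ring (quot (mon_ideal N)) q"
  shows "n - card F \<le> q"
proof -
  let ?J = "mon_ideal N"
  note J = is_ideal_mon_ideal[OF N]
  have F': "F \<subseteq> vertices n" "F \<notin> N" using F by (simp_all add: facet_def)
  note fin = finite_vertices_subset[OF F'(1)]
  obtain vs where vs: "set vs = vertices n - F" "distinct vs"
    using finite_distinct_list[of "vertices n - F"] by auto
  have len: "length vs = n - card F"
    using distinct_card[OF vs(2)] vs(1) card_Diff_subset[OF fin F'(1)] by simp
  \<comment> \<open>The chase expects an infinite sequence in the ring; zeros pad it beyond the
    variables outside \<open>F\<close>.\<close>
  define x where "x = (\<lambda>j. if j < length vs then var (vs ! j) else (0 :: 'k polynomial))"
  have vs_mem: "vs ! j \<in> vertices n - F" if "j < length vs" for j using vs(1) nth_mem[OF that] by simp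
  have xA: "x j \<in> carrier sub_ring" for j using vs_mem by (auto simp: x_def)
  have "map x [0..<j] = map var (take j vs)" if "j \<le> length vs" for j
    using that by (intro nth_equalityI) (simp_all add: x_def)
  then have S: "seq_sub (regular_module sub_ring) x A j = face_ideal (vertices n - set (take j vs))"
    if "j \<le> length vs" for j
    unfolding seq_sub_regular_module face_ideal_all[symmetric] using that vs(1) set_take_subset[of j vs]
    by (subst gen_variables[symmetric]) auto
  have reg: "weakly_regular_on (regular_module sub_ring) x (carrier sub_ring) (length vs)"
    unfolding weakly_regular_on_def
  proof (intro allI impI ballI)
    fix j u assume j: "j < length vs" and u: "u \<in> carrier sub_ring"
      "x j \<odot>\<^bsub>regular_module sub_ring\<^esub> u \<in> seq_sub (regular_module sub_ring) x (carrier sub_ring) j"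
    have "vs ! j \<notin> set (take j vs)"
      using vs(2) j by (metis distinct_take id_take_nth_drop not_distinct_conv_prefix take_Suc_conv_app_nth)
    then have "nzd (face_ideal (vertices n - set (take j vs))) (var (vs ! j))"
      using vs_mem[OF j] by (intro nzd_face_ideal) auto
    then show "u \<in> seq_sub (regular_module sub_ring) x (carrier sub_ring) j"
      using u j S[of j] nzdD by (simp add: x_def)
  qed
  let ?z = "coset ?J (monomial_poly (sqf F))"
  note Q = quot_module_simps[OF J]
  have zA: "monomial_poly (sqf F) \<in> A" by (rule sqf_mem[OF F'(1)])
  have z: "?z \<in> carrier (quot ?J)" using zA by (simp add: Q)
  have "monomial_poly (sqf F) \<notin> ?J" using F'(2) by (simp add: mon_ideal_iff keys_sqf[OF fin])
  then have z0: "?z \<noteq> \<zero>\<^bsub>quot ?J\<^esub>" using coset_zero_iff[OF J zA] by (simp add: Q)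
  have "x i \<odot>\<^bsub>quot ?J\<^esub> ?z = \<zero>\<^bsub>quot ?J\<^esub>" if "i < length vs" for i
  proof -
    have "x i \<in> face_ideal F" using vs_mem[OF that] that by (auto simp: x_def face_ideal_iff)
    then have "x i * monomial_poly (sqf F) \<in> ?J" by (rule facet_monomial[OF N F])
    then show ?thesis using xA[of i] zA coset_zero_iff[OF J] by (simp add: Q)
  qed
  then show ?thesis
    using R.projective_resolution_length[OF quot_module_module[OF J] xA reg z z0 _ res] len by simp
qed

section \<open>Prime ideals of the quotient ring and its Krull dimension\<close>

lemma quot_ring_simps:
  assumes "is_ideal J"
  shows "carrier (sub_ring Quot J) = coset J ` A"
    and "\<zero>\<^bsub>sub_ring Quot J\<^esub> = J" "\<one>\<^bsub>sub_ring Quot J\<^esub> = coset J 1"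
    and "a \<in> A \<Longrightarrow> b \<in> A \<Longrightarrow> coset J a \<oplus>\<^bsub>sub_ring Quot J\<^esub> coset J b =
      coset J (a + b)"
    and "a \<in> A \<Longrightarrow> b \<in> A \<Longrightarrow> coset J a \<otimes>\<^bsub>sub_ring Quot J\<^esub> coset J b =
      coset J (a * b)"
  using quot_module_simps[OF assms] by (simp_all add: quot_module_def) (simp add: FactRing_def)

lemma is_prime_preimage:
  assumes J: "is_ideal J" and P: "primeideal P (sub_ring Quot J)"
  defines "Q \<equiv> {a \<in> A. coset J a \<in> P}"
  shows "is_prime Q" "J \<subseteq> Q" "P = coset J ` Q"
proof -
  interpret P: primeideal P "sub_ring Quot J" by (rule P)
  note S = quot_ring_simps[OF J]
  note sub = additive_subgroup.zero_closed[OF ideal.axioms(1)[OF P.ideal_axioms]]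
    additive_subgroup.a_closed[OF ideal.axioms(1)[OF P.ideal_axioms]]
  have "J \<in> P" using sub(1) unfolding S(2) .
  then have zero: "coset J a \<in> P" if "a \<in> J" for a
    using coset_zero_iff[OF J is_idealD(1)[OF J that]] that by simp
  show "J \<subseteq> Q" using zero is_idealD(1)[OF J] by (auto simp: Q_def)
  have "P \<subseteq> coset J ` A" using P.a_subset by (simp add: S)
  then show "P = coset J ` Q" by (auto simp: Q_def)
  show "is_prime Q"
    unfolding is_prime_def
  proof (intro conjI ballI impI)
    show "is_ideal Q"
      unfolding is_ideal_def
    proof (intro conjI ballI)
      fix a b assume "a \<in> Q" "b \<in> Q"
      then show "a + b \<in> Q"
        using sub(2)[of "coset J a" "coset J b"] by (simp add: Q_def S)
    next
      fix a b assume "a \<in> A" "b \<in> Q"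
      then show "a * b \<in> Q"
        using P.I_l_closed[of "coset J b" "coset J a"] by (simp add: Q_def S)
    qed (use zero is_idealD(2)[OF J] in \<open>auto simp: Q_def\<close>)
    show "1 \<notin> Q" using P.one_imp_carrier P.I_notcarr by (auto simp: Q_def S)
    fix a b assume "a \<in> A" "b \<in> A" "a * b \<in> Q"
    then show "a \<in> Q \<or> b \<in> Q"
      using P.I_prime[of "coset J a" "coset J b"] by (auto simp: Q_def S)
  qed
qed

lemma primeideal_image:
  assumes J: "is_ideal J" and Q: "is_prime Q" "J \<subseteq> Q"
  shows "primeideal (coset J ` Q) (sub_ring Quot J)"
proof (rule primeidealI)
  note S = quot_ring_simps[OF J]
  have Qi: "is_ideal Q" using Q(1) by (simp add: is_prime_def)
  note iff = coset_in_image_iff[OF J Qi Q(2)]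
  interpret J: ideal J sub_ring using J by (simp add: ideal_iff)
  show "ideal (coset J ` Q) (sub_ring Quot J)"
    using R.ring_ideal_imp_quot_ideal[of J Q] J Qi by (simp add: ideal_iff)
  show "cring (sub_ring Quot J)" using J.quotient_is_cring[OF sub_ring_cring] .
  show "carrier (sub_ring Quot J) \<noteq> coset J ` Q"
    using iff[OF one_mem] Q(1) one_mem unfolding S(1) is_prime_def by blast
  fix X Y assume X: "X \<in> carrier (sub_ring Quot J)" and Y: "Y \<in> carrier (sub_ring Quot J)"
    and XY: "X \<otimes>\<^bsub>sub_ring Quot J\<^esub> Y \<in> coset J ` Q"
  obtain a b where a: "a \<in> A" "X = coset J a" and b: "b \<in> A" "Y = coset J b"
    using X Y unfolding S(1) by blast
  have "a * b \<in> Q" using XY iff[OF mult_mem[OF a(1) b(1)]] by (simp only: a b S)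
  then have "a \<in> Q \<or> b \<in> Q" using Q(1) a(1) b(1) by (simp add: is_prime_def)
  then show "X \<in> coset J ` Q \<or> Y \<in> coset J ` Q"
    unfolding a(2) b(2) by blast
qed

text \<open>Let \<open>V\<close> consist of the variables outside the smallest prime
  \<open>Q 0\<close> of a chain. As \<open>Q 0\<close> is prime, x_V is not in it, so
  \<open>V\<close> is a face; and every monomial not supported in \<open>V\<close> has a variable in
  \<open>Q 0\<close>, so \<open>face_ideal V\<close> lies in \<open>Q 0\<close>. Elements picked
  from the successive differences of the primes form an \<open>nzd_chain\<close>, too long if
  \<open>k > D\<close>.\<close>

lemma krull_dim_le:
  assumes N: "upward n N" and faces: "\<And>V. V \<subseteq> vertices n \<Longrightarrow> V \<notin> N \<Longrightarrow> card V \<le> D"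
  shows "krull_dim (sub_ring Quot mon_ideal N) \<le> enat D"
  unfolding krull_dim_def
proof (rule Sup_least, clarsimp)
  let ?J = "mon_ideal N"
  note J = is_ideal_mon_ideal[OF N]
  fix k \<pp> assume prime: "\<forall>i\<le>k. primeideal (\<pp> i) (sub_ring Quot ?J)" and sub: "\<forall>i<k. \<pp> i \<subset> \<pp> (Suc i)"
  define Q where "Q = (\<lambda>i. {a \<in> A. coset ?J a \<in> \<pp> i})"
  have Q: "is_prime (Q i)" "?J \<subseteq> Q i" "\<pp> i = coset ?J ` Q i" if "i \<le> k" for i
    using is_prime_preimage[OF J, of "\<pp> i"] prime that by (simp_all add: Q_def)
  have "\<exists>a. a \<in> Q (Suc i) - Q i" "Q i \<subseteq> Q (Suc i)" if i: "i < k" for i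
  proof -
    show "Q i \<subseteq> Q (Suc i)" using sub i by (auto simp: Q_def)
    show "\<exists>a. a \<in> Q (Suc i) - Q i"
    proof (rule ccontr)
      assume "\<not> (\<exists>a. a \<in> Q (Suc i) - Q i)"
      then have "\<pp> (Suc i) \<subseteq> \<pp> i" using Q(3)[of i] Q(3)[of "Suc i"] i by auto
      then show False using sub i by blast
    qed
  qed
  then obtain a where a: "\<And>i. i < k \<Longrightarrow> a i \<in> Q (Suc i) - Q i" "\<And>i. i < k \<Longrightarrow> Q i \<subseteq> Q (Suc i)" by metis
  have Qi: "is_ideal (Q i)" if "i \<le> k" for i using Q(1)[OF that] by (simp add: is_prime_def)
  have aA: "a i \<in> A" if "i < k" for i using a(1)[OF that] by (simp add: Q_def)
  have chain: "nzd_chain (Q i) (map a [i..<i + l]) (Q (i + l))" if "i + l \<le> k" for i l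
    using that
  proof (induction l arbitrary: i)
    case (Suc l)
    have i: "i < k" using Suc.prems by simp
    have "nzd (Q i) (a i)"
      using Q(1)[of i] a(1)[OF i] aA[OF i] i by (auto simp: nzd_def is_prime_def)
    moreover have "nzd_chain (Q (Suc i)) (map a [Suc i..<Suc i + l]) (Q (Suc i + l))"
      using Suc.prems by (intro Suc.IH) simp
    moreover have "[i..<i + Suc l] = i # [Suc i..<Suc i + l]" by (simp add: upt_rec)
    ultimately show ?case using Qi[of "Suc i"] a[OF i] i by (auto intro!: exI[of _ "Q (Suc i)"])
  qed simp
  show "k \<le> D"
  proof (rule ccontr)
    assume "\<not> k \<le> D"
    define V where "V = {i \<in> vertices n. var i \<notin> Q 0}"
    have V: "V \<subseteq> vertices n" by (auto simp: V_def)
    note fin = finite_vertices_subset[OF V]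
    have prod: "(\<Prod>i\<in>I. var i) \<notin> Q 0" if "I \<subseteq> V" for I
      using finite_subset[OF that fin] that
    proof (induction I rule: finite_induct)
      case empty
      show ?case using Q(1)[of 0] by (simp add: is_prime_def)
    next
      case (insert i I)
      have "(\<Prod>i\<in>I. var i) \<in> A" using insert V by (intro prod_mem) auto
      then show ?case using insert Q(1)[of 0] V by (auto simp: is_prime_def V_def)
    qed
    have "V \<notin> N"
    proof
      assume "V \<in> N"
      then have "monomial_poly (sqf V) \<in> ?J" by (simp add: mon_ideal_iff sqf_mem V keys_sqf[OF fin])
      then show False using prod[of V] Q(2)[of 0] by (auto simp: prod_var[OF fin])
    qed
    then have card: "card V < k" using faces[OF V] \<open>\<not> k \<le> D\<close> by simp
    have sub: "face_ideal V \<subseteq> Q 0"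
    proof
      fix f assume f: "f \<in> face_ideal V"
      have "monomial_poly m \<in> Q 0" if "m \<in> supp f" for m
      proof -
        obtain i where i: "i \<in> supp m" "i \<in> vertices n" "i \<notin> V"
          using f \<open>m \<in> supp f\<close> by (auto simp: face_ideal_iff A_iff subset_iff)
        have mm: "supp m \<subseteq> vertices n" using f that by (auto simp: face_ideal_iff A_iff)
        have m: "sing i 1 + (m - sing i 1) = m"
          using i(1) by (intro poly_mapping_eqI) (auto simp: lookup_add lookup_minus lookup_single when_def in_keys_iff)
        have "supp (m - sing i 1) \<subseteq> vertices n"
          using mm by (auto simp: in_keys_iff lookup_minus subset_iff)
        then have "var i * monomial_poly (m - sing i 1) \<in> Q 0"
          using i is_idealD(5)[OF Qi[of 0], of "monomial_poly (m - sing i 1)" "var i"]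
          by (simp add: V_def monom_mem)
        then show ?thesis unfolding var_def monom_mult m .
      qed
      then show "f \<in> Q 0" by (rule ideal_contains_monoms[OF Qi[of 0, simplified]])
    qed
    \<comment> \<open>The first |V| + 1 elements already give a contradiction: with 1 as
      \<open>z\<close>, the unit would lie in the prime \<open>Q (Suc (card V))\<close>.\<close>
    let ?as = "map a [0..<0 + Suc (card V)]"
    have "1 \<in> Q (0 + Suc (card V))"
    proof (rule nzd_chain_face_ideal[OF V _ _ Qi[of 0, simplified] chain[of 0 "Suc (card V)"]])
      show "set ?as \<subseteq> A" using aA card by auto
    qed (use sub card in auto)
    then show False using Q(1)[of "Suc (card V)"] card by (simp add: is_prime_def)
  qed
qed

text \<open>Removing the vertices of \<open>V\<close> one after the other adds one variable at a
  time to the face ideal, which gives |V| + 1 primes.\<close>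

lemma krull_dim_ge:
  assumes N: "upward n N" and V: "V \<subseteq> vertices n" "V \<notin> N"
  shows "enat (card V) \<le> krull_dim (sub_ring Quot mon_ideal N)"
  unfolding krull_dim_def
proof (rule Sup_upper, clarsimp)
  let ?J = "mon_ideal N"
  note J = is_ideal_mon_ideal[OF N]
  obtain vs where vs: "set vs = V" "distinct vs"
    using finite_distinct_list[OF finite_vertices_subset[OF V(1)]] by blast
  define Q where "Q = (\<lambda>i. face_ideal (set (drop i vs)))"
  have len: "length vs = card V" using distinct_card[OF vs(2)] vs(1) by simp
  have sub: "?J \<subseteq> Q i" for i
  proof
    fix f assume f: "f \<in> ?J"
    have "set (drop i vs) \<subseteq> V" using vs(1) set_drop_subset by fast
    moreover have "\<not> supp m \<subseteq> V" if "m \<in> supp f" for m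
      using f that upwardD[OF N, of "supp m" V] V by (auto simp: mon_ideal_iff)
    ultimately have "\<not> supp m \<subseteq> set (drop i vs)" if "m \<in> supp f" for m using that by blast
    then show "f \<in> Q i" using f by (simp add: Q_def face_ideal_iff mon_ideal_iff)
  qed
  have Qi: "is_ideal (Q i)" for i unfolding Q_def by (rule is_ideal_face_ideal)
  define \<pp> where "\<pp> = (\<lambda>i. coset ?J ` Q i)"
  have "primeideal (\<pp> i) (sub_ring Quot ?J)" for i
    unfolding \<pp>_def by (rule primeideal_image[OF J _ sub]) (simp add: Q_def is_prime_face_ideal)
  moreover have "\<pp> i \<subset> \<pp> (Suc i)" if i: "i < card V" for i
  proof
    have d: "set (drop i vs) = insert (vs ! i) (set (drop (Suc i) vs))"
      using i len by (simp add: Cons_nth_drop_Suc[symmetric])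
    have "Q i \<subseteq> Q (Suc i)" 
      unfolding Q_def d by (rule face_ideal_antimono) blast
    then show "\<pp> i \<subseteq> \<pp> (Suc i)" unfolding \<pp>_def by blast
    have nd: "vs ! i \<notin> set (drop (Suc i) vs)"
      using vs(2) i len by (metis Cons_nth_drop_Suc distinct.simps(2) distinct_drop)
    have "vs ! i \<in> V" using nth_mem[of i vs] i len vs(1) by simp
    then have vA: "var (vs ! i) \<in> A" using V(1) by auto
    have "var (vs ! i) \<in> Q (Suc i)" "var (vs ! i) \<notin> Q i"
      using nd vA by (simp_all add: Q_def face_ideal_iff d)
    then have "coset ?J (var (vs ! i)) \<in> \<pp> (Suc i)" "coset ?J (var (vs ! i)) \<notin> \<pp> i"
      unfolding \<pp>_def by (simp_all only: coset_in_image_iff[OF J Qi sub vA] not_False_eq_True)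
    then show "\<pp> i \<noteq> \<pp> (Suc i)" by metis
  qed
  ultimately show "\<exists>\<pp>. (\<forall>i\<le>card V. primeideal (\<pp> i) (sub_ring Quot ?J)) \<and> (\<forall>i<card V. \<pp> i \<subset> \<pp> (Suc i))"
    by blast
qed

end

section \<open>Combinatorics of spread monomials\<close>

definition spread_list :: "nat \<Rightarrow> nat \<Rightarrow> nat \<Rightarrow> nat list \<Rightarrow> bool" where
  "spread_list n d t w \<longleftrightarrow>
    length w = d \<and> set w \<subseteq> vertices n \<and> (\<forall>r. Suc r < d \<longrightarrow> w ! r + t \<le> w ! Suc r)"

lemma spread_list_nth:
  assumes "spread_list n d t w" "i + k < d"
  shows "w ! i + k * t \<le> w ! (i + k)"
  using assms(2)
proof (induction k)
  case (Suc k)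
  then have "w ! (i + k) + t \<le> w ! (i + Suc k)" using assms(1) by (simp add: spread_list_def)
  then show ?case using Suc by simp
qed simp

lemma spread_list_sorted:
  assumes "spread_list n d t w" "1 \<le> t"
  shows "sorted_wrt (<) w"
  unfolding sorted_wrt_iff_nth_less
proof (intro allI impI)
  fix i j assume ij: "i < j" "j < length w"
  have "w ! i + (j - i) * t \<le> w ! (i + (j - i))"
    using assms(1) ij by (intro spread_list_nth) (auto simp: spread_list_def)
  moreover have "1 * 1 \<le> (j - i) * t" using ij assms(2) by (intro mult_le_mono) simp_all
  moreover have "i + (j - i) = j" using ij by simp
  ultimately show "w ! i < w ! j" by (metis add_le_same_cancel1 le_add1 le_antisym le_neq_implies_less le_trans mult_1 not_one_le_zero)
qed

lemma spread_list_bounds: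
  assumes "spread_list n d t w" "k < d"
  shows "1 + k * t \<le> w ! k" "w ! k + (d - 1 - k) * t \<le> n"
proof -
  have mem: "w ! j \<in> vertices n" if "j < d" for j
    using assms(1) that nth_mem[of j w] by (auto simp: spread_list_def)
  show "1 + k * t \<le> w ! k"
    using spread_list_nth[OF assms(1), of 0 k] mem[of 0] assms(2) by (simp add: vertices_def)
  show "w ! k + (d - 1 - k) * t \<le> n"
    using spread_list_nth[OF assms(1), of k "d - 1 - k"] mem[of "d - 1"] assms(2) by (simp add: vertices_def)
qed

text \<open>Take every t-th element of \<open>S\<close> in increasing order: consecutive elements of
  \<open>S\<close> differ by at least 1, so t positions make a difference of at least t. The last
  position used is (d - 1) t.\<close>

lemma spread_list_exists:
  assumes S: "S \<subseteq> vertices n" and card: "(d - 1) * t < card S"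
  shows "\<exists>w. spread_list n d t w \<and> set w \<subseteq> S"
proof -
  have fin: "finite S" using S by (rule finite_vertices_subset)
  define xs where "xs = sorted_list_of_set S"
  have xs: "set xs = S" "sorted_wrt (<) xs" "length xs = card S"
    using fin by (simp_all add: xs_def)
  have step: "xs ! i + k \<le> xs ! (i + k)" if "i + k < length xs" for i k
    using that
  proof (induction k)
    case (Suc k)
    have "xs ! (i + k) < xs ! (i + Suc k)"
      using xs(2) Suc.prems by (intro sorted_wrt_nth_less[of "(<)"]) simp_all
    then show ?case using Suc by simp
  qed simp
  define w where "w = map (\<lambda>k. xs ! (k * t)) [0..<d]"
  have idx: "k * t < length xs" if "k < d" for k
  proof -
    have "k * t \<le> (d - 1) * t" using that by (intro mult_le_mono1) simp
    then show ?thesis using card unfolding xs(3) by linarith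
  qed
  have "spread_list n d t w"
    unfolding spread_list_def
  proof (intro conjI allI impI)
    show "set w \<subseteq> vertices n" using idx nth_mem[of _ xs] xs(1) S by (auto simp: w_def)
    fix r assume r: "Suc r < d"
    show "w ! r + t \<le> w ! Suc r" using step[of "r * t" t] idx[OF r] r by (simp add: w_def add.commute)
  qed (simp add: w_def)
  moreover have "set w \<subseteq> S" using idx nth_mem[of _ xs] xs(1) by (auto simp: w_def)
  ultimately show ?thesis by blast
qed

text \<open>Moving the last index up to n keeps a list spread and raises it componentwise. After the
  colon by x_n, membership can therefore be tested on lists that end in n.\<close>

lemma spread_list_butlast:
  assumes "spread_list n (Suc d) t w" "1 \<le> d"
  shows "spread_list (n - t) d t (butlast w)" "list_all2 (\<le>) w (butlast w @ [n])" "t \<le> n"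
proof -
  have len: "length w = Suc d" using assms(1) by (simp add: spread_list_def)
  have b: "w ! k + (d - k) * t \<le> n" "1 \<le> w ! k" if "k < Suc d" for k
    using spread_list_bounds[OF assms(1) that] by simp_all
  have bt: "w ! k + t \<le> n" if "k < d" for k
  proof -
    have "1 * t \<le> (d - k) * t" using that by (intro mult_le_mono1) simp
    moreover have "w ! k + (d - k) * t \<le> n" using b(1)[of k] that by simp
    ultimately show ?thesis by linarith
  qed
  show "t \<le> n" using bt[of 0] assms(2) by simp
  show "spread_list (n - t) d t (butlast w)"
    unfolding spread_list_def
  proof (intro conjI allI impI)
    show "set (butlast w) \<subseteq> vertices (n - t)"
    proof
      fix x assume "x \<in> set (butlast w)"
      then obtain k where k: "k < d" "x = w ! k" using len by (auto simp: in_set_conv_nth nth_butlast)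
      then show "x \<in> vertices (n - t)" using bt[of k] b(2)[of k] by (simp add: vertices_def)
    qed
    fix r assume "Suc r < d"
    then show "butlast w ! r + t \<le> butlast w ! Suc r"
      using assms(1) len by (simp add: nth_butlast spread_list_def)
  qed (simp add: len)
  show "list_all2 (\<le>) w (butlast w @ [n])"
    unfolding list_all2_conv_all_nth
  proof (intro conjI allI impI)
    fix i assume "i < length w"
    then show "w ! i \<le> (butlast w @ [n]) ! i"
      using len b(1)[of i] by (cases "i < d") (simp_all add: nth_append nth_butlast)
  qed (simp add: len)
qed

lemma spread_list_snoc:
  assumes w: "spread_list (n - t) d t w" and "1 \<le> d" "t \<le> n" "1 \<le> n"
  shows "spread_list n (Suc d) t (w @ [n])"
  unfolding spread_list_def
proof (intro conjI allI impI)
  have len: "length w = d" using w by (simp add: spread_list_def)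
  have sub: "set w \<subseteq> vertices (n - t)" using w by (simp add: spread_list_def)
  show "length (w @ [n]) = Suc d" by (simp add: len)
  have "vertices (n - t) \<subseteq> vertices n" by (auto simp: vertices_def)
  then have "set w \<subseteq> vertices n" using sub by blast
  moreover have "n \<in> vertices n" using assms(4) by (simp add: vertices_def)
  ultimately show "set (w @ [n]) \<subseteq> vertices n" by simp
  fix r assume r: "Suc r < Suc d"
  show "(w @ [n]) ! r + t \<le> (w @ [n]) ! Suc r"
  proof (cases "Suc r < d")
    case True
    then show ?thesis using w len by (simp add: nth_append spread_list_def)
  next
    case False
    have "w ! r \<in> vertices (n - t)" using r len sub nth_mem[of r w] by auto
    then have "w ! r + t \<le> n" using assms(3) by (simp add: vertices_def le_diff_conv2)
    then show ?thesis using False r len by (simp add: nth_append)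
  qed
qed

text \<open>Supports of monomials in \<open>K[x\<^sub>1, \<dots>, x\<^sub>m]\<close> lying in the ideal generated by the \<open>t\<close>-spread monomials
  of degree \<open>d\<close> in the first \<open>n\<close> variables with property \<open>\<Phi>\<close>, and by the variables in \<open>W\<close>.\<close>

definition spread_family ::
  "nat \<Rightarrow> nat \<Rightarrow> nat \<Rightarrow> nat \<Rightarrow> (nat list \<Rightarrow> bool) \<Rightarrow> nat set \<Rightarrow> nat set set" where
  "spread_family m n d t \<Phi> W = {S. S \<subseteq> vertices m \<and>
    ((\<exists>w. spread_list n d t w \<and> \<Phi> w \<and> set w \<subseteq> S) \<or> S \<inter> W \<noteq> {})}"

lemma upward_spread_family: "upward m (spread_family m n d t \<Phi> W)"
  unfolding upward_def spread_family_def by blast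

text \<open>The property of final lexsegments on which the recursion rests; it passes from
  \<open>\<Phi>\<close> to the lists that satisfy \<open>\<Phi>\<close> after appending n.\<close>

definition up_closed :: "(nat list \<Rightarrow> bool) \<Rightarrow> bool" where
  "up_closed \<Phi> \<longleftrightarrow> (\<forall>w w'. list_all2 (\<le>) w w' \<longrightarrow> \<Phi> w \<longrightarrow> \<Phi> w')"

text \<open>Split along x_n. The colon leads to (n - t, d - 1) with n appended to the tested lists;
  adding x_n leads to (n - 1, d) with n moved into \<open>W\<close>. The indices above n and outside
  \<open>W\<close> are free: no generator involves them. The number (d - 1) t plus the number of
  free indices stays the same, hence still bounds D at the leaves, reached when n = (d - 1) t or d =
  1.\<close>

lemma layered_spread_family:
  assumes t: "1 \<le> t"
    and "up_closed \<Phi>" "n \<le> m" "W \<subseteq> {n<..m}" "1 \<le> d" "(d - 1) * t \<le> n"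
    and "D \<le> (d - 1) * t + card ({n<..m} - W)"
  shows "layered m D (spread_family m n d t \<Phi> W)"
  using assms(2-)
proof (induction n arbitrary: d \<Phi> W rule: less_induct)
  case (less n)
  let ?N = "spread_family m n d t \<Phi> W" and ?free = "{n<..m} - W"
  consider (leaf) "n = (d - 1) * t" | (linear) "(d - 1) * t < n" "d = 1" | (step) "(d - 1) * t < n" "2 \<le> d"
    using less.prems(4,5) by linarith
  then show ?case
  proof cases
    case leaf
    \<comment> \<open>The last index would have to be at least 1 + (d - 1) t = n + 1.\<close>
    have no: "\<not> spread_list n d t w" for w
      using spread_list_bounds(1)[of n d t w "d - 1"] spread_list_bounds(2)[of n d t w "d - 1"]
        leaf less.prems(4) by auto
    define V where "V = vertices n \<union> ?free"
    have V: "V \<subseteq> vertices m" using less.prems(2) by (auto simp: V_def vertices_def)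
    have "card V = n + card ?free"
      unfolding V_def by (subst card_Un_disjoint) (auto simp: vertices_def)
    then have D: "D \<le> card V" using less.prems(6) leaf by simp
    have "vertices m - V = W" using less.prems(2,3) by (auto simp: V_def vertices_def)
    then have "?N = {S. S \<subseteq> vertices m \<and> \<not> S \<subseteq> V}"
      unfolding spread_family_def using no by blast
    then show ?thesis using layered_leaf[OF V D] by simp
  next
    case linear
    \<comment> \<open>The generators are now variables, so the quotient is a polynomial ring in the
      free variables and those failing \<open>\<Phi>\<close>.\<close>
    define V where "V = {i \<in> vertices n. \<not> \<Phi> [i]} \<union> ?free"
    have V: "V \<subseteq> vertices m" using less.prems(2) by (auto simp: V_def vertices_def)
    have "card ?free \<le> card V" by (rule card_mono[OF finite_vertices_subset[OF V]]) (simp add: V_def)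
    then have D: "D \<le> card V" using less.prems(6) linear by simp
    have VW: "vertices m - V = {i \<in> vertices n. \<Phi> [i]} \<union> W"
      using less.prems(2,3) by (auto simp: V_def vertices_def)
    have sp: "spread_list n 1 t w \<longleftrightarrow> (\<exists>i\<in>vertices n. w = [i])" for w
      by (auto simp: spread_list_def length_Suc_conv)
    have "?N = {S. S \<subseteq> vertices m \<and> S \<inter> (vertices m - V) \<noteq> {}}"
      unfolding spread_family_def VW linear(2) sp by auto
    also have "\<dots> = {S. S \<subseteq> vertices m \<and> \<not> S \<subseteq> V}" by blast
    finally show ?thesis using layered_leaf[OF V D] by simp
  next
    case step
    define d' where "d' = d - 1"
    have d': "d = Suc d'" "1 \<le> d'" using step(2) by (simp_all add: d'_def)
    have tn: "t \<le> n"
    proof -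
      have "1 * t \<le> d' * t" using d'(2) by (intro mult_le_mono1)
      moreover have "d' * t < n" using step(1) by (simp add: d'_def)
      ultimately show ?thesis by linarith
    qed
    have n: "1 \<le> n" "n \<in> vertices m" using step(1) less.prems(2) by (simp_all add: vertices_def)
    show ?thesis
    proof (rule layered_step[OF upward_spread_family n(2)])
      show "layered m D {S. insert n S \<in> ?N}"
      proof -
        have "{S. insert n S \<in> ?N} = spread_family m (n - t) d' t (\<lambda>w. \<Phi> (w @ [n])) W"
        proof -
          have "(\<exists>w. spread_list n d t w \<and> \<Phi> w \<and> set w \<subseteq> insert n S) \<longleftrightarrow>
            (\<exists>w. spread_list (n - t) d' t w \<and> \<Phi> (w @ [n]) \<and> set w \<subseteq> S)" (is "?L \<longleftrightarrow> ?R") for S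
          proof
            assume ?L
            then obtain w where w: "spread_list n d t w" "\<Phi> w" "set w \<subseteq> insert n S" by blast
            note b = spread_list_butlast[OF w(1)[unfolded d'(1)] d'(2)]
            have "\<Phi> (butlast w @ [n])" using less.prems(1) b(2) w(2) unfolding up_closed_def by blast
            moreover have "n \<notin> set (butlast w)"
              using b(1) t n(1) by (auto simp: spread_list_def vertices_def)
            then have "set (butlast w) \<subseteq> S" using w(3) in_set_butlastD[of _ w] by blast
            ultimately show ?R using b(1) by blast
          next
            assume ?R
            then obtain w where w: "spread_list (n - t) d' t w" "\<Phi> (w @ [n])" "set w \<subseteq> S" by blast
            have "spread_list n d t (w @ [n])" "set (w @ [n]) \<subseteq> insert n S"
              using spread_list_snoc[OF w(1) d'(2) tn n(1)] w(3) d'(1) by auto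
            then show ?L using w(2) by blast
          qed
          moreover have "insert n S \<inter> W \<noteq> {} \<longleftrightarrow> S \<inter> W \<noteq> {}" for S using less.prems(3) by auto
          ultimately show ?thesis unfolding spread_family_def using n(2) by simp
        qed
        moreover have "layered m D (spread_family m (n - t) d' t (\<lambda>w. \<Phi> (w @ [n])) W)"
        proof (rule less.IH)
          show "n - t < n" using t n(1) by simp
          show "up_closed (\<lambda>w. \<Phi> (w @ [n]))"
            using less.prems(1) unfolding up_closed_def by (meson list_all2_appendI list.rel_intros order.refl)
          show "W \<subseteq> {n - t<..m}" by (rule order.trans[OF less.prems(3)]) auto
          \<comment> \<open>Lowering d costs t in the bound, and the t indices n - t + 1, ..., n, no
            longer met by any generator, become free in exchange.\<close>
          have mul: "(d - 1) * t = (d' - 1) * t + t" using d' by (cases d') simp_all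
          show "(d' - 1) * t \<le> n - t" using step(1) mul by simp
          have "{n - t<..m} - W = {n - t<..n} \<union> ?free" using less.prems(2,3) by auto
          moreover have "card ({n - t<..n} \<union> ?free) = t + card ?free"
            using tn by (subst card_Un_disjoint) auto
          ultimately show "D \<le> (d' - 1) * t + card ({n - t<..m} - W)" using less.prems(6) mul by simp
        qed (use less.prems(2) d'(2) in auto)
        ultimately show ?thesis by simp
      qed
      have "?N \<union> {S. S \<subseteq> vertices m \<and> n \<in> S} = spread_family m (n - 1) d t \<Phi> (insert n W)"
      proof -
        have "vertices (n - 1) = vertices n - {n}" by (auto simp: vertices_def)
        then have sp: "spread_list (n - 1) d t w \<longleftrightarrow> spread_list n d t w \<and> n \<notin> set w" for w
          by (auto simp: spread_list_def)
        have "(\<exists>w. spread_list n d t w \<and> \<Phi> w \<and> set w \<subseteq> S) \<or> S \<inter> W \<noteq> {} \<or> n \<in> S \<longleftrightarrow>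
          (\<exists>w. spread_list (n - 1) d t w \<and> \<Phi> w \<and> set w \<subseteq> S) \<or> S \<inter> insert n W \<noteq> {}" for S
          unfolding sp by blast
        then show ?thesis unfolding spread_family_def by blast
      qed
      moreover have "layered m D (spread_family m (n - 1) d t \<Phi> (insert n W))"
      proof (rule less.IH)
        have "{n - 1<..m} - insert n W = ?free" using n(1) by auto
        then show "D \<le> (d - 1) * t + card ({n - 1<..m} - insert n W)" using less.prems(6) by simp
        have "{n<..m} \<subseteq> {n - 1<..m}" "n \<in> {n - 1<..m}" using n by (auto simp: vertices_def)
        then show "insert n W \<subseteq> {n - 1<..m}" using less.prems(3) by blast
      qed (use less.prems(1,2) step n in \<open>simp_all add: vertices_def\<close>)
      ultimately show "layered m D (?N \<union> {S. S \<subseteq> vertices m \<and> n \<in> S})" by simp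
    qed
  qed
qed

text \<open>A smaller index makes a monomial larger in slex, so \<open>lex_le u w\<close> expresses
  that \<open>w\<close> is slex-smaller than or equal to \<open>u\<close>. In this direction raising
  indices stays inside the final segment.\<close>

primrec lex_le :: "nat list \<Rightarrow> nat list \<Rightarrow> bool" where
  "lex_le [] w \<longleftrightarrow> w = []"
| "lex_le (a # u) w \<longleftrightarrow> (\<exists>b v. w = b # v \<and> length u = length v \<and> (a < b \<or> a = b \<and> lex_le u v))"

lemma lex_le_refl: "lex_le u u"
  by (induction u) simp_all

lemma lex_le_mono: "list_all2 (\<le>) w w' \<Longrightarrow> lex_le u w \<Longrightarrow> lex_le u w'"
proof (induction u arbitrary: w w')
  case (Cons a u)
  then obtain b v where w: "w = b # v" "length u = length v" "a < b \<or> a = b \<and> lex_le u v" by auto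
  then obtain b' v' where w': "w' = b' # v'" "b \<le> b'" "list_all2 (\<le>) v v'"
    using Cons.prems(1) by (auto simp: list_all2_Cons1)
  have "length v = length v'" using w'(3) by (rule list_all2_lengthD)
  then show ?case using w w' Cons.IH[OF w'(3)] by auto
qed simp

lemma lex_le_antisym: "lex_le u w \<Longrightarrow> list_all2 (\<le>) w u \<Longrightarrow> u = w"
  by (induction u arbitrary: w) auto

lemma lex_le_iff:
  "length u = length w \<Longrightarrow> lex_le u w \<longleftrightarrow> u = w \<or> (\<exists>s<length u. take s u = take s w \<and> u ! s < w ! s)"
proof (induction u arbitrary: w)
  case (Cons a u)
  then obtain b v where w: "w = b # v" "length u = length v" by (cases w) auto
  have "(\<exists>s<length (a # u). take s (a # u) = take s w \<and> (a # u) ! s < w ! s) \<longleftrightarrow>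
    a < b \<or> (a = b \<and> (\<exists>s<length u. take s u = take s v \<and> u ! s < v ! s))"
    by (simp only: w(1) length_Cons Ex_less_Suc2 take_Suc_Cons take_0 nth_Cons_0 nth_Cons_Suc list.inject) auto
  then show ?case using Cons.IH[OF w(2)] w by auto
qed simp

lemma up_closed_lex_le: "up_closed (lex_le u)"
  by (auto simp: up_closed_def intro: lex_le_mono)

section \<open>Final spread lexsegment ideals\<close>

context poly_subring
begin

lemma genideal_sqf:
  assumes B: "B \<subseteq> Pow (vertices n)"
  shows "Idl\<^bsub>sub_ring\<^esub> ((\<lambda>X. monomial_poly (sqf X)) ` B) = mon_ideal {S. S \<subseteq> vertices n \<and> (\<exists>X\<in>B. X \<subseteq> S)}"
    (is "Idl\<^bsub>sub_ring\<^esub> ?G = mon_ideal ?N")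
proof
  have up: "upward n ?N" by (auto simp: upward_def)
  have G: "?G \<subseteq> carrier sub_ring" using B by (auto simp: sqf_mem)
  have "?G \<subseteq> mon_ideal ?N"
  proof (clarify)
    fix X assume X: "X \<in> B"
    then have "X \<subseteq> vertices n" using B by blast
    then show "monomial_poly (sqf X) \<in> mon_ideal ?N"
      using X by (auto simp: mon_ideal_iff sqf_mem keys_sqf[OF finite_vertices_subset])
  qed
  then show "Idl\<^bsub>sub_ring\<^esub> ?G \<subseteq> mon_ideal ?N"
    using R.genideal_minimal[of "mon_ideal ?N" ?G] is_ideal_mon_ideal[OF up] by (simp add: ideal_iff)
  have I: "is_ideal (Idl\<^bsub>sub_ring\<^esub> ?G)" using R.genideal_ideal[OF G] by (simp add: ideal_iff)
  show "mon_ideal ?N \<subseteq> Idl\<^bsub>sub_ring\<^esub> ?G"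
  proof
    fix p assume p: "p \<in> mon_ideal ?N"
    show "p \<in> Idl\<^bsub>sub_ring\<^esub> ?G"
    proof (rule ideal_contains_monoms[OF I])
      fix m assume m: "m \<in> supp p"
      then obtain X where X: "X \<in> B" "X \<subseteq> supp m" "supp m \<subseteq> vertices n"
        using p by (auto simp: mon_ideal_iff)
      have fin: "finite X" using X(2,3) by (intro finite_vertices_subset[of X n]) auto
      have "sqf X + (m - sqf X) = m"
        using X(2) by (intro poly_mapping_eqI)
          (auto simp: lookup_add lookup_minus lookup_sqf[OF fin] in_keys_iff subset_iff)
      moreover have "supp (m - sqf X) \<subseteq> supp m" by (auto simp: in_keys_iff lookup_minus)
      then have "monomial_poly (m - sqf X) \<in> A" using X(3) by (auto simp: monom_mem)
      moreover have "monomial_poly (sqf X) \<in> Idl\<^bsub>sub_ring\<^esub> ?G"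
        using R.genideal_self[OF G] X(1) by blast
      ultimately have "monomial_poly (sqf X) * monomial_poly (m - sqf X) \<in> Idl\<^bsub>sub_ring\<^esub> ?G"
        using is_idealD(5)[OF I] by blast
      then show "monomial_poly m \<in> Idl\<^bsub>sub_ring\<^esub> ?G"
        unfolding monom_mult \<open>sqf X + (m - sqf X) = m\<close> .
    qed
  qed
qed

lemma irrelevant_ideal_eq: "irrelevant_ideal n = mon_ideal {S. S \<subseteq> vertices n \<and> S \<noteq> {}}"
proof -
  have "(\<lambda>i. monomial_poly (sing i 1)) ` {1..n} =
      ((\<lambda>X. monomial_poly (sqf X)) ` (\<lambda>i. {i}) ` vertices n :: 'k polynomial set)"
    by (simp add: image_image sqf_def vertices_def)
  then have "irrelevant_ideal n = Idl\<^bsub>sub_ring\<^esub> ((\<lambda>X. monomial_poly (sqf X)) ` (\<lambda>i. {i}) ` vertices n)"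
    unfolding irrelevant_ideal_def sub_ring_eq by (simp only:)
  also have "\<dots> = mon_ideal {S. S \<subseteq> vertices n \<and> (\<exists>X\<in>(\<lambda>i. {i}) ` vertices n. X \<subseteq> S)}"
    by (rule genideal_sqf) auto
  also have "{S. S \<subseteq> vertices n \<and> (\<exists>X\<in>(\<lambda>i. {i}) ` vertices n. X \<subseteq> S)} = {S. S \<subseteq> vertices n \<and> S \<noteq> {}}"
    by auto
  finally show ?thesis .
qed

lemma proj_dim_layered:
  assumes "layered n (card F) N" and F: "facet N F"
  shows "proj_dim sub_ring (quot (mon_ideal N)) = enat (n - card F)"
  unfolding proj_dim_def
proof (rule antisym)
  note N = layered_upward[OF assms(1)]
  have "has_projective_resolution sub_ring (quot (mon_ideal N)) (n - card F)"
    by (rule res_projective_resolution[OF is_ideal_mon_ideal[OF N] layered_res[OF assms(1)]])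
  then show "Inf {enat p |p. has_projective_resolution sub_ring (quot (mon_ideal N)) p}
      \<le> enat (n - card F)"
    by (intro Inf_lower) blast
  show "enat (n - card F)
      \<le> Inf {enat p |p. has_projective_resolution sub_ring (quot (mon_ideal N)) p}"
    using projective_resolution_length_ge[OF N F] by (intro Inf_greatest) auto
qed

lemma depth_layered:
  assumes "layered n (card F) N" and F: "facet N F" and ne: "{} \<notin> N"
  shows "depth n (quot (mon_ideal N)) = enat (card F)"
  unfolding depth_def depth_wrt_def sub_ring_eq[symmetric]
proof (rule antisym)
  note N = layered_upward[OF assms(1)]
  let ?M = "quot (mon_ideal N)" and ?E = "elem_syms (card F)"
  let ?I = "mon_ideal {S. S \<subseteq> vertices n \<and> S \<noteq> {}}"
  have I: "is_ideal ?I" by (rule is_ideal_mon_ideal) (auto simp: upward_def)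
  show "Sup {enat (length as) |as. set as \<subseteq> irrelevant_ideal n \<and> regular_sequence sub_ring ?M as} \<le> enat (card F)"
  proof (rule Sup_least, clarify)
    fix as assume as: "set as \<subseteq> irrelevant_ideal n" "regular_sequence sub_ring ?M as"
    have "supp m \<noteq> {}" if "a \<in> set as" "m \<in> supp a" for a m
      using subsetD[OF as(1) that(1)] that(2) unfolding irrelevant_ideal_eq mon_ideal_iff by blast
    then show "enat (length as) \<le> enat (card F)"
      using regular_sequence_length_le[OF N F as(2)] by simp
  qed
  have E: "set ?E \<subseteq> ?I"
  proof
    fix a assume a: "a \<in> set ?E"
    have "supp m \<noteq> {}" if "m \<in> supp a" for m
    proof
      assume "supp m = {}"
      then have "deg m = 0" by (simp add: deg_def)
      then show False using elem_syms_deg_pos[OF a that] by simp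
    qed
    moreover have "a \<in> A" using a elem_syms_mem by blast
    ultimately show "a \<in> ?I" using supp_vertices by (simp add: mon_ideal_iff)
  qed
  \<comment> \<open>The nonfaces are nonempty and the elementary symmetric polynomials have positive
    degree, so everything lies in the irrelevant ideal; this gives the properness demanded of a
    regular sequence.\<close>
  have "N \<subseteq> {S. S \<subseteq> vertices n \<and> S \<noteq> {}}" using N ne by (auto simp: upward_def)
  then have "mon_ideal N \<subseteq> ?I" unfolding subset_iff[of "mon_ideal N"] mon_ideal_iff by blast
  then have "gen (mon_ideal N) ?E \<subseteq> ?I" by (rule gen_subset[OF I _ E])
  then have "1 \<notin> gen (mon_ideal N) ?E" by (auto simp: mon_ideal_iff)
  moreover have "regs (mon_ideal N) ?E"
    by (rule layered_regs[OF assms(1) elem_syms_mem regs_elem_syms])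
  ultimately have "regular_sequence sub_ring ?M ?E"
    by (simp add: regular_sequence_iff[OF is_ideal_mon_ideal[OF N]] elem_syms_mem)
  moreover have "set ?E \<subseteq> irrelevant_ideal n" using E unfolding irrelevant_ideal_eq .
  ultimately show "enat (card F) \<le> Sup {enat (length as) |as. set as \<subseteq> irrelevant_ideal n \<and> regular_sequence sub_ring ?M as}"
    by (intro Sup_upper CollectI exI[of _ ?E]) simp
qed

end

lemma monomial_of_eq_sqf: "distinct w \<Longrightarrow> monomial_of w = sqf (set w)"
  by (simp add: monomial_of_def sqf_def sum_list_distinct_conv_sum_set)

lemma monomial_of_inject:
  assumes "sorted_wrt (<) w" "sorted_wrt (<) w'"
  shows "monomial_of w = monomial_of w' \<longleftrightarrow> w = w'"
proof
  assume eq: "monomial_of w = monomial_of w'"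
  have d: "distinct w" "distinct w'" using assms by (simp_all add: strict_sorted_iff)
  then have "supp (sqf (set w)) = supp (sqf (set w'))" using eq by (simp add: monomial_of_eq_sqf)
  then have "set w = set w'" by (simp add: keys_sqf)
  then show "w = w'" using assms strict_sorted_equal by blast
qed simp

lemma spread_monomials_eq:
  assumes "1 \<le> t"
  shows "spread_monomials n d t = monomial_of ` {w. spread_list n d t w}"
proof -
  have "spread_list n d t w \<longleftrightarrow>
    length w = d \<and> set w \<subseteq> {1..n} \<and> sorted w \<and> (\<forall>r. Suc r < d \<longrightarrow> w ! Suc r \<ge> w ! r + t)" for w
    using spread_list_sorted[of n d t w] assms strict_sorted_imp_sorted
    by (auto simp: spread_list_def vertices_def)
  then show ?thesis unfolding spread_monomials_def by auto
qed

lemma final_lexsegment_eq: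
  assumes "1 \<le> t" and u: "spread_list n d t u"
  shows "final_lexsegment n d t (monomial_of u) = monomial_of ` {w. spread_list n d t w \<and> lex_le u w}"
proof -
  note su = spread_list_sorted[OF u assms(1)]
  have "monomial_of w = monomial_of u \<or> monomial_of u >\<^sub>s\<^sub>l\<^sub>e\<^sub>x monomial_of w \<longleftrightarrow> lex_le u w"
    if w: "spread_list n d t w" for w
  proof -
    note sw = spread_list_sorted[OF w assms(1)]
    have len: "length u = length w" using u w by (simp add: spread_list_def)
    have "monomial_of u >\<^sub>s\<^sub>l\<^sub>e\<^sub>x monomial_of w \<longleftrightarrow> (\<exists>s<length u. take s u = take s w \<and> u ! s < w ! s)"
      unfolding slex_greater_def
    proof (intro iffI)
      assume "\<exists>is js. sorted_wrt (<) is \<and> sorted_wrt (<) js \<and> length is = length js \<and>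
        monomial_of u = monomial_of is \<and> monomial_of w = monomial_of js \<and>
        (\<exists>s<length is. take s is = take s js \<and> is ! s < js ! s)"
      then show "\<exists>s<length u. take s u = take s w \<and> u ! s < w ! s"
        using monomial_of_inject[OF su] monomial_of_inject[OF sw] by metis
    next
      assume "\<exists>s<length u. take s u = take s w \<and> u ! s < w ! s"
      then show "\<exists>is js. sorted_wrt (<) is \<and> sorted_wrt (<) js \<and> length is = length js \<and>
        monomial_of u = monomial_of is \<and> monomial_of w = monomial_of js \<and>
        (\<exists>s<length is. take s is = take s js \<and> is ! s < js ! s)"
        using su sw len by blast
    qed
    then show ?thesis using lex_le_iff[OF len] monomial_of_inject[OF sw su] by auto
  qed
  then show ?thesis unfolding final_lexsegment_def spread_monomials_eq[OF assms(1)] by auto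
qed

section \<open>The complex of the given lexsegment: a facet of size D and its largest faces\<close>

locale final_lexsegment_family =
  fixes n d t :: nat and u :: "nat list"
  assumes t: "1 \<le> t" and d: "2 \<le> d" and u: "spread_list n d t u" and u0: "u ! 0 = 1"
begin

definition D :: nat where "D = (d - 1) * t"

definition N :: "nat set set" where
  "N = {S. S \<subseteq> vertices n \<and> (\<exists>w. spread_list n d t w \<and> lex_le u w \<and> set w \<subseteq> S)}"

lemma len_u: "length u = d"
  using u by (simp add: spread_list_def)

lemma D_less: "D < n"
  using spread_list_bounds(2)[OF u, of 0] d u0 by (simp add: D_def)

lemma layered_N: "layered n D N"
proof -
  have "layered n D (spread_family n n d t (lex_le u) {})"
    using t d D_less by (intro layered_spread_family up_closed_lex_le) (simp_all add: D_def)
  then show ?thesis by (simp add: N_def spread_family_def)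
qed

lemma empty_not_in_N: "{} \<notin> N"
  using d by (auto simp: N_def spread_list_def)

text \<open>As \<open>u\<close> starts with 1, the first index alone decides. So every spread list
  avoiding 1 belongs to the lexsegment.\<close>

lemma lex_le_head: "length w = d \<Longrightarrow> 1 < w ! 0 \<Longrightarrow> lex_le u w"
  using len_u u0 d by (cases u; cases w) auto

definition F :: "nat set" where
  "F = {n - D<..n}"

lemma card_F: "card F = D"
  using D_less by (simp add: F_def)

lemma F_vertices: "F \<subseteq> vertices n"
  by (auto simp: F_def vertices_def)

lemma F_not_in_N: "F \<notin> N"
proof
  assume "F \<in> N"
  then obtain w where w: "spread_list n d t w" "set w \<subseteq> F" by (auto simp: N_def)
  have "w ! 0 \<in> set w" using w(1) d by (simp add: spread_list_def)
  then have "w ! 0 \<in> F" using w(2) by blast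
  then show False
    using spread_list_bounds(2)[OF w(1), of 0] d D_less by (simp add: F_def D_def)
qed

lemma facet_monomials:
  assumes i: "i \<in> vertices n - F"
  shows "insert i F \<in> N"
proof -
  have i': "1 \<le> i" "i + D \<le> n" using i D_less by (auto simp: F_def vertices_def)
  \<comment> \<open>The list i, n - (d - 2) t, ..., n - t, n. Apart from \<open>i\<close> all
    indices are as large as the spread condition allows, and \<open>i\<close> is at least the first
    index of \<open>u\<close>; hence the list lies componentwise above \<open>u\<close>. The gap
    after \<open>i\<close> suffices because \<open>i + D \<le> n\<close>.\<close>
  define w where "w = map (\<lambda>k. if k = 0 then i else n - (d - 1 - k) * t) [0..<d]"
  have wk: "w ! k + (d - 1 - k) * t = n" if "k < d" "k \<noteq> 0" for k
  proof -
    have "(d - 1 - k) * t \<le> D" unfolding D_def by (intro mult_le_mono1) simp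
    then show ?thesis using that D_less by (simp add: w_def)
  qed
  have w0: "w ! 0 = i" using d by (simp add: w_def)
  have len: "length w = d" by (simp add: w_def)
  have wF: "w ! k \<in> F" if "k < d" "k \<noteq> 0" for k
  proof -
    have "Suc (d - 1 - k) * t \<le> D" unfolding D_def using that by (intro mult_le_mono1) simp
    then have "(d - 1 - k) * t < D" using t by simp
    then have "n - D < w ! k" using wk[OF that] D_less by linarith
    moreover have "w ! k \<le> n" using wk[OF that] by linarith
    ultimately show ?thesis by (simp add: F_def)
  qed
  have set_w: "set w \<subseteq> insert i F"
  proof
    fix x assume "x \<in> set w"
    then obtain k where "k < d" "x = w ! k" using len by (auto simp: in_set_conv_nth)
    then show "x \<in> insert i F" using w0 wF[of k] by (cases "k = 0") auto
  qed
  have sub: "insert i F \<subseteq> vertices n" using i F_vertices by auto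
  have "spread_list n d t w"
    unfolding spread_list_def
  proof (intro conjI allI impI)
    show "set w \<subseteq> vertices n" using set_w sub by blast
    fix r assume r: "Suc r < d"
    have s: "w ! Suc r + (d - 1 - Suc r) * t = n" using wk[OF r] by simp
    have e: "(d - 1 - r) * t = t + (d - 1 - Suc r) * t"
    proof -
      have "d - 1 - r = Suc (d - 1 - Suc r)" using r by simp
      then show ?thesis by (simp only: mult_Suc)
    qed
    show "w ! r + t \<le> w ! Suc r"
    proof (cases "r = 0")
      case True
      then have "(d - 1 - r) * t = D" by (simp add: D_def)
      moreover have "w ! r = i" using w0 True by simp
      ultimately show ?thesis using s e i'(2) by linarith
    next
      case False
      then have "w ! r + (d - 1 - r) * t = n" using wk[of r] r by simp
      then show ?thesis using s e by linarith
    qed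
  qed (rule len)
  moreover have "list_all2 (\<le>) u w"
    unfolding list_all2_conv_all_nth
  proof (intro conjI allI impI)
    fix k assume "k < length u"
    then have k: "k < d" by (simp add: len_u)
    show "u ! k \<le> w ! k"
      using spread_list_bounds(2)[OF u k] wk[OF k] w0 u0 i'(1) by (cases "k = 0") simp_all
  qed (simp add: len len_u)
  then have "lex_le u w" using lex_le_mono lex_le_refl by blast
  ultimately show ?thesis using set_w sub unfolding N_def by blast
qed

text \<open>Componentwise the least spread list, hence the slex-largest monomial. If
  \<open>u\<close> is this one, the lexsegment consists of all spread monomials of degree d.\<close>

definition max_list :: "nat list" where
  "max_list = map (\<lambda>k. 1 + k * t) [0..<d]"

lemma max_list_le: "spread_list n d t w \<Longrightarrow> list_all2 (\<le>) max_list w"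
  unfolding list_all2_conv_all_nth using spread_list_bounds(1)[of n d t w]
  by (auto simp: max_list_def spread_list_def)

text \<open>More than D vertices contain a spread list. If \<open>u\<close> is the slex-largest
  monomial, that list is in the lexsegment at once; otherwise vertex 1 is discarded first, at the
  cost of one vertex, and the list found starts beyond 1.\<close>

lemma card_face_le:
  assumes V: "V \<subseteq> vertices n" "V \<notin> N"
  shows "card V \<le> (if u = max_list then D else 1 + D)"
proof (rule ccontr)
  assume c: "\<not> card V \<le> (if u = max_list then D else 1 + D)"
  show False
  proof (cases "u = max_list")
    case True
    then obtain w where w: "spread_list n d t w" "set w \<subseteq> V"
      using spread_list_exists[OF V(1), of d t] c by (auto simp: D_def)
    have "lex_le u w" using max_list_le[OF w(1)] lex_le_mono lex_le_refl True by blast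
    then show False using w V unfolding N_def by blast
  next
    case False
    have "card V - 1 \<le> card (V - {1})" by (simp add: card_Diff_singleton_if)
    then have "(d - 1) * t < card (V - {1})" using c False by (simp add: D_def)
    then obtain w where w: "spread_list n d t w" "set w \<subseteq> V - {1}"
      using spread_list_exists[of "V - {1}" n d t] V(1) by blast
    have "w ! 0 \<in> set w" using w(1) d by (simp add: spread_list_def)
    then have "w ! 0 \<in> vertices n" "w ! 0 \<noteq> 1" using w V(1) by auto
    then have "1 < w ! 0" by (simp add: vertices_def)
    then have "lex_le u w" using w(1) lex_le_head by (simp add: spread_list_def)
    then show False using w V unfolding N_def by blast
  qed
qed

text \<open>If \<open>u\<close> is not the slex-largest monomial, {1, ..., 1 + D} is a face: the
  only spread list inside it is \<open>max_list\<close>, which comes strictly before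
  \<open>u\<close>.\<close>

lemma face_exists: "\<exists>V. V \<subseteq> vertices n \<and> V \<notin> N \<and> card V = (if u = max_list then D else 1 + D)"
proof (cases "u = max_list")
  case True
  then show ?thesis using F_vertices F_not_in_N card_F by auto
next
  case False
  have "{1..1 + D} \<notin> N"
  proof
    assume "{1..1 + D} \<in> N"
    then obtain w where w: "spread_list n d t w" "lex_le u w" "set w \<subseteq> vertices (1 + D)"
      by (auto simp: N_def vertices_def)
    \<comment> \<open>Reread with 1 + D as the number of variables, the upper bounds for the indices
      become \<open>1 + k * t\<close> and match the lower bounds.\<close>
    have w': "spread_list (1 + D) d t w" using w(1,3) by (simp add: spread_list_def)
    have le: "w ! k \<le> 1 + k * t" if "k < d" for k
    proof -
      have "D = k * t + (d - 1 - k) * t"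
        using that by (simp add: D_def add_mult_distrib[symmetric])
      then show ?thesis using spread_list_bounds(2)[OF w' that] by linarith
    qed
    have "list_all2 (\<le>) w max_list"
      unfolding list_all2_conv_all_nth using le w(1) by (auto simp: max_list_def spread_list_def)
    then have "list_all2 (\<le>) w u"
      using max_list_le[OF u] list_all2_trans[of "(\<le>)" "(\<le>)" "(\<le>)" w max_list u] by auto
    then have "u = w" using lex_le_antisym w(2) by blast
    moreover have "w = max_list"
      using le spread_list_bounds(1)[OF w(1)] w(1)
      by (intro nth_equalityI) (auto simp: max_list_def spread_list_def intro: antisym)
    ultimately show False using False by simp
  qed
  moreover have "{1..1 + D} \<subseteq> vertices n" using D_less by (auto simp: vertices_def)
  ultimately show ?thesis using False by (intro exI[of _ "{1..1 + D}"]) simp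
qed

end

theorem corollary2p9:
  fixes n t d :: nat and u :: monomial
    and S :: "'k::field polynomial ring" and T :: "'k polynomial set"
  assumes "n \<ge> 1" and "t \<ge> 1" and "d \<ge> 2"
    and "u \<in> spread_monomials n d t" and "min_var u = 1"
    and "S = poly_ring n" and "T = final_lexsegment_ideal n d t u"
  shows "proj_dim S (quot_module S T) = enat (n - (d - 1) * t) \<and>
    depth n (quot_module S T) = enat ((d - 1) * t) \<and>
    krull_dim (S Quot T) =
      (if u = monomial_of (map (\<lambda>k. 1 + k * t) [0..<d])
       then enat ((d - 1) * t) else enat (1 + (d - 1) * t))"
proof -
  interpret poly_subring "carrier (poly_ring n :: 'k polynomial ring)" n
    by (rule poly_subring_carrier)
  obtain us where us: "spread_list n d t us" "u = monomial_of us"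
    using assms(4) unfolding spread_monomials_eq[OF assms(2)] by blast
  note sorted_us = spread_list_sorted[OF us(1) assms(2)]
  have len: "length us = d" using us(1) by (simp add: spread_list_def)
  have dist: "distinct us" using sorted_us by (simp add: strict_sorted_iff)
  have "us ! 0 = 1"
  proof -
    have ne: "us \<noteq> []" using len assms(3) by auto
    have "Min (set us) = 1"
      using assms(5) us(2) dist by (simp add: min_var_def monomial_of_eq_sqf keys_sqf)
    moreover have "Min (set us) = us ! 0"
    proof (rule Min_eqI)
      fix y assume "y \<in> set us"
      then obtain k where "k < length us" "y = us ! k" by (auto simp: in_set_conv_nth)
      then show "us ! 0 \<le> y"
        using sorted_wrt_nth_less[OF sorted_us, of 0 k] by (cases "k = 0") auto
    qed (use ne in auto)
    ultimately show ?thesis by simp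
  qed
  then interpret L: final_lexsegment_family n d t us
    by unfold_locales (use us assms in auto)
  have S: "S = sub_ring" using assms(6) by (simp add: sub_ring_eq)
  have "monomial_of w = sqf (set w)" if "spread_list n d t w" for w
    using spread_list_sorted[OF that assms(2)] by (simp add: monomial_of_eq_sqf strict_sorted_iff)
  then have "monomial_poly ` final_lexsegment n d t u =
    ((\<lambda>X. monomial_poly (sqf X)) ` set ` {w. spread_list n d t w \<and> lex_le us w} :: 'k polynomial set)"
    unfolding us(2) final_lexsegment_eq[OF assms(2) us(1)] image_image by (intro image_cong) auto
  then have "T = Idl\<^bsub>sub_ring\<^esub> ((\<lambda>X. monomial_poly (sqf X)) ` set ` {w. spread_list n d t w \<and> lex_le us w})"
    unfolding assms(7) final_lexsegment_ideal_def sub_ring_eq by (simp only:)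
  also have "\<dots> = mon_ideal {S. S \<subseteq> vertices n \<and> (\<exists>X\<in>set ` {w. spread_list n d t w \<and> lex_le us w}. X \<subseteq> S)}"
    by (rule genideal_sqf) (auto simp: spread_list_def)
  also have "{S. S \<subseteq> vertices n \<and> (\<exists>X\<in>set ` {w. spread_list n d t w \<and> lex_le us w}. X \<subseteq> S)} = L.N"
    unfolding L.N_def by blast
  finally have T: "T = mon_ideal L.N" .
  have facet: "facet L.N L.F"
    unfolding facet_def using L.F_vertices L.F_not_in_N L.facet_monomials by blast
  have layered: "layered n (card L.F) L.N" using L.layered_N by (simp add: L.card_F)
  note N = layered_upward[OF L.layered_N]
  have "krull_dim (sub_ring Quot mon_ideal L.N) = enat (if us = L.max_list then L.D else 1 + L.D)"
  proof (rule antisym)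
    show "krull_dim (sub_ring Quot mon_ideal L.N) \<le> enat (if us = L.max_list then L.D else 1 + L.D)"
      by (rule krull_dim_le[OF N L.card_face_le])
    obtain V where V: "V \<subseteq> vertices n" "V \<notin> L.N" "card V = (if us = L.max_list then L.D else 1 + L.D)"
      using L.face_exists by blast
    show "enat (if us = L.max_list then L.D else 1 + L.D) \<le> krull_dim (sub_ring Quot mon_ideal L.N)"
      using krull_dim_ge[OF N V(1,2)] unfolding V(3) .
  qed
  moreover have "us = L.max_list \<longleftrightarrow> u = monomial_of (map (\<lambda>k. 1 + k * t) [0..<d])"
  proof -
    have "sorted_wrt (<) L.max_list"
      using assms(2) by (simp add: L.max_list_def sorted_wrt_iff_nth_less)
    then show ?thesis using monomial_of_inject[OF sorted_us] us(2) by (simp add: L.max_list_def)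
  qed
  ultimately show ?thesis
    using proj_dim_layered[OF layered facet] depth_layered[OF layered facet L.empty_not_in_N]
    unfolding S T L.card_F L.D_def by simp
qed

end
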